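(* Let $\mathbb{B}$ be the open unit ball of a complex Banach space. Let $\omega$ and $\mu$ be normal functions and let $\varphi\in H(\mathbb{B})$ be such that the set $E_{\varepsilon,\rho}$ is relatively compact in $\mathbb{B}$ for every $\varepsilon>0$ and every $\rho\in(0,1)$. Then $T_{\varphi}:\mathcal{B}_{\mathcal{R}}(\mathbb{B})_{\omega,0}\to\mathcal{B}_{\mathcal{R}}(\mathbb{B})_{\mu,0}$ is compact if and only if $$\lim_{\|z\|\to1}\mu(z)|\mathcal{R}\varphi(z)|\int_0^{\|z\|}\frac{1}{\omega(t)}\,dt=0.$$
   Context: A positive continuous function $\omega$ on $[0,1)$ is normal if there are constants $\delta\in[0,1)$ and $0<a<b<\infty$ such that on $[\delta,1)$ the function $\omega(r)/(1-r)^a$ is decreasing and $\omega(r)/(1-r)^b$ is increasing. A normal function is extended to $\mathbb{B}$ by $\omega(z)=\omega(\|z\|)$. $H(\mathbb{B})$ is the set of holomorphic functions $\mathbb{B}\to\mathbb{C}$. For $f\in H(\mathbb{B})$, $\mathcal{R}f(z)=Df(z)z$, where $Df(z)$ is the Fréchet derivative of $f$ at $z$. For a normal $\omega$, the Bloch-type space $\mathcal{B}_{\mathcal{R}}(\mathbb{B})_{\omega}$ is the set of $f\in H(\mathbb{B})$ with $\sup_{z\in\mathbb{B}}\omega(z)|\mathcal{R}f(z)|<\infty$, with norm $\|f\|_{\mathcal{R},\omega}=|f(0)|+\sup_{z\in\mathbb{B}}\omega(z)|\mathcal{R}f(z)|$ (a Banach space). The little Bloch-type space $\mathcal{B}_{\mathcal{R}}(\mathbb{B})_{\omega,0}$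 is the closed subspace of those $f\in H(\mathbb{B})$ with $\lim_{\|z\|\to1}\omega(z)|\mathcal{R}f(z)|=0$. For $\varphi\in H(\mathbb{B})$, the extended Cesàro operator is $T_{\varphi}f(z)=\int_0^1 f(tz)\,\mathcal{R}\varphi(tz)\,\frac{1}{t}\,dt$ for $f\in H(\mathbb{B})$, $z\in\mathbb{B}$. Saying that $T_\varphi$ is compact between two spaces means that it maps the first into the second and is a compact linear operator. For $\varepsilon>0$, $\rho\in(0,1)$, $$E_{\varepsilon,\rho}=\{z\in\mathbb{B}:\ \|z\|\le\rho,\ \exists s\in[1,\rho^{-1}]\text{ with } sz\in\mathbb{B}\text{ and }\mu(sz)|\mathcal{R}\varphi(sz)|\ge\varepsilon\}.$$ Limits as $\|z\|\to1$ are uniform over all $z\in\mathbb{B}$ with $\|z\|\to 1$. *)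

theory Defs
  imports "HOL-Complex_Analysis.Complex_Analysis"
begin

text \<open>Complex Banach spaces: the underlying real Banach space structure is the one obtained
  by restriction of scalars.\<close>

class complex_banach = banach +
  fixes scaleC :: "complex \<Rightarrow> 'a \<Rightarrow> 'a"
  assumes scaleC_add_right: "scaleC c (x + y) = scaleC c x + scaleC c y"
    and scaleC_add_left: "scaleC (c + d) x = scaleC c x + scaleC d x"
    and scaleC_scaleC: "scaleC c (scaleC d x) = scaleC (c * d) x"
    and scaleC_of_real: "scaleC (complex_of_real r) x = r *\<^sub>R x"
    and norm_scaleC: "norm (scaleC c x) = cmod c * norm x"

text \<open>The word ``decreasing'' may be read weakly or strictly: replacing \<open>a\<close> and \<open>b\<close> by a
  slightly smaller and a slightly larger exponent turns weak monotonicity into strict.\<close>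

definition normal_weight :: "(real \<Rightarrow> real) \<Rightarrow> bool" where
  "normal_weight \<omega> \<longleftrightarrow>
     continuous_on {0..<1} \<omega> \<and> (\<forall>r\<in>{0..<1}. 0 < \<omega> r) \<and>
     (\<exists>\<delta> a b. 0 \<le> \<delta> \<and> \<delta> < 1 \<and> 0 < a \<and> a < b \<and>
        antimono_on {\<delta>..<1} (\<lambda>r. \<omega> r / (1 - r) powr a) \<and>
        mono_on {\<delta>..<1} (\<lambda>r. \<omega> r / (1 - r) powr b))"

text \<open>A function on the unit ball is represented by the function on the whole type that is
  \<open>undefined\<close> off the ball, so that equality is equality on the ball.  A complex Frechet
  derivative is a real one that is homogeneous over the complex numbers.\<close>

definition hol_ball :: "('a::complex_banach \<Rightarrow> complex) set" where
  "hol_ball = {f \<in> ball 0 1 \<rightarrow>\<^sub>E UNIV.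
     \<forall>z\<in>ball 0 1. \<exists>D. (f has_derivative D) (at z) \<and> (\<forall>c x. D (scaleC c x) = c * D x)}"

definition radial_deriv :: "('a::complex_banach \<Rightarrow> complex) \<Rightarrow> 'a \<Rightarrow> complex" where
  "radial_deriv f z = frechet_derivative f (at z) z"

definition to_sphere :: "'a::complex_banach filter" where
  "to_sphere = filtercomap norm (at_left 1)"

definition bloch_norm :: "(real \<Rightarrow> real) \<Rightarrow> ('a::complex_banach \<Rightarrow> complex) \<Rightarrow> real" where
  "bloch_norm \<omega> f =
     cmod (f 0) + (SUP z\<in>ball 0 1. \<omega> (norm z) * cmod (radial_deriv f z))"

text \<open>By the maximum principle on complex lines through \<open>0\<close>, for a normal weight the limit
  condition already implies that the supremum in \<open>bloch_norm \<omega>\<close> is finite.\<close>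

definition little_bloch :: "(real \<Rightarrow> real) \<Rightarrow> ('a::complex_banach \<Rightarrow> complex) set" where
  "little_bloch \<omega> = {f \<in> hol_ball.
     ((\<lambda>z. \<omega> (norm z) * cmod (radial_deriv f z)) \<longlongrightarrow> 0) to_sphere}"

text \<open>The integrand at the single point \<open>t = 0\<close> is immaterial.\<close>

definition cesaro ::
    "('a::complex_banach \<Rightarrow> complex) \<Rightarrow> ('a \<Rightarrow> complex) \<Rightarrow> 'a \<Rightarrow> complex" where
  "cesaro \<phi> f = (\<lambda>z\<in>ball 0 1.
     integral {0..1} (\<lambda>t. f (t *\<^sub>R z) * radial_deriv \<phi> (t *\<^sub>R z) * (1 / complex_of_real t)))"

definition relatively_compact_in :: "'b topology \<Rightarrow> 'b set \<Rightarrow> bool" where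
  "relatively_compact_in X S \<longleftrightarrow> S \<subseteq> topspace X \<and> compactin X (X closure_of S)"

text \<open>The distance induced by a norm \<open>N\<close> on a linear space \<open>Y\<close> of functions on the unit ball.
  It is set to \<open>0\<close> off \<open>Y\<close>, since \<open>Metric_space\<close> requires symmetry and nonnegativity for
  all arguments.\<close>

definition fun_dist ::
    "('a::complex_banach \<Rightarrow> complex) set \<Rightarrow> (('a \<Rightarrow> complex) \<Rightarrow> real) \<Rightarrow>
     ('a \<Rightarrow> complex) \<Rightarrow> ('a \<Rightarrow> complex) \<Rightarrow> real" where
  "fun_dist Y N f g = (if f \<in> Y \<and> g \<in> Y then N (\<lambda>z\<in>ball 0 1. f z - g z) else 0)"

definition compact_linear_operator ::
    "('a::complex_banach \<Rightarrow> complex) set \<Rightarrow> (('a \<Rightarrow> complex) \<Rightarrow> real) \<Rightarrow>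
     ('a \<Rightarrow> complex) set \<Rightarrow> (('a \<Rightarrow> complex) \<Rightarrow> real) \<Rightarrow>
     (('a \<Rightarrow> complex) \<Rightarrow> 'a \<Rightarrow> complex) \<Rightarrow> bool" where
  "compact_linear_operator X NX Y NY T \<longleftrightarrow>
     T \<in> X \<rightarrow> Y \<and>
     (\<forall>f\<in>X. \<forall>g\<in>X. T (\<lambda>z\<in>ball 0 1. f z + g z) = (\<lambda>z\<in>ball 0 1. T f z + T g z)) \<and>
     (\<forall>c. \<forall>f\<in>X. T (\<lambda>z\<in>ball 0 1. c * f z) = (\<lambda>z\<in>ball 0 1. c * T f z)) \<and>
     (\<forall>S\<subseteq>X. (\<exists>C. \<forall>f\<in>S. NX f \<le> C) \<longrightarrow>
        relatively_compact_in (Metric_space.mtopology Y (fun_dist Y NY)) (T ` S))"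

definition E_set ::
    "(real \<Rightarrow> real) \<Rightarrow> ('a::complex_banach \<Rightarrow> complex) \<Rightarrow> real \<Rightarrow> real \<Rightarrow> 'a set" where
  "E_set \<mu> \<phi> \<epsilon> \<rho> = {z \<in> ball 0 1. norm z \<le> \<rho> \<and>
     (\<exists>s\<in>{1..inverse \<rho>}. s *\<^sub>R z \<in> ball 0 1 \<and>
        \<mu> (norm (s *\<^sub>R z)) * cmod (radial_deriv \<phi> (s *\<^sub>R z)) \<ge> \<epsilon>)}"

end

theory Submission
  imports Defs
begin

text \<open>
  Since \<open>\<R>(T f) = f \<cdot> \<R>\<phi>\<close>, everything is about the size of \<open>\<mu> |\<R>\<phi>| |f|\<close> near the sphere, and on the
  unit ball of the Bloch-type space \<open>|f(z)|\<close> is of the exact order \<open>growth \<omega> \<parallel>z\<parallel> = 1 + \<integral>\<^sub>0 1/\<omega>\<close>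
  (integral up to \<open>\<parallel>z\<parallel>\<close>).  The upper estimate comes from integrating along rays.  The lower one is
  attained by the lacunary polynomials \<open>\<Sum> 2\<^bsup>-k\<^esup> L(w)\<^bsup>2^k\<^esup> / \<omega>(1 - 2\<^bsup>-k\<^esup>)\<close> in a functional \<open>L\<close> norming \<open>z\<close>.

  If \<open>T\<close> is compact, the image of the unit ball is totally bounded in the little space, hence its
  elements satisfy the little-space condition uniformly; inserting the lacunary polynomials gives
  the limit.  Conversely, the limit makes \<open>\<mu> |\<R>\<phi>| |f - g|\<close> small near the sphere uniformly on bounded
  sets; where \<open>\<parallel>z\<parallel> \<le> \<rho>\<close> it is small if \<open>\<mu> |\<R>\<phi>| < \<epsilon>\<close>, and the remaining points lie in the relatively
  compact set \<open>E\<close>, on which bounded families are equi-Lipschitz and thus totally bounded in the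
  uniform norm.  As the little space is complete, totally bounded images are relatively compact.
\<close>

section \<open>Holomorphic functions on a complex Banach space\<close>

text \<open>In infinite dimension the closed balls of radius less than 1 are not compact, so bounded
  families need not be totally bounded in the uniform norm there; the sets \<open>E_set\<close>
  supply compactness exactly where \<mu>|R\<phi>| is not small. Compactness is handled through
  finite nets, not through sequences. The exponents of the test polynomials are dyadic because the
  radial derivative multiplies the k-th term by 2^k and cancels its 2^-k: the derivative becomes a
  sum bounded by a multiple of 1/\<omega>, while the coefficients are the terms of a dyadic Riemann
  sum for the integral of 1/\<omega>. Polynomials in a bounded functional lie in the little space of
  every normal weight, so they can be inserted as they are. Function theory is reduced to one
  variable: complex lines give Cauchy estimates and the maximum principle, and a circle integral
  shows that \<open>radial_deriv\<close> of a holomorphic function is holomorphic, on which the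
  holomorphy of T f rests.\<close>

lemma bounded_bilinear_scaleC: "bounded_bilinear (scaleC :: complex \<Rightarrow> 'a \<Rightarrow> 'a::complex_banach)"
proof
  fix r :: real and a b :: complex and x y :: 'a
  show "scaleC (a + b) x = scaleC a x + scaleC b x" by (rule scaleC_add_left)
  show "scaleC a (x + y) = scaleC a x + scaleC a y" by (rule scaleC_add_right)
  show "scaleC (r *\<^sub>R a) x = r *\<^sub>R scaleC a x"
    using scaleC_scaleC[of "complex_of_real r" a x] by (simp add: scaleC_of_real scaleR_conv_of_real)
  show "scaleC a (r *\<^sub>R x) = r *\<^sub>R scaleC a x"
    using scaleC_scaleC[of "complex_of_real r" a x] scaleC_scaleC[of a "complex_of_real r" x]
    by (simp add: scaleC_of_real mult.commute)
  show "\<exists>K. \<forall>(a::complex) x::'a. norm (scaleC a x) \<le> norm a * norm x * K"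
    by (intro exI[of _ 1]) (simp add: norm_scaleC)
qed

interpretation scaleC: bounded_bilinear "scaleC :: complex \<Rightarrow> 'a \<Rightarrow> 'a::complex_banach"
  by (rule bounded_bilinear_scaleC)

lemma scaleC_one [simp]: "scaleC 1 x = (x::'a::complex_banach)"
  using scaleC_of_real[of 1 x] by simp

text \<open>Names the derivative whose existence \<open>hol_ball\<close> asserts. Real
  differentiability and complex homogeneity are kept apart, so that the calculus of
  \<open>has_derivative\<close> applies directly and only homogeneity has to be checked by
  hand.\<close>

definition has_cderiv ::
    "('a::complex_banach \<Rightarrow> complex) \<Rightarrow> ('a \<Rightarrow> complex) \<Rightarrow> 'a \<Rightarrow> bool" where
  "has_cderiv f D z \<longleftrightarrow> (f has_derivative D) (at z) \<and> (\<forall>c x. D (scaleC c x) = c * D x)"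

definition cdiff_on :: "('a::complex_banach \<Rightarrow> complex) \<Rightarrow> 'a set \<Rightarrow> bool" where
  "cdiff_on f U \<longleftrightarrow> (\<forall>z\<in>U. \<exists>D. has_cderiv f D z)"

lemma hol_ball_iff: "f \<in> hol_ball \<longleftrightarrow> f \<in> extensional (ball 0 1) \<and> cdiff_on f (ball 0 1)"
  by (auto simp: hol_ball_def cdiff_on_def has_cderiv_def PiE_def)

lemma has_cderiv_frechet:
  assumes "has_cderiv f D z" shows "frechet_derivative f (at z) = D"
  using assms frechet_derivative_at has_cderiv_def by metis

lemma cdiff_on_frechet:
  assumes "cdiff_on f U" "z \<in> U" shows "has_cderiv f (frechet_derivative f (at z)) z"
  using assms has_cderiv_frechet unfolding cdiff_on_def by metis

lemma cdiff_on_subset: "cdiff_on f U \<Longrightarrow> V \<subseteq> U \<Longrightarrow> cdiff_on f V"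
  by (auto simp: cdiff_on_def)

lemma cdiff_on_isCont:
  assumes "cdiff_on f U" "z \<in> U" shows "isCont f z"
  using assms has_derivative_continuous unfolding cdiff_on_def has_cderiv_def by blast

lemma cdiff_on_continuous: "cdiff_on f U \<Longrightarrow> continuous_on U f"
  by (simp add: cdiff_on_isCont continuous_at_imp_continuous_on)

lemma has_cderiv_cong:
  assumes "has_cderiv f D z" "open U" "z \<in> U" "\<And>w. w \<in> U \<Longrightarrow> f w = g w"
  shows "has_cderiv g D z"
  using assms has_derivative_transform_within_open unfolding has_cderiv_def by blast

lemma has_cderiv_const: "has_cderiv (\<lambda>_. k) (\<lambda>_. 0) z"
  by (simp add: has_cderiv_def)

lemma has_cderiv_diff:
  "has_cderiv f D z \<Longrightarrow> has_cderiv g E z \<Longrightarrow> has_cderiv (\<lambda>z. f z - g z) (\<lambda>h. D h - E h) z"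
  by (auto simp: has_cderiv_def algebra_simps intro: has_derivative_diff)

lemma has_cderiv_mult:
  "has_cderiv f D z \<Longrightarrow> has_cderiv g E z \<Longrightarrow>
   has_cderiv (\<lambda>z. f z * g z) (\<lambda>h. f z * E h + D h * g z) z"
  by (auto simp: has_cderiv_def algebra_simps intro!: derivative_eq_intros)

lemma has_cderiv_cmult:
  "has_cderiv f D z \<Longrightarrow> has_cderiv (\<lambda>z. c * f z) (\<lambda>h. c * D h) z"
  using has_cderiv_mult[OF has_cderiv_const[of c z]] by simp

lemma has_cderiv_shift:
  assumes "has_cderiv f D (z + a)" shows "has_cderiv (\<lambda>w. f (w + a)) D z"
proof -
  have "((\<lambda>w. w + a) has_derivative (\<lambda>h. h)) (at z)"
    by (auto intro!: derivative_eq_intros)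
  then have "(f \<circ> (\<lambda>w. w + a) has_derivative D \<circ> (\<lambda>h. h)) (at z)"
    using assms by (intro diff_chain_at) (auto simp: has_cderiv_def)
  then show ?thesis using assms by (simp add: has_cderiv_def o_def)
qed

lemma has_cderiv_scaleC_arg:
  assumes "has_cderiv f D (scaleC c z)" shows "has_cderiv (\<lambda>w. f (scaleC c w)) (\<lambda>h. c * D h) z"
proof -
  have "((\<lambda>w. scaleC c w) has_derivative (\<lambda>h. scaleC c h)) (at z)"
    by (intro scaleC.FDERIV[THEN has_derivative_eq_rhs]) (auto intro!: derivative_eq_intros
      simp: scaleC.zero_left)
  then have "(f \<circ> scaleC c has_derivative D \<circ> scaleC c) (at z)"
    using assms by (intro diff_chain_at) (auto simp: has_cderiv_def)
  then show ?thesis using assms by (auto simp: has_cderiv_def o_def)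
qed

text \<open>The bridge to complex analysis in one variable. Homogeneity turns the real derivative of
  the restriction to a complex line, which sends c to \<open>D (scaleC c h)\<close>, into
  multiplication by \<open>D h\<close>.\<close>

lemma has_cderiv_line:
  assumes "has_cderiv f D (z + scaleC \<zeta> h)"
  shows "((\<lambda>\<zeta>. f (z + scaleC \<zeta> h)) has_field_derivative D h) (at \<zeta>)"
proof -
  have "((\<lambda>\<zeta>. z + scaleC \<zeta> h) has_derivative (\<lambda>c. scaleC c h)) (at \<zeta>)"
    by (auto intro!: derivative_eq_intros scaleC.FDERIV[THEN has_derivative_eq_rhs]
      simp: scaleC.zero_right)
  then have "(f \<circ> (\<lambda>\<zeta>. z + scaleC \<zeta> h) has_derivative D \<circ> (\<lambda>c. scaleC c h)) (at \<zeta>)"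
    using assms by (intro diff_chain_at) (auto simp: has_cderiv_def)
  then show ?thesis using assms 
    by (auto simp: has_cderiv_def o_def has_field_derivative_def mult.commute fun_eq_iff elim!: has_derivative_eq_rhs)
qed

text \<open>\<open>D h\<close> is the derivative at 0 of the function \<zeta> \<mapsto> f(z +
  \<zeta>h) on a disc of radius d / |h|, so the one-variable Cauchy inequality applies.\<close>

lemma Cauchy_estimate:
  fixes f :: "'a::complex_banach \<Rightarrow> complex"
  assumes f: "cdiff_on f (ball z d)" and M: "\<And>w. w \<in> ball z d \<Longrightarrow> cmod (f w) \<le> M"
    and d: "0 < d" and D: "has_cderiv f D z"
  shows "cmod (D h) \<le> M / d * norm h"
proof (cases "h = 0")
  case True
  then show ?thesis using D linear_0[OF has_derivative_linear] by (auto simp: has_cderiv_def)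
next
  case False
  have M0: "0 \<le> M" using order_trans[OF norm_ge_zero M[of z]] d by simp
  \<comment> \<open>The radius is kept strictly below d so that the closed disc lands in the open
    ball; s tends to d afterwards.\<close>
  have *: "cmod (D h) \<le> M / (s / norm h)" if s: "0 < s" "s < d" for s
  proof -
    define F where "F = (\<lambda>\<zeta>. f (z + scaleC \<zeta> h))"
    have in_ball: "z + scaleC \<zeta> h \<in> ball z d" if "cmod \<zeta> \<le> s / norm h" for \<zeta>
      using that s False by (simp add: dist_norm norm_scaleC field_simps)
    have der: "(F has_field_derivative frechet_derivative f (at (z + scaleC \<zeta> h)) h) (at \<zeta>)"
      if "cmod \<zeta> \<le> s / norm h" for \<zeta>
      unfolding F_def using has_cderiv_line cdiff_on_frechet[OF f in_ball[OF that]] by blast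
    have "F holomorphic_on cball 0 (s / norm h)"
      by (intro holomorphic_onI) (use der in \<open>auto simp: field_differentiable_def intro: has_field_derivative_at_within\<close>)
    then have "cmod ((deriv ^^ 1) F 0) \<le> fact 1 * M / (s / norm h) ^ 1"
      using s False in_ball M
      by (intro Cauchy_inequality) (auto intro: holomorphic_on_subset holomorphic_on_imp_continuous_on simp: F_def)
    moreover have "deriv F 0 = D h"
      unfolding F_def by (intro DERIV_imp_deriv has_cderiv_line) (use D in \<open>simp add: scaleC.zero_left\<close>)
    ultimately show ?thesis by simp
  qed
  have "((\<lambda>s. M / (s / norm h)) \<longlongrightarrow> M / (d / norm h)) (at_left d)"
    using d False by (intro tendsto_intros) auto
  moreover have "\<forall>\<^sub>F s in at_left d. cmod (D h) \<le> M / (s / norm h)"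
    using eventually_at_left[of 0 d] * d by fastforce
  ultimately have "cmod (D h) \<le> M / (d / norm h)"
    by (intro tendsto_lowerbound) auto
  then show ?thesis by (simp add: field_simps)
qed

lemma onorm_Cauchy_estimate:
  fixes f :: "'a::complex_banach \<Rightarrow> complex"
  assumes f: "cdiff_on f (ball z d)" and M: "\<And>w. w \<in> ball z d \<Longrightarrow> cmod (f w) \<le> M"
    and d: "0 < d" and D: "has_cderiv f D z"
  shows "onorm D \<le> M / d"
proof (rule onorm_bound)
  show "0 \<le> M / d" using order_trans[OF norm_ge_zero M[of z]] d by simp
qed (rule Cauchy_estimate[OF assms])

text \<open>The Cauchy estimate bounds the operator norm of the derivative by M / d at every point
  of S, and the mean value inequality on the convex set S does the rest.\<close>

lemma bounded_imp_Lipschitz: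
  fixes f :: "'a::complex_banach \<Rightarrow> complex"
  assumes f: "cdiff_on f U" and U: "convex S" "\<And>x. x \<in> S \<Longrightarrow> ball x d \<subseteq> U"
    and M: "\<And>w. w \<in> U \<Longrightarrow> cmod (f w) \<le> M" and d: "0 < d" and "x \<in> S" "y \<in> S"
  shows "cmod (f x - f y) \<le> M / d * norm (x - y)"
proof (rule differentiable_bound)
  fix x assume x: "x \<in> S"
  then have "x \<in> U" using U(2)[OF x] d by auto
  then have D: "has_cderiv f (frechet_derivative f (at x)) x" by (rule cdiff_on_frechet[OF f])
  then show "(f has_derivative frechet_derivative f (at x)) (at x within S)"
    by (simp add: has_cderiv_def has_derivative_at_withinI)
  show "onorm (frechet_derivative f (at x)) \<le> M / d"
    using U(2)[OF x] by (intro onorm_Cauchy_estimate[OF _ _ d D] M cdiff_on_subset[OF f]) auto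
qed (use assms in auto)

lemma cdiff_on_locally_bounded:
  fixes f :: "'a::complex_banach \<Rightarrow> complex"
  assumes "cdiff_on f U" "open U" "z \<in> U"
  obtains d M where "0 < d" "ball z d \<subseteq> U" "\<And>w. w \<in> ball z d \<Longrightarrow> cmod (f w) \<le> M"
proof -
  obtain e where e: "0 < e" "ball z e \<subseteq> U" using assms openE by metis
  obtain d where d: "0 < d" "\<And>w. dist w z < d \<Longrightarrow> dist (f w) (f z) < 1"
    using cdiff_on_isCont[OF assms(1,3)] unfolding continuous_at_eps_delta by (metis zero_less_one)
  show thesis
  proof
    show "0 < min d e" "ball z (min d e) \<subseteq> U" using d e by auto
    fix w assume "w \<in> ball z (min d e)"
    then have "dist (f w) (f z) < 1" using d(2) by (simp add: dist_commute)
    then show "cmod (f w) \<le> cmod (f z) + 1"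
      by (smt (verit) dist_norm norm_triangle_ineq2)
  qed
qed

text \<open>Bundled as a bounded linear map because the Leibniz rule asks for continuity of the
  derivative in operator norm.\<close>

definition cderiv :: "('a::complex_banach \<Rightarrow> complex) \<Rightarrow> 'a \<Rightarrow> 'a \<Rightarrow>\<^sub>L complex" where
  "cderiv f z = Blinfun (frechet_derivative f (at z))"

lemma blinfun_apply_cderiv:
  assumes "cdiff_on f U" "z \<in> U" shows "blinfun_apply (cderiv f z) = frechet_derivative f (at z)"
  unfolding cderiv_def using cdiff_on_frechet[OF assms]
  by (intro bounded_linear_Blinfun_apply) (auto simp: has_cderiv_def has_derivative_bounded_linear)

text \<open>The difference of the derivatives at w and z is the derivative at z of the single
  function v \<mapsto> f(v + (w - z)) - f(v). This function is of size L |w - z| because f is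
  Lipschitz, so a second Cauchy estimate finishes. Radii: f is bounded on radius d, hence Lipschitz
  on d/2; a shift by less than d/4 keeps the ball of radius d/4 inside that of radius d/2.\<close>

lemma continuous_on_cderiv:
  fixes f :: "'a::complex_banach \<Rightarrow> complex"
  assumes f: "cdiff_on f U" and U: "open U"
  shows "continuous_on U (cderiv f)"
proof (intro continuous_at_imp_continuous_on ballI)
  fix z assume z: "z \<in> U"
  obtain d M where d: "0 < d" "ball z d \<subseteq> U" "\<And>w. w \<in> ball z d \<Longrightarrow> cmod (f w) \<le> M"
    using cdiff_on_locally_bounded[OF f U z] by blast
  have M0: "0 \<le> M" using order_trans[OF norm_ge_zero d(3)[of z]] d(1) by simp
  define L where "L = M / (d/2)"
  have lip: "cmod (f x - f y) \<le> L * norm (x - y)" if "x \<in> ball z (d/2)" "y \<in> ball z (d/2)" for x y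
    unfolding L_def
  proof (rule bounded_imp_Lipschitz[where U = "ball z d" and S = "ball z (d/2)"])
    fix x assume "x \<in> ball z (d/2)"
    then show "ball x (d/2) \<subseteq> ball z d" 
      by (smt (verit) dist_triangle field_sum_of_halves mem_ball subsetI)
  qed (use d that cdiff_on_subset[OF f] in auto)
  have est: "norm (cderiv f w - cderiv f z) \<le> L * dist w z / (d/4)" if w: "dist w z < d/4" for w
  proof (rule norm_blinfun_bound)
    show "0 \<le> L * dist w z / (d/4)" using M0 d(1) by (simp add: L_def)
    fix h
    have wU: "w \<in> U" using w d by (intro subsetD[OF d(2)]) (simp add: dist_commute)
    have near: "v + (w - z) \<in> ball z (d/2)" "v \<in> ball z (d/2)" if "v \<in> ball z (d/4)" for v
    proof -
      have "norm (v + (w - z) - z) \<le> norm (v - z) + norm (w - z)"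
        by (metis add_diff_eq add_diff_add add.commute diff_add_eq norm_triangle_ineq)
      then show "v + (w - z) \<in> ball z (d/2)" using that w
        by (simp add: dist_norm norm_minus_commute)
    qed (use that d in auto)
    then have nU: "v + (w - z) \<in> U" "v \<in> U" if "v \<in> ball z (d/4)" for v
      using that d by fastforce+
    have "cmod (frechet_derivative f (at w) h - frechet_derivative f (at z) h) \<le> L * norm (w - z) / (d/4) * norm h"
    proof (rule Cauchy_estimate)
      show "has_cderiv (\<lambda>v. f (v + (w - z)) - f v)
         (\<lambda>h. frechet_derivative f (at w) h - frechet_derivative f (at z) h) z"
        using cdiff_on_frechet[OF f] wU z by (intro has_cderiv_diff has_cderiv_shift) auto
      show "cdiff_on (\<lambda>v. f (v + (w - z)) - f v) (ball z (d/4))"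
        unfolding cdiff_on_def
        using has_cderiv_diff has_cderiv_shift cdiff_on_frechet[OF f] nU by blast
      fix v assume "v \<in> ball z (d/4)"
      then show "cmod (f (v + (w - z)) - f v) \<le> L * norm (w - z)"
        using lip[OF near] by (metis add_diff_cancel_left')
    qed (use d in auto)
    then show "norm (blinfun_apply (cderiv f w - cderiv f z) h) \<le> L * dist w z / (d/4) * norm h"
      using wU z by (simp add: blinfun.diff_left blinfun_apply_cderiv[OF f] dist_norm)
  qed
  have "((\<lambda>w. L * dist w z / (d/4)) \<longlongrightarrow> L * dist z z / (d/4)) (at z)"
    using d by (intro tendsto_intros) auto
  then have "((\<lambda>w. L * dist w z / (d/4)) \<longlongrightarrow> 0) (at z)" by simp
  then have "((\<lambda>w. cderiv f w - cderiv f z) \<longlongrightarrow> 0) (at z)"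
  proof (rule Lim_null_comparison[rotated])
    show "\<forall>\<^sub>F w in at z. norm (cderiv f w - cderiv f z) \<le> L * dist w z / (d / 4)"
      using est d(1) unfolding eventually_at by (intro exI[of _ "d/4"]) auto
  qed
  then show "isCont (cderiv f) z" by (simp add: isCont_def Lim_null[symmetric])
qed

text \<open>Common form of two differentiations under the integral sign: over a circle for
  \<open>radial_deriv\<close> and along a ray for the Cesaro integral. The factor w of the
  derivative is separate from the integrand k because along the ray the factor 1/t of k cancels
  against the t from the chain rule.\<close>

lemma has_cderiv_integral:
  fixes g :: "'a::complex_banach \<Rightarrow> complex" and c w :: "real \<Rightarrow> complex"
  assumes g: "cdiff_on g V" "open V" and U: "open U" "convex U" "z \<in> U"
    and c: "continuous_on {0..1} c" and w: "continuous_on {0..1} w"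
    and V: "\<And>x t. x \<in> U \<Longrightarrow> t \<in> {0..1} \<Longrightarrow> scaleC (c t) x \<in> V"
    and der: "\<And>x t. x \<in> U \<Longrightarrow> t \<in> {0..1} \<Longrightarrow>
      has_cderiv (\<lambda>x. k x t) (\<lambda>h. w t * frechet_derivative g (at (scaleC (c t) x)) h) x"
    and int: "\<And>x. x \<in> U \<Longrightarrow> k x integrable_on {0..1}"
  shows "has_cderiv (\<lambda>x. integral {0..1} (k x))
    (\<lambda>h. integral {0..1} (\<lambda>t. w t * frechet_derivative g (at (scaleC (c t) z)) h)) z"
proof -
  define F where "F = (\<lambda>x t. blinfun_mult_right (w t) o\<^sub>L cderiv g (scaleC (c t) x))"
  have F: "blinfun_apply (F x t) = (\<lambda>h. w t * frechet_derivative g (at (scaleC (c t) x)) h)"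
    if "x \<in> U" "t \<in> {0..1}" for x t
    using blinfun_apply_cderiv[OF g(1) V[OF that]] by (auto simp: F_def)
  have "continuous_on (U \<times> {0..1}) (\<lambda>p. cderiv g (scaleC (c (snd p)) (fst p)))"
    by (intro continuous_on_compose2[OF continuous_on_cderiv[OF g]] scaleC.continuous_on
        continuous_on_compose2[OF c] continuous_intros) (auto intro: V)
  moreover have "continuous_on (U \<times> {0..1}) (\<lambda>p. blinfun_mult_right (w (snd p)))"
    by (intro bounded_linear.continuous_on[OF bounded_linear_blinfun_mult_right]
        continuous_on_compose2[OF w] continuous_intros) auto
  ultimately have contF: "continuous_on (U \<times> cbox 0 1) (\<lambda>(x, t). F x t)"
    unfolding F_def split_beta
    by (intro bounded_bilinear.continuous_on[OF bounded_bilinear_blinfun_compose]) auto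
  have "((\<lambda>x. integral (cbox 0 1) (k x)) has_derivative integral (cbox 0 1) (F z)) (at z within U)"
  proof (rule leibniz_rule[OF _ _ contF U(3,2)])
    fix x and t :: real assume "x \<in> U" "t \<in> cbox 0 1"
    then show "((\<lambda>x. k x t) has_derivative blinfun_apply (F x t)) (at x within U)"
      using F[of x t] der[of x t] by (simp add: has_cderiv_def has_derivative_at_withinI)
  qed (use int in auto)
  then have *: "((\<lambda>x. integral {0..1} (k x)) has_derivative integral {0..1} (F z)) (at z)"
    using at_within_open[OF U(3,1)] by simp
  have "F z integrable_on {0..1}"
    unfolding cbox_interval[symmetric]
    by (intro integrable_continuous continuous_on_compose2[OF contF, of _ "\<lambda>t. (z, t)", simplified split_conv])
      (auto intro!: continuous_intros U)
  then have "blinfun_apply (integral {0..1} (F z)) h =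
    integral {0..1} (\<lambda>t. w t * frechet_derivative g (at (scaleC (c t) z)) h)" for h
    by (subst blinfun_apply_integral) (use F[OF U(3)] in \<open>auto intro!: integral_cong simp del: mult_1\<close>)
  then have D: "((\<lambda>x. integral {0..1} (k x)) has_derivative
     (\<lambda>h. integral {0..1} (\<lambda>t. w t * frechet_derivative g (at (scaleC (c t) z)) h))) (at z)"
    by (intro has_derivative_eq_rhs[OF *]) (simp add: fun_eq_iff)
  have "integral {0..1} (\<lambda>t. w t * frechet_derivative g (at (scaleC (c t) z)) (scaleC a h)) =
    a * integral {0..1} (\<lambda>t. w t * frechet_derivative g (at (scaleC (c t) z)) h)" for a h
  proof -
    have "integral {0..1} (\<lambda>t. w t * frechet_derivative g (at (scaleC (c t) z)) (scaleC a h)) =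
      integral {0..1} (\<lambda>t. a * (w t * frechet_derivative g (at (scaleC (c t) z)) h))"
      using cdiff_on_frechet[OF g(1) V[OF U(3)]]
      by (intro integral_cong) (auto simp: has_cderiv_def)
    then show ?thesis by simp
  qed
  with D show ?thesis by (simp add: has_cderiv_def)
qed

text \<open>The radial derivative at x is the derivative at 1 of \<zeta> \<mapsto> f(\<zeta>x).
  Cauchy's formula on a small circle about 1 expresses it by values of f alone, so differentiating
  in x uses only the derivative of f and no second derivative.\<close>

lemma cdiff_on_radial_deriv:
  fixes f :: "'a::complex_banach \<Rightarrow> complex"
  assumes f: "cdiff_on f (ball 0 1)"
  shows "cdiff_on (radial_deriv f) (ball 0 1)"
  unfolding cdiff_on_def
proof
  fix z :: 'a assume z: "z \<in> ball 0 1"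
  \<comment> \<open>A quarter of the distance to the sphere leaves room both for moving z by \<eta>
    and for scaling by a factor of modulus up to 1 + \<eta>.\<close>
  define \<eta> where "\<eta> = (1 - norm z) / 4"
  have \<eta>: "0 < \<eta>" "\<eta> \<le> 1/4" using z by (auto simp: \<eta>_def)
  define U where "U = ball z \<eta>"
  have U: "open U" "convex U" "z \<in> U" using \<eta> by (auto simp: U_def)
  have in_ball: "scaleC \<zeta> x \<in> ball 0 1" if "x \<in> U" "\<zeta> \<in> cball 1 \<eta>" for x \<zeta>
  proof -
    have "norm x \<le> norm z + \<eta>" using that(1) norm_triangle_sub[of x z]
      by (simp add: U_def dist_norm norm_minus_commute)
    moreover have "cmod \<zeta> \<le> 1 + \<eta>" using that(2) norm_triangle_sub[of \<zeta> 1]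
      by (simp add: dist_norm norm_minus_commute)
    ultimately have "norm (scaleC \<zeta> x) \<le> (1 + \<eta>) * (norm z + \<eta>)"
      unfolding norm_scaleC by (intro mult_mono) (use \<eta> in auto)
    also have "\<dots> = norm z + \<eta> + \<eta> * (norm z + \<eta>)" by (simp add: algebra_simps)
    also have "\<dots> \<le> norm z + \<eta> + \<eta> * 2"
      using \<eta> z by (intro add_mono mult_left_mono) auto
    also have "\<dots> < 1" using z by (simp add: \<eta>_def field_simps)
    finally show ?thesis by simp
  qed
  define c where "c = (\<lambda>t. 1 + of_real \<eta> * exp (2 * of_real pi * \<i> * of_real t))"
  \<comment> \<open>\<open>c\<close> runs through the circle about 1, and \<open>w\<close> is what
    remains of d\<zeta> / (2 pi i (\<zeta> - 1)^2) on it.\<close>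
  define w where "w = (\<lambda>t. 1 / (of_real \<eta> * exp (2 * of_real pi * \<i> * of_real t)))"
  have c: "continuous_on {0..1} c" and w: "continuous_on {0..1} w"
    using \<eta> unfolding c_def w_def by (auto intro!: continuous_intros)
  have c_ball: "c t \<in> cball 1 \<eta>" for t
    using \<eta> by (simp add: c_def dist_norm norm_mult norm_exp_eq_Re)
  have cp: "circlepath 1 \<eta> t = c t" for t by (simp add: circlepath c_def)
  have eq: "radial_deriv f x = integral {0..1} (\<lambda>t. w t * f (scaleC (c t) x))" if x: "x \<in> U" for x
  proof -
    define F where "F = (\<lambda>\<zeta>. f (scaleC \<zeta> x))"
    have der: "(F has_field_derivative frechet_derivative f (at (scaleC \<zeta> x)) x) (at \<zeta>)"
      if "\<zeta> \<in> cball 1 \<eta>" for \<zeta>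
      using has_cderiv_line[of f _ 0 \<zeta> x] cdiff_on_frechet[OF f in_ball[OF x that]]
      by (simp add: F_def)
    have "F holomorphic_on cball 1 \<eta>"
      by (intro holomorphic_onI) (use der in \<open>auto simp: field_differentiable_def intro: has_field_derivative_at_within\<close>)
    then have "(F has_field_derivative (1 / (2 * of_real pi * \<i>) *
        contour_integral (circlepath 1 \<eta>) (\<lambda>u. F u / (u - 1)^2))) (at 1)"
      using \<eta> by (intro Cauchy_derivative_integral_circlepath) 
        (auto intro: holomorphic_on_imp_continuous_on holomorphic_on_subset)
    moreover have "(F has_field_derivative radial_deriv f x) (at 1)"
      using der[of 1] \<eta> by (simp add: radial_deriv_def)
    ultimately have "radial_deriv f x = 1 / (2 * of_real pi * \<i>) *
        contour_integral (circlepath 1 \<eta>) (\<lambda>u. F u / (u - 1)^2)"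
      by (rule DERIV_unique[rotated])
    also have "\<dots> = integral {0..1} (\<lambda>t. 1 / (2 * of_real pi * \<i>) *
        (F (c t) / (c t - 1)^2 * (2 * of_real pi * \<i> * (of_real \<eta> * exp (2 * of_real pi * \<i> * of_real t)))))"
      unfolding contour_integral_integral integral_mult_right[symmetric]
      by (intro integral_cong) (simp only: vector_derivative_circlepath cp mult_ac of_real_mult of_real_numeral)
    also have "\<dots> = integral {0..1} (\<lambda>t. w t * F (c t))"
      using \<eta> by (intro integral_cong) (simp add: w_def c_def power2_eq_square field_simps)
    finally show ?thesis by (simp add: F_def)
  qed
  have "has_cderiv (\<lambda>x. integral {0..1} (\<lambda>t. w t * f (scaleC (c t) x)))
    (\<lambda>h. integral {0..1} (\<lambda>t. (w t * c t) * frechet_derivative f (at (scaleC (c t) z)) h)) z"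
  proof (rule has_cderiv_integral[OF f _ U c])
    fix x and t :: real assume x: "x \<in> U" "t \<in> {0..1}"
    show V: "scaleC (c t) x \<in> ball 0 1" using in_ball[OF x(1) c_ball] .
    show "has_cderiv (\<lambda>x. w t * f (scaleC (c t) x))
      (\<lambda>h. (w t * c t) * frechet_derivative f (at (scaleC (c t) x)) h) x"
      using has_cderiv_cmult[OF has_cderiv_scaleC_arg[OF cdiff_on_frechet[OF f V]], of "w t"]
      by (simp add: mult.assoc)
  next
    fix x assume x: "x \<in> U"
    have "continuous_on {0..1} (\<lambda>t. w t * f (scaleC (c t) x))"
      by (intro continuous_intros w continuous_on_compose2[OF cdiff_on_continuous[OF f]]
        scaleC.continuous_on c) (use in_ball[OF x c_ball] in auto)
    then show "(\<lambda>t. w t * f (scaleC (c t) x)) integrable_on {0..1}"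
      by (rule integrable_continuous_real)
  next
    show "continuous_on {0..1} (\<lambda>t. w t * c t)" by (rule continuous_on_mult[OF w c])
  qed simp
  from has_cderiv_cong[OF this U(1,3) eq[symmetric]] show "\<exists>D. has_cderiv (radial_deriv f) D z"
    by blast
qed

lemma has_vector_derivative_ray:
  assumes "has_cderiv f D (t *\<^sub>R z)"
  shows "((\<lambda>t. f (t *\<^sub>R z)) has_vector_derivative D z) (at t)"
proof -
  have "((\<lambda>\<zeta>. f (0 + scaleC \<zeta> z)) has_field_derivative D z) (at (of_real t))"
    using assms by (intro has_cderiv_line) (simp add: scaleC_of_real)
  then have "((\<lambda>\<zeta>. f (0 + scaleC \<zeta> z)) \<circ> of_real has_vector_derivative 1 * D z) (at t)"
    by (intro field_vector_diff_chain_at) (auto intro!: derivative_eq_intros)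
  then show ?thesis by (simp add: o_def scaleC_of_real)
qed

lemma scaleR_in_unit_ball:
  fixes z :: "'a::real_normed_vector"
  assumes "z \<in> ball 0 1" "t \<in> {0..1}"
  shows "t *\<^sub>R z \<in> ball 0 1"
  using assms mult_left_le_one_le[of "norm z" t] by simp

text \<open>Solves RG = g: the chain rule produces a factor t that cancels 1/t, so DG(z)z is the
  integral of Dg(tz)z, which is the derivative of g(tz) in t. The condition g(0) = 0 makes the
  singularity at t = 0 removable.\<close>

lemma
  fixes g :: "'a::complex_banach \<Rightarrow> complex"
  assumes g: "cdiff_on g (ball 0 1)" and g0: "g 0 = 0"
  defines "G \<equiv> \<lambda>z. integral {0..1} (\<lambda>t. g (t *\<^sub>R z) / complex_of_real t)"
  shows radial_primitive_integrable:
      "z \<in> ball 0 1 \<Longrightarrow> (\<lambda>t. g (t *\<^sub>R z) / complex_of_real t) integrable_on {0..1}"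
    and radial_primitive_cdiff: "cdiff_on G (ball 0 1)"
    and radial_primitive_deriv: "z \<in> ball 0 1 \<Longrightarrow> frechet_derivative G (at z) z = g z"
proof -
  let ?D = "\<lambda>z. frechet_derivative g (at z)"
  \<comment> \<open>The value at t = 0 is the limit of the quotient, which makes the integrand
    continuous and lets the derivative formula in x hold at t = 0 as well.\<close>
  define k where "k = (\<lambda>z t. if t = 0 then ?D 0 z else g (t *\<^sub>R z) / complex_of_real t)"
  have contk: "continuous_on {0..1} (k z)" if z: "z \<in> ball 0 1" for z
  proof -
    have "((\<lambda>\<zeta>. g (0 + scaleC \<zeta> z)) has_field_derivative ?D 0 z) (at 0)"
      by (intro has_cderiv_line) (simp add: scaleC.zero_left cdiff_on_frechet[OF g])
    then have "((\<lambda>\<zeta>. g (scaleC \<zeta> z) / \<zeta>) \<longlongrightarrow> ?D 0 z) (at 0)"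
      by (simp add: DERIV_def scaleC.zero_left g0)
    moreover have "LIM t at (0::real). complex_of_real t :> at 0"
    proof -
      have "((\<lambda>t. complex_of_real t) \<longlongrightarrow> of_real 0) (at (0::real))" by (intro tendsto_intros)
      then show ?thesis by (auto simp: filterlim_at eventually_at_filter)
    qed
    ultimately have lim: "((\<lambda>t. g (scaleC (of_real t) z) / of_real t) \<longlongrightarrow> ?D 0 z) (at (0::real))"
      by (rule filterlim_compose)
    show ?thesis
    proof (intro continuous_at_imp_continuous_on ballI)
      fix t :: real assume t: "t \<in> {0..1}"
      show "isCont (k z) t"
      proof (cases "t = 0")
        case True
        have "((k z) \<longlongrightarrow> ?D 0 z) (at 0)"
          by (rule Lim_transform_eventually[OF lim])
            (auto simp: k_def eventually_at_filter scaleC_of_real)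
        then show ?thesis using True by (simp add: isCont_def k_def)
      next
        case False
        have "isCont g (t *\<^sub>R z)"
          using scaleR_in_unit_ball[OF z t] cdiff_on_isCont[OF g] by blast
        then have "isCont (\<lambda>t. g (t *\<^sub>R z) / of_real t) t"
          using False isCont_o2[where f = "\<lambda>t. t *\<^sub>R z" and g = g and a = t]
          by (intro isCont_divide isCont_of_real continuous_ident) auto
        moreover have "\<forall>\<^sub>F s in nhds t. k z s = g (s *\<^sub>R z) / of_real s"
          using t1_space_nhds[OF False] by eventually_elim (simp add: k_def)
        ultimately show ?thesis by (simp add: isCont_cong)
      qed
    qed
  qed
  have int_k: "k z integrable_on {0..1}" if "z \<in> ball 0 1" for z
    using contk[OF that] by (rule integrable_continuous_real)
  then show "(\<lambda>t. g (t *\<^sub>R z) / complex_of_real t) integrable_on {0..1}" if "z \<in> ball 0 1" for z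
    by (rule integrable_spike[of _ _ "{0}", OF _ negligible_sing]) (use that in \<open>auto simp: k_def\<close>)
  have G: "G z = integral {0..1} (k z)" for z
    unfolding G_def by (rule integral_spike[of "{0}"]) (auto simp: k_def)
  have D: "has_cderiv G (\<lambda>h. integral {0..1} (\<lambda>t. 1 * ?D (scaleC (of_real t) z) h)) z"
    if z: "z \<in> ball 0 1" for z
    unfolding G[abs_def]
  proof (rule has_cderiv_integral[OF g _ _ _ z])
    fix x :: 'a and t :: real assume x: "x \<in> ball 0 1" and t: "t \<in> {0..1}"
    show V: "scaleC (of_real t) x \<in> ball 0 1"
      using scaleR_in_unit_ball[OF x t] by (simp add: scaleC_of_real)
    show "has_cderiv (\<lambda>x. k x t) (\<lambda>h. 1 * ?D (scaleC (of_real t) x) h) x"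
    proof (cases "t = 0")
      case True
      have "has_cderiv g (?D 0) 0" using cdiff_on_frechet[OF g] by simp
      then have "has_cderiv (?D 0) (?D 0) x"
        using bounded_linear_imp_has_derivative[OF has_derivative_bounded_linear]
        by (auto simp: has_cderiv_def)
      then show ?thesis using True by (simp add: k_def scaleC.zero_left)
    next
      case False
      then show ?thesis
        using has_cderiv_cmult[OF has_cderiv_scaleC_arg[OF cdiff_on_frechet[OF g V]], of "1 / of_real t"]
        by (simp add: k_def scaleC_of_real)
    qed
  next
    fix x :: 'a assume x: "x \<in> ball 0 1"
    show "k x integrable_on {0..1}" by (rule int_k[OF x])
  qed (auto intro: continuous_on_of_real continuous_on_id)
  then show "cdiff_on G (ball 0 1)" unfolding cdiff_on_def by blast
  show "frechet_derivative G (at z) z = g z" if z: "z \<in> ball 0 1" for z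
  proof -
    have "((\<lambda>t. ?D (t *\<^sub>R z) z) has_integral g (1 *\<^sub>R z) - g (0 *\<^sub>R z)) {0..1}"
      by (rule fundamental_theorem_of_calculus[OF zero_le_one])
        (intro has_vector_derivative_at_within[OF has_vector_derivative_ray]
          cdiff_on_frechet[OF g] scaleR_in_unit_ball[OF z])
    then show ?thesis
      using has_cderiv_frechet[OF D[OF z]] by (simp add: scaleC_of_real g0 integral_unique)
  qed
qed

section \<open>Functions restricted to the ball and the radial derivative of the Cesaro
  operator\<close>

lemma has_cderiv_restrict:
  "has_cderiv f D z \<Longrightarrow> z \<in> ball 0 1 \<Longrightarrow> has_cderiv (restrict f (ball 0 1)) D z"
  by (rule has_cderiv_cong[OF _ open_ball]) (assumption | simp)+

lemma restrict_in_hol_ball: "cdiff_on f (ball 0 1) \<Longrightarrow> restrict f (ball 0 1) \<in> hol_ball"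
  unfolding hol_ball_iff cdiff_on_def using has_cderiv_restrict by (blast intro: restrict_extensional)

lemma radial_deriv_restrict:
  assumes "has_cderiv f D z" "z \<in> ball 0 1"
  shows "radial_deriv (restrict f (ball 0 1)) z = D z"
  using has_cderiv_frechet[OF has_cderiv_restrict[OF assms]] by (simp add: radial_deriv_def)

lemma hol_ball_has_cderiv:
  "f \<in> hol_ball \<Longrightarrow> z \<in> ball 0 1 \<Longrightarrow> has_cderiv f (frechet_derivative f (at z)) z"
  using cdiff_on_frechet hol_ball_iff by blast

lemma
  assumes f: "f \<in> hol_ball" and g: "g \<in> hol_ball"
  shows hol_ball_diff: "(\<lambda>z\<in>ball 0 1. f z - g z) \<in> hol_ball"
    and radial_deriv_diff: "z \<in> ball 0 1 \<Longrightarrow>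
      radial_deriv (\<lambda>z\<in>ball 0 1. f z - g z) z = radial_deriv f z - radial_deriv g z"
proof -
  note D = has_cderiv_diff[OF hol_ball_has_cderiv[OF f] hol_ball_has_cderiv[OF g]]
  show "(\<lambda>z\<in>ball 0 1. f z - g z) \<in> hol_ball"
    using D by (intro restrict_in_hol_ball) (unfold cdiff_on_def, blast)
  show "radial_deriv (\<lambda>z\<in>ball 0 1. f z - g z) z = radial_deriv f z - radial_deriv g z"
    if z: "z \<in> ball 0 1"
    using radial_deriv_restrict[OF D[OF z z] z] by (simp add: radial_deriv_def)
qed

lemma radial_deriv_zero:
  assumes "f \<in> hol_ball" shows "radial_deriv f 0 = 0"
  using hol_ball_has_cderiv[OF assms, of 0] linear_0[OF has_derivative_linear]
  by (auto simp: has_cderiv_def radial_deriv_def)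

text \<open>All four facts come from the radial primitive of f R\<phi>, which vanishes at 0 because
  R\<phi> does.\<close>

lemma
  fixes \<phi> f :: "'a::complex_banach \<Rightarrow> complex"
  assumes \<phi>: "\<phi> \<in> hol_ball" and f: "f \<in> hol_ball"
  shows cesaro_integrable: "z \<in> ball 0 1 \<Longrightarrow>
      (\<lambda>t. f (t *\<^sub>R z) * radial_deriv \<phi> (t *\<^sub>R z) * (1 / complex_of_real t)) integrable_on {0..1}"
    and cesaro_in_hol_ball: "cesaro \<phi> f \<in> hol_ball"
    and radial_deriv_cesaro: "z \<in> ball 0 1 \<Longrightarrow>
      radial_deriv (cesaro \<phi> f) z = f z * radial_deriv \<phi> z"
    and cesaro_zero: "cesaro \<phi> f 0 = 0"
proof -
  let ?g = "\<lambda>z. f z * radial_deriv \<phi> z"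
  have R: "cdiff_on (radial_deriv \<phi>) (ball 0 1)"
    using \<phi> by (simp add: hol_ball_iff cdiff_on_radial_deriv)
  have g: "cdiff_on ?g (ball 0 1)"
    unfolding cdiff_on_def
    using has_cderiv_mult[OF hol_ball_has_cderiv[OF f] cdiff_on_frechet[OF R]] by blast
  have g0: "?g 0 = 0" using radial_deriv_zero[OF \<phi>] by simp
  have C: "cesaro \<phi> f = restrict (\<lambda>z. integral {0..1} (\<lambda>t. ?g (t *\<^sub>R z) / complex_of_real t)) (ball 0 1)"
    by (simp add: cesaro_def)
  show "(\<lambda>t. f (t *\<^sub>R z) * radial_deriv \<phi> (t *\<^sub>R z) * (1 / complex_of_real t)) integrable_on {0..1}"
    if "z \<in> ball 0 1"
    using radial_primitive_integrable[OF g g0 that] by simp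
  show "cesaro \<phi> f \<in> hol_ball"
    unfolding C by (rule restrict_in_hol_ball[OF radial_primitive_cdiff[OF g g0]])
  show "radial_deriv (cesaro \<phi> f) z = ?g z" if z: "z \<in> ball 0 1"
    unfolding C radial_deriv_restrict[OF cdiff_on_frechet[OF radial_primitive_cdiff[OF g g0] z] z]
    by (rule radial_primitive_deriv[OF g g0 z])
  show "cesaro \<phi> f 0 = 0" using radial_deriv_zero[OF \<phi>] by (simp add: cesaro_def)
qed

text \<open>A Weierstrass convergence theorem: Cauchy estimates for the differences F m - F n make
  the derivatives uniformly Cauchy on a smaller ball, and then the theorem on differentiating
  sequences identifies the derivative of the limit. It is needed for completeness of the little
  space.\<close>

lemma
  fixes F :: "nat \<Rightarrow> 'a::complex_banach \<Rightarrow> complex"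
  assumes F: "\<And>n. cdiff_on (F n) U" and U: "open U"
    and lim: "\<And>z. z \<in> U \<Longrightarrow> \<exists>d>0. uniform_limit (ball z d) F f sequentially"
  shows cdiff_on_uniform_limit: "cdiff_on f U"
    and frechet_derivative_uniform_limit: "z \<in> U \<Longrightarrow>
      (\<lambda>n. frechet_derivative (F n) (at z) h) \<longlonglongrightarrow> frechet_derivative f (at z) h"
proof -
  let ?D = "\<lambda>n z. frechet_derivative (F n) (at z)"
  have *: "\<exists>D. has_cderiv f D z \<and> (\<forall>h. (\<lambda>n. ?D n z h) \<longlonglongrightarrow> D h)" if z: "z \<in> U" for z
  proof -
    obtain d1 where d1: "d1 > 0" "uniform_limit (ball z d1) F f sequentially" using lim[OF z] by blast
    obtain d2 where d2: "d2 > 0" "ball z d2 \<subseteq> U" using U z openE by blast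
    \<comment> \<open>Half the radius, so that around each point of \<open>ball z d\<close> a Cauchy
      estimate on radius d stays in the region of uniform convergence.\<close>
    define d where "d = min d1 d2 / 2"
    have d: "0 < d" "ball z (2 * d) \<subseteq> U" "uniform_limit (ball z (2 * d)) F f sequentially"
      using d1 d2 subset_ball[of "2 * d" d1 z]
      by (auto simp: d_def intro: uniform_limit_on_subset[OF d1(2)])
    have sub: "ball x d \<subseteq> ball z (2 * d)" if "x \<in> ball z d" for x
    proof
      fix w assume "w \<in> ball x d"
      then show "w \<in> ball z (2 * d)" using that dist_triangle[of z w x] by simp
    qed
    have FD: "has_cderiv (F n) (?D n x) x" if "x \<in> ball z (2 * d)" for n x
      using cdiff_on_frechet[OF F] d(2) that by blast
    have cauchy: "\<exists>N. \<forall>m\<ge>N. \<forall>n\<ge>N. \<forall>x\<in>ball z d. \<forall>h. cmod (?D m x h - ?D n x h) \<le> e * norm h"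
      if "e > 0" for e
    proof -
      have "e * d / 2 > 0" using that d by simp
      then obtain N where N: "\<And>n x. n \<ge> N \<Longrightarrow> x \<in> ball z (2 * d) \<Longrightarrow> dist (F n x) (f x) < e * d / 2"
        using uniform_limitD[OF d(3)] unfolding eventually_sequentially by meson
      have "cmod (?D m x h - ?D n x h) \<le> e * norm h"
        if mn: "m \<ge> N" "n \<ge> N" and x: "x \<in> ball z d" for m n x h
      proof -
        have "cmod (?D m x h - ?D n x h) \<le> (e * d) / d * norm h"
        proof (rule Cauchy_estimate)
          show "cdiff_on (\<lambda>y. F m y - F n y) (ball x d)"
            unfolding cdiff_on_def using has_cderiv_diff[OF FD FD] sub[OF x] by blast
          show "has_cderiv (\<lambda>y. F m y - F n y) (\<lambda>h. ?D m x h - ?D n x h) x"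
            using x d by (intro has_cderiv_diff FD) auto
          fix w assume "w \<in> ball x d"
          then have "w \<in> ball z (2 * d)" using sub[OF x] by blast
          from N[OF mn(1) this] N[OF mn(2) this] show "cmod (F m w - F n w) \<le> e * d"
            using norm_triangle_ineq4[of "F m w - f w" "F n w - f w"] by (simp add: dist_norm)
        qed (rule d)
        then show ?thesis using d by simp
      qed
      then show ?thesis by blast
    qed
    define g where "g = (\<lambda>x h. lim (\<lambda>n. ?D n x h))"
    have conv: "(\<lambda>n. ?D n x h) \<longlonglongrightarrow> g x h" if x: "x \<in> ball z d" for x h
    proof -
      have "Cauchy (\<lambda>n. ?D n x h)"
      proof (rule metric_CauchyI)
        fix e :: real assume e: "e > 0"
        \<comment> \<open>The summand 1 avoids a division by zero when h = 0.\<close>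
        define e' where "e' = e / (norm h + 1)"
        have "e' > 0" using e by (simp add: e'_def add_nonneg_pos)
        from cauchy[OF this] obtain N where
          N: "\<And>m n. m \<ge> N \<Longrightarrow> n \<ge> N \<Longrightarrow> cmod (?D m x h - ?D n x h) \<le> e' * norm h" using x by blast
        have "e' * norm h < e" proof -
          have "0 < norm h + 1" by (simp add: add_nonneg_pos)
          moreover have "e * norm h < e * (norm h + 1)" using e by simp
          ultimately show ?thesis by (simp only: e'_def times_divide_eq_left pos_divide_less_eq)
        qed
        with N show "\<exists>M. \<forall>m\<ge>M. \<forall>n\<ge>M. dist (?D m x h) (?D n x h) < e"
          unfolding dist_norm by (intro exI[of _ N]) (blast intro: le_less_trans)
      qed
      then show ?thesis unfolding g_def using Cauchy_convergent_iff convergent_LIMSEQ_iff by blast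
    qed
    have "\<exists>G. \<forall>x\<in>ball z d. (\<lambda>n. F n x) \<longlonglongrightarrow> G x \<and> (G has_derivative g x) (at x within ball z d)"
    proof (rule has_derivative_sequence[where f = F and f' = ?D])
      show "(F n has_derivative ?D n x) (at x within ball z d)" if "x \<in> ball z d" for n x
        using FD[of x n] that d by (simp add: has_cderiv_def has_derivative_at_withinI)
      show "z \<in> ball z d" using d by simp
      then show "(\<lambda>n. F n z) \<longlonglongrightarrow> f z"
        using tendsto_uniform_limitI[OF d(3)] d by simp
      fix e :: real assume "e > 0"
      from cauchy[OF this] obtain N where
        N: "\<And>m n x h. m \<ge> N \<Longrightarrow> n \<ge> N \<Longrightarrow> x \<in> ball z d \<Longrightarrow> cmod (?D m x h - ?D n x h) \<le> e * norm h" by blast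
      have "cmod (?D n x h - g x h) \<le> e * norm h" if n: "n \<ge> N" and x: "x \<in> ball z d" for n x h
      proof (rule tendsto_upperbound)
        show "(\<lambda>m. cmod (?D n x h - ?D m x h)) \<longlonglongrightarrow> cmod (?D n x h - g x h)"
          by (intro tendsto_intros conv x)
        show "\<forall>\<^sub>F m in sequentially. cmod (?D n x h - ?D m x h) \<le> e * norm h"
          using N[OF n _ x] by (auto simp: eventually_sequentially)
      qed simp
      then show "\<forall>\<^sub>F n in sequentially. \<forall>x\<in>ball z d. \<forall>h. cmod (?D n x h - g x h) \<le> e * norm h"
        unfolding eventually_sequentially by blast
    qed (rule convex_ball)
    then obtain G where G: "\<And>x. x \<in> ball z d \<Longrightarrow> (\<lambda>n. F n x) \<longlonglongrightarrow> G x"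
        "\<And>x. x \<in> ball z d \<Longrightarrow> (G has_derivative g x) (at x within ball z d)" by blast
    have zd: "z \<in> ball z d" using d by simp
    \<comment> \<open>The sequence theorem returns a limit function of its own; uniqueness of limits
      identifies it with f.\<close>
    have "G x = f x" if "x \<in> ball z d" for x
      using LIMSEQ_unique[OF G(1)[OF that] tendsto_uniform_limitI[OF d(3)]] that d by auto
    moreover have "(G has_derivative g z) (at z)"
      using G(2)[OF zd] at_within_open[OF zd open_ball] by simp
    ultimately have "(f has_derivative g z) (at z)"
      using has_derivative_transform_within_open[OF _ open_ball zd] by blast
    moreover have "g z (scaleC c h) = c * g z h" for c h
    proof (rule LIMSEQ_unique[OF conv[OF zd]])
      have "(\<lambda>n. c * ?D n z h) \<longlonglongrightarrow> c * g z h" by (intro tendsto_intros conv zd)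
      then show "(\<lambda>n. ?D n z (scaleC c h)) \<longlonglongrightarrow> c * g z h"
        using FD[of z] d by (simp add: has_cderiv_def)
    qed
    ultimately have "has_cderiv f (g z) z" by (simp add: has_cderiv_def)
    then show ?thesis using conv[OF zd] by blast
  qed
  then show "cdiff_on f U" unfolding cdiff_on_def by blast
  show "(\<lambda>n. ?D n z h) \<longlonglongrightarrow> frechet_derivative f (at z) h" if "z \<in> U"
    using *[OF that] has_cderiv_frechet by blast
qed

section \<open>Normal weights\<close>

text \<open>Normality controls a weight only near 1. On the compact remainder the quotient of two
  values is at most maximum over minimum, so monotonicity extends to the whole interval at the price
  of a constant. A pair on both sides of \<delta> is compared through the value at \<delta>.\<close>

lemma almost_decreasing_global:
  fixes h :: "real \<Rightarrow> real"
  assumes h: "continuous_on {0..<1} h" "\<And>x. x \<in> {0..<1} \<Longrightarrow> 0 < h x"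
    and \<delta>: "0 \<le> \<delta>" "\<delta> < 1" and anti: "antimono_on {\<delta>..<1} h"
  obtains C where "1 \<le> C" "\<And>s t. 0 \<le> s \<Longrightarrow> s \<le> t \<Longrightarrow> t < 1 \<Longrightarrow> h t \<le> C * h s"
proof -
  have cont: "continuous_on {0..\<delta>} h" using h(1) \<delta> by (auto intro: continuous_on_subset)
  obtain p where p: "p \<in> {0..\<delta>}" "\<And>x. x \<in> {0..\<delta>} \<Longrightarrow> h p \<le> h x"
    using continuous_attains_inf[OF compact_Icc _ cont] \<delta> by fastforce
  obtain q where q: "q \<in> {0..\<delta>}" "\<And>x. x \<in> {0..\<delta>} \<Longrightarrow> h x \<le> h q"
    using continuous_attains_sup[OF compact_Icc _ cont] \<delta> by fastforce
  have hp: "0 < h p" using h(2) p \<delta> by simp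
  define C where "C = h q / h p"
  have C: "1 \<le> C" using p(2)[OF q(1)] hp by (simp add: C_def)
  have on: "h t \<le> C * h s" if "s \<in> {0..\<delta>}" "t \<in> {0..\<delta>}" for s t
  proof -
    have "h t \<le> C * h p" using q(2)[OF that(2)] hp by (simp add: C_def)
    also have "\<dots> \<le> C * h s" using p(2)[OF that(1)] C by simp
    finally show ?thesis .
  qed
  have off: "h t \<le> h s" if "\<delta> \<le> s" "s \<le> t" "t < 1" for s t
    using monotone_onD[OF anti, of s t] that by simp
  show thesis
  proof (rule that[OF C])
    fix s t :: real assume st: "0 \<le> s" "s \<le> t" "t < 1"
    have hs: "0 < h s" using h(2) st by simp
    consider "t \<le> \<delta>" | "\<delta> \<le> s" | "s \<le> \<delta>" "\<delta> \<le> t" by linarith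
    then show "h t \<le> C * h s"
    proof cases
      case 2
      then have "h t \<le> 1 * h s" using off st by simp
      also have "\<dots> \<le> C * h s" using C hs by (intro mult_right_mono) auto
      finally show ?thesis .
    next
      case 3
      then show ?thesis using off[of \<delta> t] on[of s \<delta>] st by force
    qed (use on st in auto)
  qed
qed

text \<open>The form in which normality is used from here on: power bounds on all of [0,1), from
  above with exponent a and from below with exponent b.\<close>

lemma normal_weight_comparison:
  assumes "normal_weight \<omega>"
  obtains a b C where "0 < a" "0 < b" "1 \<le> C"
    "\<And>s t. 0 \<le> s \<Longrightarrow> s \<le> t \<Longrightarrow> t < 1 \<Longrightarrow> \<omega> t \<le> C * \<omega> s * ((1 - t) / (1 - s)) powr a"
    "\<And>s t. 0 \<le> s \<Longrightarrow> s \<le> t \<Longrightarrow> t < 1 \<Longrightarrow> \<omega> s \<le> C * \<omega> t * ((1 - s) / (1 - t)) powr b"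
proof -
  obtain \<delta> a b where w: "continuous_on {0..<1} \<omega>" "\<And>r. r \<in> {0..<1} \<Longrightarrow> 0 < \<omega> r"
    and \<delta>: "0 \<le> \<delta>" "\<delta> < 1" and ab: "0 < a" "a < b"
    and anti: "antimono_on {\<delta>..<1} (\<lambda>r. \<omega> r / (1 - r) powr a)"
    and mono: "mono_on {\<delta>..<1} (\<lambda>r. \<omega> r / (1 - r) powr b)"
    using assms unfolding normal_weight_def by blast
  obtain A where A: "1 \<le> A" "\<And>s t. 0 \<le> s \<Longrightarrow> s \<le> t \<Longrightarrow> t < 1 \<Longrightarrow>
      \<omega> t / (1 - t) powr a \<le> A * (\<omega> s / (1 - s) powr a)"
  proof (rule almost_decreasing_global[OF _ _ \<delta> anti])
    show "continuous_on {0..<1} (\<lambda>r. \<omega> r / (1 - r) powr a)"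
      by (intro continuous_intros w) auto
  qed (use w in auto)
  \<comment> \<open>The increasing quotient is inverted so that the same lemma on decreasing
    functions applies.\<close>
  obtain B where B: "1 \<le> B" "\<And>s t. 0 \<le> s \<Longrightarrow> s \<le> t \<Longrightarrow> t < 1 \<Longrightarrow>
      (1 - t) powr b / \<omega> t \<le> B * ((1 - s) powr b / \<omega> s)"
  proof (rule almost_decreasing_global[OF _ _ \<delta>])
    show "continuous_on {0..<1} (\<lambda>r. (1 - r) powr b / \<omega> r)"
      by (intro continuous_intros w) (use w(2) in force)+
    show "antimono_on {\<delta>..<1} (\<lambda>r. (1 - r) powr b / \<omega> r)"
    proof (rule monotone_onI)
      fix s t assume st: "s \<in> {\<delta>..<1}" "t \<in> {\<delta>..<1}" "s \<le> t"
      have pos: "0 < \<omega> s" "0 < \<omega> t" "0 < (1 - s) powr b" "0 < (1 - t) powr b" using st \<delta> w(2) by auto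
      have "\<omega> s / (1 - s) powr b \<le> \<omega> t / (1 - t) powr b" using monotone_onD[OF mono st] .
      then show "(1 - t) powr b / \<omega> t \<le> (1 - s) powr b / \<omega> s"
        using pos by (simp add: field_simps)
    qed
  qed (use w in auto)
  define C where "C = max A B"
  show thesis
  proof (rule that[of a b C])
    fix s t :: real assume st: "0 \<le> s" "s \<le> t" "t < 1"
    have pos: "0 < \<omega> s" "0 < \<omega> t" "0 < 1 - s" "0 < 1 - t" using st w(2) by auto
    have "\<omega> t \<le> A * \<omega> s * ((1 - t) / (1 - s)) powr a"
      using A(2)[OF st] pos by (simp add: powr_divide field_simps)
    also have "\<dots> \<le> C * \<omega> s * ((1 - t) / (1 - s)) powr a"
      using pos by (intro mult_right_mono) (auto simp: C_def)
    finally show "\<omega> t \<le> C * \<omega> s * ((1 - t) / (1 - s)) powr a" .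
    have "\<omega> s \<le> B * \<omega> t * ((1 - s) / (1 - t)) powr b"
      using B(2)[OF st] pos by (simp add: powr_divide field_simps)
    also have "\<dots> \<le> C * \<omega> t * ((1 - s) / (1 - t)) powr b"
      using pos by (intro mult_right_mono) (auto simp: C_def)
    finally show "\<omega> s \<le> C * \<omega> t * ((1 - s) / (1 - t)) powr b" .
  qed (use ab A B in \<open>auto simp: C_def\<close>)
qed

lemma normal_weight_pos: "normal_weight \<omega> \<Longrightarrow> 0 \<le> t \<Longrightarrow> t < 1 \<Longrightarrow> 0 < \<omega> t"
  by (auto simp: normal_weight_def)

lemma normal_weight_almost_decreasing:
  assumes "normal_weight \<omega>"
  obtains C where "1 \<le> C" "\<And>s t. 0 \<le> s \<Longrightarrow> s \<le> t \<Longrightarrow> t < 1 \<Longrightarrow> \<omega> t \<le> C * \<omega> s"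
proof -
  obtain a b C where C: "0 < a" "1 \<le> C"
    "\<And>s t. 0 \<le> s \<Longrightarrow> s \<le> t \<Longrightarrow> t < 1 \<Longrightarrow> \<omega> t \<le> C * \<omega> s * ((1 - t) / (1 - s)) powr a"
    using normal_weight_comparison[OF assms] by metis
  show thesis
  proof (rule that[OF C(2)])
    fix s t :: real assume st: "0 \<le> s" "s \<le> t" "t < 1"
    have "((1 - t) / (1 - s)) powr a \<le> 1"
      using st C(1) by (intro powr_le1) auto
    then have "C * \<omega> s * ((1 - t) / (1 - s)) powr a \<le> C * \<omega> s"
      using C(2) normal_weight_pos[OF assms, of s] st by (intro mult_left_le) auto
    then show "\<omega> t \<le> C * \<omega> s" using C(3)[OF st] by simp
  qed
qed

lemma normal_weight_tendsto_zero:
  assumes "normal_weight \<omega>" shows "(\<omega> \<longlongrightarrow> 0) (at_left 1)"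
proof -
  obtain a b C where C: "0 < a" "1 \<le> C"
    "\<And>s t. 0 \<le> s \<Longrightarrow> s \<le> t \<Longrightarrow> t < 1 \<Longrightarrow> \<omega> t \<le> C * \<omega> s * ((1 - t) / (1 - s)) powr a"
    using normal_weight_comparison[OF assms] by metis
  have "\<forall>\<^sub>F t in at_left 1. \<bar>\<omega> t\<bar> \<le> C * \<omega> 0 * (1 - t) powr a"
  proof (rule eventually_mono[OF eventually_at_left_real[OF zero_less_one]])
    fix t :: real assume "t \<in> {0<..<1}"
    then show "\<bar>\<omega> t\<bar> \<le> C * \<omega> 0 * (1 - t) powr a"
      using C(3)[of 0 t] normal_weight_pos[OF assms, of t] by simp
  qed
  moreover have "((\<lambda>t. C * \<omega> 0 * (1 - t) powr a) \<longlongrightarrow> C * \<omega> 0 * (1 - 1) powr a) (at_left 1)"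
    using C(1) eventually_mono[OF eventually_at_left_real[OF zero_less_one]]
    by (intro tendsto_intros) auto
  then have "((\<lambda>t. C * \<omega> 0 * (1 - t) powr a) \<longlongrightarrow> 0) (at_left 1)" by simp
  ultimately show ?thesis by (auto intro: Lim_null_comparison)
qed

lemma normal_weight_inverse_integrable:
  assumes "normal_weight \<omega>" "r < 1"
  shows "(\<lambda>t. 1 / \<omega> t) integrable_on {0..r}"
proof (rule integrable_continuous_real)
  have "continuous_on {0..r} \<omega>"
    using assms by (auto simp: normal_weight_def intro: continuous_on_subset)
  then show "continuous_on {0..r} (\<lambda>t. 1 / \<omega> t)"
    using normal_weight_pos[OF assms(1)] assms(2)
    by (intro continuous_intros) (auto simp: less_le)
qed

text \<open>The radius may be required to be positive; later it serves as the parameter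
  \<open>\<rho>\<close> of \<open>E_set\<close>.\<close>

lemma eventually_to_sphere:
  "eventually P to_sphere \<longleftrightarrow> (\<exists>r. 0 < r \<and> r < 1 \<and> (\<forall>z. r < norm z \<longrightarrow> norm z < 1 \<longrightarrow> P z))"
proof
  assume "eventually P to_sphere"
  then obtain Q where Q: "eventually Q (at_left 1)" "\<And>z. Q (norm z) \<Longrightarrow> P z"
    unfolding to_sphere_def eventually_filtercomap by blast
  then obtain r where r: "r < 1" "\<And>x. r < x \<Longrightarrow> x < 1 \<Longrightarrow> Q x"
    using eventually_at_left[of 0 "1::real" Q] by auto
  show "\<exists>r. 0 < r \<and> r < 1 \<and> (\<forall>z. r < norm z \<longrightarrow> norm z < 1 \<longrightarrow> P z)"
    using r Q(2) by (intro exI[of _ "max r (1/2)"]) auto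
next
  assume "\<exists>r. 0 < r \<and> r < 1 \<and> (\<forall>z. r < norm z \<longrightarrow> norm z < 1 \<longrightarrow> P z)"
  then obtain r where r: "r < 1" "\<And>z. r < norm z \<Longrightarrow> norm z < 1 \<Longrightarrow> P z" by blast
  then show "eventually P to_sphere"
    unfolding to_sphere_def eventually_filtercomap
    by (intro exI[of _ "\<lambda>x. r < x \<and> x < 1"]) (auto intro: eventually_at_left_real[THEN eventually_mono])
qed

lemma tendsto_zero_to_sphere:
  assumes "\<And>z. norm z < 1 \<Longrightarrow> 0 \<le> (F z :: real)"
  shows "(F \<longlongrightarrow> 0) to_sphere \<longleftrightarrow>
    (\<forall>\<epsilon>>0. \<exists>r. 0 < r \<and> r < 1 \<and> (\<forall>z. r < norm z \<longrightarrow> norm z < 1 \<longrightarrow> F z < \<epsilon>))"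
  unfolding tendsto_iff eventually_to_sphere using assms by (simp add: dist_real_def)

section \<open>The little Bloch-type space\<close>

text \<open>The disc of radius r in the complex line through z has its boundary on the sphere of
  radius r, so the one-variable principle suffices, although that sphere need not be
  compact.\<close>

lemma maximum_modulus_ball:
  fixes h :: "'a::complex_banach \<Rightarrow> complex"
  assumes h: "cdiff_on h (ball 0 1)" and r: "r < 1" and K: "\<And>w. norm w = r \<Longrightarrow> cmod (h w) \<le> K"
    and z: "z \<noteq> 0" "norm z \<le> r"
  shows "cmod (h z) \<le> K"
proof -
  define u where "u = z /\<^sub>R norm z"
  have u: "norm u = 1" using z by (simp add: u_def)
  define G where "G = (\<lambda>\<zeta>. h (scaleC \<zeta> u))"
  have r0: "0 < r" using z by (meson less_le_trans zero_less_norm_iff)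
  have der: "G field_differentiable (at \<zeta>)" if "cmod \<zeta> < 1" for \<zeta>
    using has_cderiv_line[of h _ 0 \<zeta> u] cdiff_on_frechet[OF h, of "scaleC \<zeta> u"] that u
    by (auto simp: G_def field_differentiable_def norm_scaleC)
  then have hol: "G holomorphic_on cball 0 r"
    using r by (intro holomorphic_onI field_differentiable_at_within[OF der]) simp
  have "cmod (G (of_real (norm z))) \<le> K"
  proof (rule maximum_modulus_frontier[of G "cball 0 r"])
    show "G holomorphic_on interior (cball 0 r)"
      using hol by (rule holomorphic_on_subset) auto
    show "continuous_on (closure (cball 0 r)) G"
      using hol by (simp add: holomorphic_on_imp_continuous_on)
    fix \<zeta> :: complex assume "\<zeta> \<in> frontier (cball 0 r)"
    then show "cmod (G \<zeta>) \<le> K" using r0 u by (auto simp: G_def norm_scaleC intro!: K)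
  qed (use z in auto)
  then show ?thesis using z by (simp add: G_def scaleC_of_real u_def)
qed

lemma little_blochD: "f \<in> little_bloch \<omega> \<Longrightarrow> f \<in> hol_ball"
  by (simp add: little_bloch_def)

lemma little_bloch_iff:
  assumes "normal_weight \<omega>"
  shows "f \<in> little_bloch \<omega> \<longleftrightarrow> f \<in> hol_ball \<and> (\<forall>\<epsilon>>0. \<exists>r. 0 < r \<and> r < 1 \<and>
    (\<forall>z. r < norm z \<longrightarrow> norm z < 1 \<longrightarrow> \<omega> (norm z) * cmod (radial_deriv f z) < \<epsilon>))"
  unfolding little_bloch_def mem_Collect_eq
  by (subst tendsto_zero_to_sphere) (use normal_weight_pos[OF assms] in \<open>auto intro!: mult_nonneg_nonneg simp: less_imp_le\<close>)

text \<open>Gives the supremum in \<open>bloch_norm\<close> its meaning. Near the sphere the limit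
  condition gives a bound; further inside, the maximum principle for the radial derivative does,
  because \<omega> is at most a multiple of its value at 0.\<close>

lemma little_bloch_bdd_above:
  assumes \<omega>: "normal_weight \<omega>" and f: "f \<in> little_bloch \<omega>"
  shows "bdd_above ((\<lambda>z. \<omega> (norm z) * cmod (radial_deriv f z)) ` ball 0 1)"
proof -
  obtain C where C: "1 \<le> C" "\<And>s t. 0 \<le> s \<Longrightarrow> s \<le> t \<Longrightarrow> t < 1 \<Longrightarrow> \<omega> t \<le> C * \<omega> s"
    using normal_weight_almost_decreasing[OF \<omega>] by blast
  have hol: "f \<in> hol_ball" using f by (rule little_blochD)
  obtain r where r: "0 < r" "r < 1"
    "\<And>z. r < norm z \<Longrightarrow> norm z < 1 \<Longrightarrow> \<omega> (norm z) * cmod (radial_deriv f z) < 1"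
    using f zero_less_one unfolding little_bloch_iff[OF \<omega>] by blast
  \<comment> \<open>The bound below 1 holds strictly outside radius r, so the maximum principle is
    used on a slightly larger sphere.\<close>
  define s where "s = (1 + r) / 2"
  have s: "r < s" "0 < s" "s < 1" using r by (auto simp: s_def)
  note pos = normal_weight_pos[OF \<omega>]
  have K: "cmod (radial_deriv f w) \<le> 1 / \<omega> s" if "norm w = s" for w
    using r(3)[of w] that s pos[of s] by (simp add: field_simps)
  show ?thesis
  proof (rule bdd_aboveI2)
    fix z :: 'a assume z: "z \<in> ball 0 1"
    show "\<omega> (norm z) * cmod (radial_deriv f z) \<le> max 1 (C * \<omega> 0 * (1 / \<omega> s))"
    proof (cases "norm z \<le> s")
      case True
      have "cmod (radial_deriv f z) \<le> 1 / \<omega> s"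
      proof (cases "z = 0")
        case True
        then show ?thesis using radial_deriv_zero[OF hol] pos[of s] s by simp
      next
        case False
        have "cdiff_on (radial_deriv f) (ball 0 1)"
          using hol by (simp add: hol_ball_iff cdiff_on_radial_deriv)
        from maximum_modulus_ball[OF this s(3) K False True] show ?thesis .
      qed
      moreover have "\<omega> (norm z) \<le> C * \<omega> 0" using C(2)[of 0 "norm z"] z by simp
      ultimately have "\<omega> (norm z) * cmod (radial_deriv f z) \<le> C * \<omega> 0 * (1 / \<omega> s)"
        using C(1) pos[of 0] by (intro mult_mono) auto
      then show ?thesis by simp
    next
      case False
      then show ?thesis using r(3)[of z] s z by simp
    qed
  qed
qed

section \<open>The norm of the little space and pointwise growth\<close>

lemma bloch_norm_ge:
  assumes \<omega>: "normal_weight \<omega>" and f: "f \<in> little_bloch \<omega>" and z: "z \<in> ball 0 1"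
  shows "cmod (f 0) + \<omega> (norm z) * cmod (radial_deriv f z) \<le> bloch_norm \<omega> f"
  unfolding bloch_norm_def by (intro add_left_mono cSUP_upper little_bloch_bdd_above assms)

lemma bloch_norm_le:
  assumes "\<And>z::'a::complex_banach. z \<in> ball 0 1 \<Longrightarrow> \<omega> (norm z) * cmod (radial_deriv f z) \<le> N"
  shows "bloch_norm \<omega> f \<le> cmod (f 0) + N"
  unfolding bloch_norm_def by (intro add_left_mono cSUP_least assms) auto

lemma
  assumes \<omega>: "normal_weight \<omega>" and f: "f \<in> little_bloch \<omega>"
  shows bloch_norm_ge_at_zero: "cmod (f 0) \<le> bloch_norm \<omega> f"
    and bloch_norm_ge_deriv: "z \<in> ball 0 1 \<Longrightarrow> \<omega> (norm z) * cmod (radial_deriv f z) \<le> bloch_norm \<omega> f"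
    and bloch_norm_nonneg: "0 \<le> bloch_norm \<omega> f"
proof -
  show 0: "cmod (f 0) \<le> bloch_norm \<omega> f"
    using bloch_norm_ge[OF assms, of 0] normal_weight_pos[OF \<omega>, of 0]
      radial_deriv_zero[OF little_blochD[OF f]] by simp
  then show "0 \<le> bloch_norm \<omega> f" using norm_ge_zero order_trans by blast
  show "\<omega> (norm z) * cmod (radial_deriv f z) \<le> bloch_norm \<omega> f" if "z \<in> ball 0 1"
    using bloch_norm_ge[OF assms that] norm_ge_zero[of "f 0"] by linarith
qed

lemma norm_less_one_to_sphere: "\<forall>\<^sub>F z in to_sphere. norm z < 1"
  unfolding eventually_to_sphere by (auto intro: exI[of _ "1/2"])

lemma little_bloch_dominated:
  fixes h :: "'a::complex_banach \<Rightarrow> complex"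
  assumes \<omega>: "normal_weight \<omega>" and h: "h \<in> hol_ball"
    and b: "\<And>z. norm z < 1 \<Longrightarrow> \<omega> (norm z) * cmod (radial_deriv h z) \<le> b z"
    and lim: "(b \<longlongrightarrow> 0) to_sphere"
  shows "h \<in> little_bloch \<omega>"
proof -
  have "\<forall>\<^sub>F z::'a in to_sphere. norm (\<omega> (norm z) * cmod (radial_deriv h z)) \<le> b z"
    using norm_less_one_to_sphere
  proof eventually_elim
    case (elim z)
    then show ?case using b[OF elim] normal_weight_pos[OF \<omega>, of "norm z"] by simp
  qed
  from Lim_null_comparison[OF this lim] show ?thesis using h by (simp add: little_bloch_def)
qed

lemma little_bloch_diff:
  fixes f g :: "'a::complex_banach \<Rightarrow> complex"
  assumes \<omega>: "normal_weight \<omega>" and f: "f \<in> little_bloch \<omega>" and g: "g \<in> little_bloch \<omega>"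
  shows "(\<lambda>z\<in>ball 0 1. f z - g z) \<in> little_bloch \<omega>"
proof -
  have R0: "((\<lambda>z. \<omega> (norm z) * cmod (radial_deriv f z)) \<longlongrightarrow> 0) to_sphere"
    "((\<lambda>z. \<omega> (norm z) * cmod (radial_deriv g z)) \<longlongrightarrow> 0) to_sphere"
    using f g by (auto simp: little_bloch_def)
  note fg = little_blochD[OF f] little_blochD[OF g]
  show ?thesis
  proof (rule little_bloch_dominated[OF \<omega> hol_ball_diff[OF fg]])
    fix z :: 'a assume "norm z < 1"
    then show "\<omega> (norm z) * cmod (radial_deriv (\<lambda>z\<in>ball 0 1. f z - g z) z)
      \<le> \<omega> (norm z) * cmod (radial_deriv f z) + \<omega> (norm z) * cmod (radial_deriv g z)"
      using radial_deriv_diff[OF fg, of z] normal_weight_pos[OF \<omega>, of "norm z"]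
      by (simp add: distrib_left[symmetric] mult_left_mono norm_triangle_ineq4)
  qed (use tendsto_add[OF R0] in simp)
qed

text \<open>On the line through z the radial derivative is \<zeta>F'(\<zeta>), and F' is integrated
  along the ray. Dividing by \<zeta> costs a factor 2 outside the disc of radius 1/2. Inside, F' is
  bounded by its values on the circle of radius 1/2, and \<omega> is comparable to its value at
  1/2.\<close>

lemma little_bloch_growth:
  assumes \<omega>: "normal_weight \<omega>"
  obtains C where "0 < C" "\<And>(f :: 'a::complex_banach \<Rightarrow> complex) N (z :: 'a). f \<in> hol_ball \<Longrightarrow>
      (\<And>w. w \<in> ball 0 1 \<Longrightarrow> \<omega> (norm w) * cmod (radial_deriv f w) \<le> N) \<Longrightarrow> z \<in> ball 0 1 \<Longrightarrow>
      cmod (f z - f 0) \<le> C * N * integral {0..norm z} (\<lambda>t. 1 / \<omega> t)"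
proof -
  obtain b C where b: "0 < b" "1 \<le> C"
    "\<And>s t. 0 \<le> s \<Longrightarrow> s \<le> t \<Longrightarrow> t < 1 \<Longrightarrow> \<omega> s \<le> C * \<omega> t * ((1 - s) / (1 - t)) powr b"
    using normal_weight_comparison[OF \<omega>] by metis
  note pos = normal_weight_pos[OF \<omega>]
  \<comment> \<open>For s in [0, 1/2] the quotient (1 - s) / (1 - 1/2) is at most 2.\<close>
  define B where "B = C * 2 powr b"
  have B: "1 \<le> B" using b mult_mono[of 1 C 1 "2 powr b"] ge_one_powr_ge_zero[of 2 b] by (simp add: B_def)
  have half: "\<omega> s \<le> B * \<omega> (1/2)" if "0 \<le> s" "s \<le> 1/2" for s
  proof -
    have "\<omega> s \<le> C * \<omega> (1/2) * ((1 - s) / (1 - 1/2)) powr b" using b(3)[of s "1/2"] that by simp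
    also have "\<dots> \<le> C * \<omega> (1/2) * 2 powr b"
      using that b pos[of "1/2"] by (intro mult_left_mono powr_mono2) auto
    finally show ?thesis by (simp add: B_def mult_ac)
  qed
  show thesis
  proof (rule that[of "2 * B"])
    show "0 < 2 * B" using B by simp
    fix f :: "'a \<Rightarrow> complex" and N and z :: 'a
    assume f: "f \<in> hol_ball" and N: "\<And>w. w \<in> ball 0 1 \<Longrightarrow> \<omega> (norm w) * cmod (radial_deriv f w) \<le> N"
      and z: "z \<in> ball 0 1"
    show "cmod (f z - f 0) \<le> 2 * B * N * integral {0..norm z} (\<lambda>t. 1 / \<omega> t)"
    proof (cases "z = 0")
      case False
      have N0: "0 \<le> N" using N[of 0] radial_deriv_zero[OF f] by simp
      define u where "u = z /\<^sub>R norm z"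
      have u: "norm u = 1" using False by (simp add: u_def)
      define F where "F = (\<lambda>\<zeta>. f (scaleC \<zeta> u))"
      have in_ball: "scaleC \<zeta> u \<in> ball 0 1" if "cmod \<zeta> < 1" for \<zeta>
        using that u by (simp add: norm_scaleC)
      have der: "(F has_field_derivative frechet_derivative f (at (scaleC \<zeta> u)) u) (at \<zeta>)"
        if "cmod \<zeta> < 1" for \<zeta>
        using has_cderiv_line[of f _ 0 \<zeta> u] hol_ball_has_cderiv[OF f in_ball[OF that]]
        by (simp add: F_def)
      have dF: "(F has_field_derivative deriv F \<zeta>) (at \<zeta>)" if "cmod \<zeta> < 1" for \<zeta>
        using der[OF that] DERIV_imp_deriv by metis
      have Rf: "radial_deriv f (scaleC \<zeta> u) = \<zeta> * deriv F \<zeta>" if "cmod \<zeta> < 1" for \<zeta>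
        using DERIV_imp_deriv[OF der[OF that]] hol_ball_has_cderiv[OF f in_ball[OF that]]
        by (simp add: radial_deriv_def has_cderiv_def)
      have "F holomorphic_on ball 0 1"
        unfolding holomorphic_on_open[OF open_ball] using dF by (metis mem_ball_0)
      then have hol: "deriv F holomorphic_on ball 0 1" by (simp add: holomorphic_deriv)
      have bound1: "cmod (deriv F \<zeta>) \<le> 2 * N / \<omega> (cmod \<zeta>)" if \<zeta>: "1/2 \<le> cmod \<zeta>" "cmod \<zeta> < 1" for \<zeta>
      proof -
        have "\<omega> (cmod \<zeta>) * (cmod \<zeta> * cmod (deriv F \<zeta>)) \<le> N"
          using N[OF in_ball[OF \<zeta>(2)]] Rf[OF \<zeta>(2)] u by (simp add: norm_scaleC norm_mult)
        moreover have "\<omega> (cmod \<zeta>) * (1/2 * cmod (deriv F \<zeta>)) \<le> \<omega> (cmod \<zeta>) * (cmod \<zeta> * cmod (deriv F \<zeta>))"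
          using \<zeta> pos[of "cmod \<zeta>"] by (intro mult_left_mono mult_right_mono) auto
        ultimately have "\<omega> (cmod \<zeta>) * (1/2 * cmod (deriv F \<zeta>)) \<le> N" by linarith
        then show ?thesis using pos[of "cmod \<zeta>"] \<zeta> by (simp add: field_simps)
      qed
      have bound2: "cmod (deriv F \<zeta>) \<le> 2 * B * N * (1 / \<omega> (cmod \<zeta>))" if \<zeta>: "cmod \<zeta> < 1" for \<zeta>
      proof (cases "cmod \<zeta> \<le> 1/2")
        case True
        have "cmod (deriv F \<zeta>) \<le> 2 * N / \<omega> (1/2)"
        proof (rule maximum_modulus_frontier[of "deriv F" "cball 0 (1/2)"])
          show "deriv F holomorphic_on interior (cball 0 (1/2))"
            using hol by (rule holomorphic_on_subset) auto
          have "continuous_on (cball 0 (1/2)) (deriv F)"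
            by (rule holomorphic_on_imp_continuous_on[OF holomorphic_on_subset[OF hol]]) auto
          then show "continuous_on (closure (cball 0 (1/2))) (deriv F)" by simp
          fix \<xi> :: complex assume "\<xi> \<in> frontier (cball 0 (1/2))"
          then have \<xi>: "cmod \<xi> = 1/2" by simp
          have "1/2 \<le> cmod \<xi>" "cmod \<xi> < 1" by (simp_all only: \<xi>)
          from bound1[OF this] show "cmod (deriv F \<xi>) \<le> 2 * N / \<omega> (1/2)" unfolding \<xi> .
        qed (use True in auto)
        also have "\<dots> = 2 * N * (1 / \<omega> (1/2))" by simp
        also have "\<dots> \<le> 2 * N * (B / \<omega> (cmod \<zeta>))"
          using half[of "cmod \<zeta>"] True pos[of "1/2"] pos[of "cmod \<zeta>"] N0 \<zeta>
          by (intro mult_left_mono) (auto simp: field_simps)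
        finally show ?thesis by (simp add: mult_ac)
      next
        case False
        have "cmod (deriv F \<zeta>) \<le> 1 * (2 * N / \<omega> (cmod \<zeta>))" using bound1[of \<zeta>] False \<zeta> by simp
        also have "\<dots> \<le> B * (2 * N / \<omega> (cmod \<zeta>))"
          using B N0 pos[of "cmod \<zeta>"] \<zeta> by (intro mult_right_mono) auto
        finally show ?thesis by (simp add: mult_ac)
      qed
      have vd: "((\<lambda>t. F (of_real t)) has_vector_derivative deriv F (of_real t)) (at t within {0..norm z})"
        if "t \<in> {0..norm z}" for t
      proof -
        have "cmod (of_real t) < 1" using that z by simp
        then have "(F \<circ> of_real has_vector_derivative 1 * deriv F (of_real t)) (at t)"
          by (intro field_vector_diff_chain_at dF) (auto intro!: derivative_eq_intros)
        then show ?thesis by (simp add: o_def has_vector_derivative_at_within)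
      qed
      have int: "((\<lambda>t. deriv F (of_real t)) has_integral F (of_real (norm z)) - F (of_real 0)) {0..norm z}"
        by (rule fundamental_theorem_of_calculus) (use vd in auto)
      have "F (of_real (norm z)) = f z" "F (of_real 0) = f 0"
        using False by (simp_all add: F_def scaleC_of_real u_def scaleC.zero_left)
      then have "cmod (f z - f 0) = cmod (integral {0..norm z} (\<lambda>t. deriv F (of_real t)))"
        using integral_unique[OF int] by simp
      also have "\<dots> \<le> integral {0..norm z} (\<lambda>t. 2 * B * N * (1 / \<omega> t))"
      proof (rule Henstock_Kurzweil_Integration.integral_norm_bound_integral)
        show "(\<lambda>t. deriv F (of_real t)) integrable_on {0..norm z}" using int by blast
        show "(\<lambda>t. 2 * B * N * (1 / \<omega> t)) integrable_on {0..norm z}"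
          using normal_weight_inverse_integrable[OF \<omega>, of "norm z"] z
          by (intro integrable_on_mult_right) auto
        fix t assume "t \<in> {0..norm z}"
        then show "cmod (deriv F (of_real t)) \<le> 2 * B * N * (1 / \<omega> t)" using bound2[of "of_real t"] z by simp
      qed
      finally show ?thesis by (simp only: integral_mult_right)
    qed simp
  qed
qed

lemma bloch_norm_diff_triangle:
  fixes f :: "'a::complex_banach \<Rightarrow> complex"
  assumes \<omega>: "normal_weight \<omega>" and fgh: "f \<in> little_bloch \<omega>" "g \<in> little_bloch \<omega>" "h \<in> little_bloch \<omega>"
  shows "bloch_norm \<omega> (\<lambda>z\<in>ball 0 1. f z - h z) \<le>
    bloch_norm \<omega> (\<lambda>z\<in>ball 0 1. f z - g z) + bloch_norm \<omega> (\<lambda>z\<in>ball 0 1. g z - h z)"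
proof -
  let ?d = "\<lambda>f g. \<lambda>z\<in>ball 0 1. f z - g z :: complex"
  note hol = fgh[THEN little_blochD]
  note ge = bloch_norm_ge[OF \<omega> little_bloch_diff[OF \<omega> fgh(1,2)]]
    bloch_norm_ge[OF \<omega> little_bloch_diff[OF \<omega> fgh(2,3)]]
  \<comment> \<open>Norm minus modulus at 0 is the supremum part of the norm; written this way, the
    suprema can be added without being unfolded.\<close>
  have "bloch_norm \<omega> (?d f h) \<le> cmod (?d f h 0) +
    (bloch_norm \<omega> (?d f g) + bloch_norm \<omega> (?d g h) - cmod (?d f g 0) - cmod (?d g h 0))"
  proof (rule bloch_norm_le)
    fix z :: 'a assume z: "z \<in> ball 0 1"
    have "radial_deriv (?d f h) z = radial_deriv (?d f g) z + radial_deriv (?d g h) z"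
      using radial_deriv_diff[OF hol(1,3) z] radial_deriv_diff[OF hol(1,2) z]
        radial_deriv_diff[OF hol(2,3) z] by simp
    then have "\<omega> (norm z) * cmod (radial_deriv (?d f h) z) \<le>
        \<omega> (norm z) * (cmod (radial_deriv (?d f g) z) + cmod (radial_deriv (?d g h) z))"
      using normal_weight_pos[OF \<omega>, of "norm z"] z
      by (simp only:) (intro mult_left_mono norm_triangle_ineq, simp)
    then show "\<omega> (norm z) * cmod (radial_deriv (?d f h) z) \<le>
      bloch_norm \<omega> (?d f g) + bloch_norm \<omega> (?d g h) - cmod (?d f g 0) - cmod (?d g h 0)"
      using ge[OF z] by (simp add: distrib_left)
  qed
  moreover have "cmod (?d f h 0) \<le> cmod (?d f g 0) + cmod (?d g h 0)"
    using norm_triangle_ineq[of "f 0 - g 0" "g 0 - h 0"] by simp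
  ultimately show ?thesis by linarith
qed

text \<open>The summand 1 accounts for the value at 0, so a single factor bounds |f(z)| on the whole
  ball, also at the centre where the integral vanishes.\<close>

definition growth :: "(real \<Rightarrow> real) \<Rightarrow> real \<Rightarrow> real" where
  "growth \<omega> r = 1 + integral {0..r} (\<lambda>t. 1 / \<omega> t)"

lemma growth_mono:
  assumes \<omega>: "normal_weight \<omega>" and "0 \<le> r" "r \<le> s" "s < 1"
  shows "growth \<omega> r \<le> growth \<omega> s"
  unfolding growth_def using assms normal_weight_pos[OF \<omega>]
  by (intro add_left_mono integral_subset_le normal_weight_inverse_integrable[OF \<omega>]) (auto intro: less_imp_le)

lemma growth_ge_one: "normal_weight \<omega> \<Longrightarrow> 0 \<le> r \<Longrightarrow> r < 1 \<Longrightarrow> 1 \<le> growth \<omega> r"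
  using growth_mono[of \<omega> 0 r] by (simp add: growth_def)

lemma little_bloch_pointwise:
  assumes \<omega>: "normal_weight \<omega>"
  obtains C where "0 < C" "\<And>(f :: 'a::complex_banach \<Rightarrow> complex) (z :: 'a). f \<in> little_bloch \<omega> \<Longrightarrow>
      z \<in> ball 0 1 \<Longrightarrow> cmod (f z) \<le> C * bloch_norm \<omega> f * growth \<omega> (norm z)"
proof -
  obtain C where C: "0 < C" "\<And>(f :: 'a \<Rightarrow> complex) N z. f \<in> hol_ball \<Longrightarrow>
      (\<And>w. w \<in> ball 0 1 \<Longrightarrow> \<omega> (norm w) * cmod (radial_deriv f w) \<le> N) \<Longrightarrow> z \<in> ball 0 1 \<Longrightarrow>
      cmod (f z - f 0) \<le> C * N * integral {0..norm z} (\<lambda>t. 1 / \<omega> t)"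
    using little_bloch_growth[OF \<omega>] by blast
  show thesis
  proof (rule that[of "max 1 C"])
    fix f :: "'a \<Rightarrow> complex" and z :: 'a assume f: "f \<in> little_bloch \<omega>" and z: "z \<in> ball 0 1"
    let ?N = "bloch_norm \<omega> f" and ?I = "integral {0..norm z} (\<lambda>t. 1 / \<omega> t)"
    have I: "0 \<le> ?I" using growth_ge_one[OF \<omega>, of "norm z"] z by (simp add: growth_def)
    have N: "0 \<le> ?N" by (rule bloch_norm_nonneg[OF \<omega> f])
    have "cmod (f z) \<le> cmod (f 0) + cmod (f z - f 0)" using norm_triangle_sub by blast
    also have "\<dots> \<le> 1 * ?N + C * ?N * ?I"
      using bloch_norm_ge_at_zero[OF \<omega> f] C(2)[OF little_blochD[OF f] _ z, of ?N]
        bloch_norm_ge_deriv[OF \<omega> f] by simp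
    also have "\<dots> \<le> max 1 C * ?N + max 1 C * ?N * ?I"
      using N I by (intro add_mono mult_right_mono) auto
    finally show "cmod (f z) \<le> max 1 C * ?N * growth \<omega> (norm z)"
      by (simp add: growth_def distrib_left)
  qed simp
qed

text \<open>Distance zero forces equality on the ball through the pointwise estimate, and off the
  ball by extensionality. Symmetry and nonnegativity at foreign arguments come from the value 0 of
  \<open>fun_dist\<close> there.\<close>

lemma Metric_space_little_bloch:
  assumes \<omega>: "normal_weight \<omega>"
  shows "Metric_space (little_bloch \<omega> :: ('a::complex_banach \<Rightarrow> complex) set)
    (fun_dist (little_bloch \<omega>) (bloch_norm \<omega>))"
proof
  let ?X = "little_bloch \<omega> :: ('a \<Rightarrow> complex) set"
  fix f g h :: "'a \<Rightarrow> complex"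
  show "0 \<le> fun_dist ?X (bloch_norm \<omega>) f g"
    using bloch_norm_nonneg[OF \<omega> little_bloch_diff[OF \<omega>, of f g]] by (simp add: fun_dist_def)
  have le: "bloch_norm \<omega> (\<lambda>z\<in>ball 0 1. f z - g z) \<le> bloch_norm \<omega> (\<lambda>z\<in>ball 0 1. g z - f z)"
    if f: "f \<in> ?X" and g: "g \<in> ?X" for f g
  proof -
    let ?h = "\<lambda>z\<in>ball 0 1. g z - f z"
    have "bloch_norm \<omega> (\<lambda>z\<in>ball 0 1. f z - g z) \<le>
      cmod ((\<lambda>z\<in>ball 0 1. f z - g z) 0) + (bloch_norm \<omega> ?h - cmod (?h 0))"
    proof (rule bloch_norm_le)
      fix z :: 'a assume z: "z \<in> ball 0 1"
      show "\<omega> (norm z) * cmod (radial_deriv (\<lambda>z\<in>ball 0 1. f z - g z) z) \<le> bloch_norm \<omega> ?h - cmod (?h 0)"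
        using bloch_norm_ge[OF \<omega> little_bloch_diff[OF \<omega> g f] z]
          radial_deriv_diff[OF little_blochD[OF f] little_blochD[OF g] z]
          radial_deriv_diff[OF little_blochD[OF g] little_blochD[OF f] z]
        by (simp add: norm_minus_commute)
    qed
    then show ?thesis by (simp add: norm_minus_commute)
  qed
  show "fun_dist ?X (bloch_norm \<omega>) f g = fun_dist ?X (bloch_norm \<omega>) g f"
    using le[of f g] le[of g f] by (auto simp: fun_dist_def)
  show "(fun_dist ?X (bloch_norm \<omega>) f g = 0) = (f = g)" if fg: "f \<in> ?X" "g \<in> ?X"
  proof
    assume "fun_dist ?X (bloch_norm \<omega>) f g = 0"
    then have 0: "bloch_norm \<omega> (\<lambda>z\<in>ball 0 1. f z - g z) = 0" using fg by (simp add: fun_dist_def)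
    obtain C where C: "\<And>(f :: 'a \<Rightarrow> complex) z. f \<in> little_bloch \<omega> \<Longrightarrow>
      z \<in> ball 0 1 \<Longrightarrow> cmod (f z) \<le> C * bloch_norm \<omega> f * growth \<omega> (norm z)"
      using little_bloch_pointwise[OF \<omega>] by blast
    have "f z = g z" if "z \<in> ball 0 1" for z
      using C[OF little_bloch_diff[OF \<omega> fg] that] that 0 by simp
    moreover have "f \<in> extensional (ball 0 1)" "g \<in> extensional (ball 0 1)"
      using fg[THEN little_blochD] by (auto simp: hol_ball_iff)
    ultimately show "f = g" by (intro extensionalityI) auto
  next
    assume "f = g"
    have "radial_deriv (\<lambda>z\<in>ball 0 1. g z - g z) z = 0" if "z \<in> ball 0 1" for z
      using radial_deriv_diff[OF little_blochD[OF fg(2)] little_blochD[OF fg(2)] that] by simp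
    then have "bloch_norm \<omega> (\<lambda>z\<in>ball 0 1. g z - g z) \<le> cmod ((\<lambda>z\<in>ball 0 1. g z - g z) 0) + 0"
      by (intro bloch_norm_le) simp
    then have "bloch_norm \<omega> (\<lambda>z\<in>ball 0 1. g z - g z) \<le> 0" by simp
    then show "fun_dist ?X (bloch_norm \<omega>) f g = 0"
      using bloch_norm_nonneg[OF \<omega> little_bloch_diff[OF \<omega> fg(2,2)]] fg \<open>f = g\<close> by (simp add: fun_dist_def)
  qed
  show "fun_dist ?X (bloch_norm \<omega>) f h \<le> fun_dist ?X (bloch_norm \<omega>) f g + fun_dist ?X (bloch_norm \<omega>) g h"
    if "f \<in> ?X" "g \<in> ?X" "h \<in> ?X"
    using bloch_norm_diff_triangle[OF \<omega> that] that by (simp add: fun_dist_def)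
qed

text \<open>By the pointwise estimate a Cauchy sequence is uniformly Cauchy on each smaller ball, so
  it has a holomorphic limit and its radial derivatives converge pointwise. Letting m tend to
  infinity in the Cauchy inequalities then gives convergence in norm.\<close>

lemma little_bloch_complete:
  fixes \<sigma> :: "nat \<Rightarrow> 'a::complex_banach \<Rightarrow> complex"
  assumes \<omega>: "normal_weight \<omega>" and \<sigma>: "\<And>n. \<sigma> n \<in> little_bloch \<omega>"
    and cauchy: "\<And>\<epsilon>. 0 < \<epsilon> \<Longrightarrow> \<exists>N. \<forall>m\<ge>N. \<forall>n\<ge>N. bloch_norm \<omega> (\<lambda>z\<in>ball 0 1. \<sigma> m z - \<sigma> n z) < \<epsilon>"
  obtains f where "f \<in> little_bloch \<omega>"
    "\<And>\<epsilon>. 0 < \<epsilon> \<Longrightarrow> \<exists>N. \<forall>n\<ge>N. bloch_norm \<omega> (\<lambda>z\<in>ball 0 1. \<sigma> n z - f z) < \<epsilon>"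
proof -
  let ?d = "\<lambda>f g. \<lambda>z\<in>ball 0 1. f z - g z :: complex"
  note hol = little_blochD[OF \<sigma>]
  obtain C where C: "0 < C" "\<And>(f :: 'a \<Rightarrow> complex) z. f \<in> little_bloch \<omega> \<Longrightarrow>
      z \<in> ball 0 1 \<Longrightarrow> cmod (f z) \<le> C * bloch_norm \<omega> f * growth \<omega> (norm z)"
    using little_bloch_pointwise[OF \<omega>] by blast
  have unif: "\<exists>N. \<forall>m\<ge>N. \<forall>n\<ge>N. \<forall>z. norm z \<le> r \<longrightarrow> cmod (\<sigma> m z - \<sigma> n z) < e"
    if e: "0 < e" and r: "0 \<le> r" "r < 1" for e r
  proof -
    have G: "0 < C * growth \<omega> r" using C(1) growth_ge_one[OF \<omega> r] by simp
    obtain N where N: "\<And>m n. m \<ge> N \<Longrightarrow> n \<ge> N \<Longrightarrow> bloch_norm \<omega> (?d (\<sigma> m) (\<sigma> n)) < e / (C * growth \<omega> r)"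
      using cauchy[of "e / (C * growth \<omega> r)"] G e by auto
    have "cmod (\<sigma> m z - \<sigma> n z) < e" if mn: "m \<ge> N" "n \<ge> N" and z: "norm z \<le> r" for m n z
    proof -
      have zb: "z \<in> ball 0 1" using z r by simp
      have "cmod (\<sigma> m z - \<sigma> n z) \<le> C * bloch_norm \<omega> (?d (\<sigma> m) (\<sigma> n)) * growth \<omega> (norm z)"
        using C(2)[OF little_bloch_diff[OF \<omega> \<sigma> \<sigma>] zb, of m n] zb by simp
      also have "\<dots> \<le> C * bloch_norm \<omega> (?d (\<sigma> m) (\<sigma> n)) * growth \<omega> r"
        using C(1) z r bloch_norm_nonneg[OF \<omega> little_bloch_diff[OF \<omega> \<sigma> \<sigma>]]
        by (intro mult_left_mono growth_mono[OF \<omega>]) auto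
      also have "\<dots> < e" using N[OF mn] G by (simp add: pos_less_divide_eq mult_ac)
      finally show ?thesis .
    qed
    then show ?thesis by blast
  qed
  define g where "g = (\<lambda>z. lim (\<lambda>n. \<sigma> n z))"
  have conv: "(\<lambda>n. \<sigma> n z) \<longlonglongrightarrow> g z" if z: "z \<in> ball 0 1" for z
  proof -
    have "Cauchy (\<lambda>n. \<sigma> n z)"
    proof (rule metric_CauchyI)
      fix e :: real assume "0 < e"
      from unif[OF this, of "norm z"] z
      show "\<exists>M. \<forall>m\<ge>M. \<forall>n\<ge>M. dist (\<sigma> m z) (\<sigma> n z) < e"
        unfolding dist_norm by auto
    qed
    then show ?thesis unfolding g_def using Cauchy_convergent_iff convergent_LIMSEQ_iff by blast
  qed
  have lim: "\<exists>d>0. uniform_limit (ball z d) \<sigma> g sequentially" if z: "z \<in> ball 0 1" for z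
  proof (intro exI conjI)
    define d where "d = (1 - norm z) / 2"
    define r where "r = norm z + d"
    have r: "0 \<le> r" "r < 1" using z by (auto simp: r_def d_def field_simps)
    show "0 < d" using z by (simp add: d_def)
    show "uniform_limit (ball z d) \<sigma> g sequentially"
    proof (rule uniform_limitI)
      fix e :: real assume e: "0 < e"
      obtain N where N: "\<And>m n w. m \<ge> N \<Longrightarrow> n \<ge> N \<Longrightarrow> norm w \<le> r \<Longrightarrow> cmod (\<sigma> m w - \<sigma> n w) < e/2"
        using unif[of "e/2", OF _ r] e by auto
      have "dist (\<sigma> n w) (g w) < e" if n: "n \<ge> N" and w: "w \<in> ball z d" for n w
      proof -
        have wr: "norm w \<le> r" using w norm_triangle_sub[of w z] by (simp add: r_def dist_norm norm_minus_commute)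
        have "cmod (\<sigma> n w - g w) \<le> e/2"
        proof (rule tendsto_upperbound)
          show "(\<lambda>m. cmod (\<sigma> n w - \<sigma> m w)) \<longlonglongrightarrow> cmod (\<sigma> n w - g w)"
            using wr r by (intro tendsto_intros conv) simp
          show "\<forall>\<^sub>F m in sequentially. cmod (\<sigma> n w - \<sigma> m w) \<le> e/2"
            unfolding eventually_sequentially using N[OF n _ wr] by (blast intro: less_imp_le)
        qed simp
        then show ?thesis using e by (simp add: dist_norm)
      qed
      then show "\<forall>\<^sub>F n in sequentially. \<forall>w\<in>ball z d. dist (\<sigma> n w) (g w) < e"
        unfolding eventually_sequentially by blast
    qed
  qed
  have cd: "cdiff_on (\<sigma> n) (ball 0 1)" for n using hol by (simp add: hol_ball_iff)
  have cg: "cdiff_on g (ball 0 1)"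
    by (rule cdiff_on_uniform_limit[OF cd open_ball lim])
  define f where "f = restrict g (ball 0 1)"
  have fhol: "f \<in> hol_ball" unfolding f_def by (rule restrict_in_hol_ball[OF cg])
  have Rconv: "(\<lambda>n. radial_deriv (\<sigma> n) z) \<longlonglongrightarrow> radial_deriv f z" if z: "z \<in> ball 0 1" for z
    using frechet_derivative_uniform_limit[OF cd open_ball lim z, of z]
      radial_deriv_restrict[OF cdiff_on_frechet[OF cg z] z] by (simp add: radial_deriv_def f_def)
  have pos: "0 \<le> \<omega> (norm z)" if "z \<in> ball 0 1" for z :: 'a
    using normal_weight_pos[OF \<omega>, of "norm z"] that by simp
  \<comment> \<open>The derivative bound is recorded beside the norm bound: it cannot yet be read
    off from the norm, since that requires the limit to lie in the little space, which is proved
    from this very bound.\<close>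
  have est: "\<exists>N. \<forall>n\<ge>N. bloch_norm \<omega> (?d (\<sigma> n) f) \<le> e \<and>
      (\<forall>z\<in>ball 0 1. \<omega> (norm z) * cmod (radial_deriv (\<sigma> n) z - radial_deriv f z) \<le> e)" if e: "0 < e" for e
  proof -
    obtain N where N: "\<And>m n. m \<ge> N \<Longrightarrow> n \<ge> N \<Longrightarrow> bloch_norm \<omega> (?d (\<sigma> m) (\<sigma> n)) < e / 2"
      using cauchy[of "e / 2"] e by auto
    have "bloch_norm \<omega> (?d (\<sigma> n) f) \<le> e \<and>
      (\<forall>z\<in>ball 0 1. \<omega> (norm z) * cmod (radial_deriv (\<sigma> n) z - radial_deriv f z) \<le> e)" if n: "n \<ge> N" for n
    proof -
      have R: "\<omega> (norm z) * cmod (radial_deriv (\<sigma> n) z - radial_deriv f z) \<le> e/2" if z: "z \<in> ball 0 1" for z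
      proof (rule tendsto_upperbound)
        show "(\<lambda>m. \<omega> (norm z) * cmod (radial_deriv (\<sigma> n) z - radial_deriv (\<sigma> m) z))
          \<longlonglongrightarrow> \<omega> (norm z) * cmod (radial_deriv (\<sigma> n) z - radial_deriv f z)"
          by (intro tendsto_intros Rconv z)
        have "\<omega> (norm z) * cmod (radial_deriv (\<sigma> n) z - radial_deriv (\<sigma> m) z) \<le> e/2" if "m \<ge> N" for m
          using bloch_norm_ge_deriv[OF \<omega> little_bloch_diff[OF \<omega> \<sigma> \<sigma>] z, of n m] N[OF n that]
            radial_deriv_diff[OF hol hol z, of n m] by simp
        then show "\<forall>\<^sub>F m in sequentially. \<omega> (norm z) * cmod (radial_deriv (\<sigma> n) z - radial_deriv (\<sigma> m) z) \<le> e/2"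
          unfolding eventually_sequentially by blast
      qed simp
      have "cmod (\<sigma> n 0 - g 0) \<le> e/2"
      proof (rule tendsto_upperbound)
        show "(\<lambda>m. cmod (\<sigma> n 0 - \<sigma> m 0)) \<longlonglongrightarrow> cmod (\<sigma> n 0 - g 0)"
          by (intro tendsto_intros conv) simp
        have "cmod (\<sigma> n 0 - \<sigma> m 0) \<le> e/2" if "m \<ge> N" for m
          using bloch_norm_ge_at_zero[OF \<omega> little_bloch_diff[OF \<omega> \<sigma> \<sigma>], of n m] N[OF n that] by simp
        then show "\<forall>\<^sub>F m in sequentially. cmod (\<sigma> n 0 - \<sigma> m 0) \<le> e/2"
          unfolding eventually_sequentially by blast
      qed simp
      moreover have "bloch_norm \<omega> (?d (\<sigma> n) f) \<le> cmod (?d (\<sigma> n) f 0) + e/2"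
        by (rule bloch_norm_le) (use R radial_deriv_diff[OF hol fhol] in simp)
      ultimately have "bloch_norm \<omega> (?d (\<sigma> n) f) \<le> e" by (simp add: f_def)
      then show ?thesis using R e by fastforce
    qed
    then show ?thesis by blast
  qed
  show thesis
  proof
    show "f \<in> little_bloch \<omega>"
      unfolding little_bloch_iff[OF \<omega>]
    proof (intro conjI fhol allI impI)
      fix e :: real assume e: "0 < e"
      obtain n where n: "\<And>z. z \<in> ball 0 1 \<Longrightarrow> \<omega> (norm z) * cmod (radial_deriv (\<sigma> n) z - radial_deriv f z) \<le> e/2"
        using est[OF half_gt_zero[OF e]] by blast
      obtain r where r: "0 < r" "r < 1" "\<And>z. r < norm z \<Longrightarrow> norm z < 1 \<Longrightarrow> \<omega> (norm z) * cmod (radial_deriv (\<sigma> n) z) < e/2"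
        using \<sigma>[of n] half_gt_zero[OF e] unfolding little_bloch_iff[OF \<omega>] by blast
      have "\<omega> (norm z) * cmod (radial_deriv f z) < e" if z: "r < norm z" "norm z < 1" for z
      proof -
        have "\<omega> (norm z) * cmod (radial_deriv f z) \<le>
          \<omega> (norm z) * (cmod (radial_deriv (\<sigma> n) z) + cmod (radial_deriv (\<sigma> n) z - radial_deriv f z))"
          using z by (intro mult_left_mono pos) (auto simp: norm_minus_commute intro: norm_triangle_sub)
        then show ?thesis using n[of z] r(3)[OF z] z by (simp add: distrib_left)
      qed
      then show "\<exists>r. 0 < r \<and> r < 1 \<and> (\<forall>z. r < norm z \<longrightarrow> norm z < 1 \<longrightarrow> \<omega> (norm z) * cmod (radial_deriv f z) < e)"
        using r by blast
    qed
    fix e :: real assume e: "0 < e"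
    then have "e / 2 < e" by simp
    then show "\<exists>N. \<forall>n\<ge>N. bloch_norm \<omega> (?d (\<sigma> n) f) < e"
      using est[OF half_gt_zero[OF e]] le_less_trans by blast
  qed
qed

lemma mcomplete_little_bloch:
  fixes \<omega> :: "real \<Rightarrow> real"
  assumes \<omega>: "normal_weight \<omega>"
  shows "Metric_space.mcomplete (little_bloch \<omega> :: ('a::complex_banach \<Rightarrow> complex) set)
    (fun_dist (little_bloch \<omega>) (bloch_norm \<omega>))"
proof -
  let ?X = "little_bloch \<omega> :: ('a \<Rightarrow> complex) set"
  interpret M: Metric_space ?X "fun_dist ?X (bloch_norm \<omega>)"
    by (rule Metric_space_little_bloch[OF \<omega>])
  show ?thesis
    unfolding M.mcomplete_def
  proof (intro allI impI)
    fix \<sigma> assume "M.MCauchy \<sigma>"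
    then have X: "\<And>n. \<sigma> n \<in> ?X"
      and c: "\<And>e. 0 < e \<Longrightarrow> \<exists>N. \<forall>m n. N \<le> m \<longrightarrow> N \<le> n \<longrightarrow> fun_dist ?X (bloch_norm \<omega>) (\<sigma> m) (\<sigma> n) < e"
      unfolding M.MCauchy_def by auto
    have c': "\<exists>N. \<forall>m\<ge>N. \<forall>n\<ge>N. bloch_norm \<omega> (\<lambda>z\<in>ball 0 1. \<sigma> m z - \<sigma> n z) < e" if "0 < e" for e
      using c[OF that] X by (simp add: fun_dist_def)
    obtain f where f: "f \<in> ?X" "\<And>e. 0 < e \<Longrightarrow> \<exists>N. \<forall>n\<ge>N. bloch_norm \<omega> (\<lambda>z\<in>ball 0 1. \<sigma> n z - f z) < e"
      using little_bloch_complete[OF \<omega> X c'] by blast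
    have "limitin M.mtopology \<sigma> f sequentially"
      unfolding M.limitin_metric eventually_sequentially using f X by (simp add: fun_dist_def)
    then show "\<exists>f. limitin M.mtopology \<sigma> f sequentially" by blast
  qed
qed

section \<open>Norming functionals\<close>

definition sublinear :: "('a::real_vector \<Rightarrow> real) \<Rightarrow> bool" where
  "sublinear p \<longleftrightarrow> (\<forall>x y. p (x + y) \<le> p x + p y) \<and> (\<forall>c x. 0 \<le> c \<longrightarrow> p (c *\<^sub>R x) = c * p x)"

lemma
  assumes p: "sublinear p"
  shows sublinear_add: "p (x + y) \<le> p x + p y"
    and sublinear_scaleR: "0 \<le> c \<Longrightarrow> p (c *\<^sub>R x) = c * p x"
    and sublinear_zero: "p 0 = 0"
    and sublinear_minus: "- p (- x) \<le> p x"
proof -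
  have add: "p (x + y) \<le> p x + p y" for x y using p by (simp add: sublinear_def)
  have scale: "0 \<le> c \<Longrightarrow> p (c *\<^sub>R x) = c * p x" for c x using p by (simp add: sublinear_def)
  have 0: "p 0 = 0" using scale[of 0 0] by simp
  show "p (x + y) \<le> p x + p y" "0 \<le> c \<Longrightarrow> p (c *\<^sub>R x) = c * p x" "p 0 = 0"
    by (fact add scale 0)+
  show "- p (- x) \<le> p x" using add[of x "- x"] 0 by simp
qed

text \<open>One inequality suffices for homogeneity: applied to \<open>inverse c\<close> it yields
  the reverse one.\<close>

lemma sublinearI:
  assumes add: "\<And>x y. p (x + y) \<le> p x + p y" and 0: "p 0 = 0"
    and scale: "\<And>c x. 0 < c \<Longrightarrow> p (c *\<^sub>R x) \<le> c * p x"
  shows "sublinear p"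
  unfolding sublinear_def
proof (intro conjI allI impI add)
  fix c :: real and x assume "0 \<le> c"
  show "p (c *\<^sub>R x) = c * p x"
  proof (cases "c = 0")
    case False
    with \<open>0 \<le> c\<close> have c: "0 < c" by simp
    have "p x \<le> inverse c * p (c *\<^sub>R x)" using scale[of "inverse c" "c *\<^sub>R x"] c by simp
    then have "c * p x \<le> p (c *\<^sub>R x)" using c by (simp add: field_simps)
    with scale[OF c, of x] show ?thesis by simp
  qed (simp add: 0)
qed

text \<open>Lowers p so far that a linear functional below the result is forced to take the value
  \<open>p y\<close> at y. This serves twice: to show that a minimal sublinear functional is linear,
  and to make a functional norming.\<close>

definition lower_along :: "('a::real_vector \<Rightarrow> real) \<Rightarrow> 'a \<Rightarrow> 'a \<Rightarrow> real" where
  "lower_along p y x = (INF t\<in>{0..}. p (x + t *\<^sub>R y) - t * p y)"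

lemma
  assumes p: "sublinear p"
  shows sublinear_lower_along: "sublinear (lower_along p y)"
    and lower_along_le: "lower_along p y x \<le> p x"
    and lower_along_minus: "lower_along p y (- y) \<le> - p y"
proof -
  let ?q = "lower_along p y"
  \<comment> \<open>Keeps the infimum finite: x + ty and -x add up to ty.\<close>
  have ge: "- p (- x) \<le> p (x + t *\<^sub>R y) - t * p y" if "0 \<le> t" for x t
    using sublinear_add[OF p, of "x + t *\<^sub>R y" "- x"] sublinear_scaleR[OF p that, of y] by simp
  have le: "?q x \<le> p (x + t *\<^sub>R y) - t * p y" if "0 \<le> t" for x t
    unfolding lower_along_def using that
    by (intro cINF_lower bdd_belowI2[where m = "- p (- x)"] ge) auto
  have greatest: "m \<le> ?q x" if "\<And>t. 0 \<le> t \<Longrightarrow> m \<le> p (x + t *\<^sub>R y) - t * p y" for m x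
    unfolding lower_along_def using that by (intro cINF_greatest) auto
  show qp: "?q x \<le> p x" for x using le[of 0 x] by simp
  show "?q (- y) \<le> - p y" using le[of 1 "- y"] sublinear_zero[OF p] by simp
  show "sublinear ?q"
  proof (rule sublinearI)
    fix x1 x2
    \<comment> \<open>The parameter t1 + t2 for the sum is at least as good as t1 and t2 taken
      separately; the infimum is taken over t2 with t1 fixed, and then over t1.\<close>
    have "?q (x1 + x2) - ?q x2 \<le> p (x1 + t1 *\<^sub>R y) - t1 * p y" if t1: "0 \<le> t1" for t1
    proof -
      have "?q (x1 + x2) - (p (x1 + t1 *\<^sub>R y) - t1 * p y) \<le> ?q x2"
      proof (rule greatest)
        fix t2 :: real assume t2: "0 \<le> t2"
        have "?q (x1 + x2) \<le> p ((x1 + x2) + (t1 + t2) *\<^sub>R y) - (t1 + t2) * p y"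
          using t1 t2 by (intro le) simp
        also have "(x1 + x2) + (t1 + t2) *\<^sub>R y = (x1 + t1 *\<^sub>R y) + (x2 + t2 *\<^sub>R y)"
          by (simp add: algebra_simps)
        finally show "?q (x1 + x2) - (p (x1 + t1 *\<^sub>R y) - t1 * p y) \<le> p (x2 + t2 *\<^sub>R y) - t2 * p y"
          using sublinear_add[OF p, of "x1 + t1 *\<^sub>R y" "x2 + t2 *\<^sub>R y"] by (simp add: algebra_simps)
      qed
      then show ?thesis by simp
    qed
    from greatest[OF this] show "?q (x1 + x2) \<le> ?q x1 + ?q x2" by simp
  next
    show "?q 0 = 0"
      using qp[of 0] greatest[of 0 0] ge[of _ 0] sublinear_zero[OF p] by (intro antisym) auto
  next
    fix c :: real and x :: 'a assume c: "0 < c"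
    have "?q (c *\<^sub>R x) / c \<le> ?q x"
    proof (rule greatest)
      fix t :: real assume t: "0 \<le> t"
      have "?q (c *\<^sub>R x) \<le> p (c *\<^sub>R x + (c * t) *\<^sub>R y) - (c * t) * p y"
        using c t by (intro le) simp
      also have "c *\<^sub>R x + (c * t) *\<^sub>R y = c *\<^sub>R (x + t *\<^sub>R y)" by (simp add: algebra_simps)
      also have "p (c *\<^sub>R (x + t *\<^sub>R y)) - (c * t) * p y = c * (p (x + t *\<^sub>R y) - t * p y)"
        using sublinear_scaleR[OF p, of c "x + t *\<^sub>R y"] c by (simp add: right_diff_distrib)
      finally show "?q (c *\<^sub>R x) / c \<le> p (x + t *\<^sub>R y) - t * p y"
        using c by (simp add: field_simps)
    qed
    then show "?q (c *\<^sub>R x) \<le> c * ?q x" using c by (simp add: field_simps)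
  qed
qed

text \<open>A minimal sublinear functional \<open>m\<close> is unchanged by \<open>lower_along\<close>, whence \<open>m (- y) \<le> - m y\<close>,
  which makes it linear.\<close>

lemma Hahn_Banach_sublinear:
  fixes p :: "'a::real_vector \<Rightarrow> real"
  assumes p: "sublinear p"
  obtains l where "linear l" "\<And>x. l x \<le> p x"
proof -
  define A where "A = {q. sublinear q \<and> (\<forall>x. q x \<le> p x)}"
  \<comment> \<open>The order is reversed, so that a maximal element in Zorn's lemma is a pointwise
    minimal functional.\<close>
  define P :: "('a \<Rightarrow> real) \<Rightarrow> ('a \<Rightarrow> real) \<Rightarrow> bool" where "P = (\<lambda>q r. \<forall>x. r x \<le> q x)"
  have "\<exists>m\<in>A. \<forall>a\<in>A. P m a \<longrightarrow> a = m"
  proof (rule predicate_Zorn)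
    show "partial_order_on A (relation_of P A)"
      unfolding partial_order_on_def preorder_on_def refl_on_def trans_def antisym_def relation_of_def P_def
      by (auto intro: order_trans simp: fun_eq_iff intro!: antisym)
    fix C assume C: "C \<in> Chains (relation_of P A)"
    show "\<exists>u\<in>A. \<forall>a\<in>C. P a u"
    proof (cases "C = {}")
      case True
      then show ?thesis using p by (auto simp: A_def)
    next
      case False
      have CA: "sublinear q" "q x \<le> p x" if "q \<in> C" for q x
        using C that by (auto simp: Chains_def relation_of_def A_def)
      have chain: "(\<forall>x. q x \<le> r x) \<or> (\<forall>x. r x \<le> q x)" if "q \<in> C" "r \<in> C" for q r
        using C that by (auto simp: Chains_def relation_of_def P_def)
      define u where "u = (\<lambda>x. INF q\<in>C. q x)"
      have ge: "- p (- x) \<le> q x" if "q \<in> C" for q x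
        using sublinear_minus[OF CA(1)[OF that], of x] CA(2)[OF that, of "- x"] by linarith
      have le: "u x \<le> q x" if "q \<in> C" for q x
        unfolding u_def using that by (intro cINF_lower bdd_belowI2[where m = "- p (- x)"] ge) auto
      have greatest: "m \<le> u x" if "\<And>q. q \<in> C \<Longrightarrow> m \<le> q x" for m x
        unfolding u_def using that False by (intro cINF_greatest) auto
      have "sublinear u"
      proof (rule sublinearI)
        fix x y
        have "u (x + y) - u y \<le> q x" if q: "q \<in> C" for q
        proof -
          have "u (x + y) - q x \<le> u y"
          proof (rule greatest)
            fix r assume r: "r \<in> C"
            have "u (x + y) \<le> q x + q y" "u (x + y) \<le> r x + r y"
              using le[OF q, of "x + y"] le[OF r, of "x + y"] sublinear_add[OF CA(1)[OF q], of x y]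
                sublinear_add[OF CA(1)[OF r], of x y] by linarith+
            \<comment> \<open>Comparability in the chain lets both summands be taken from the same
              functional, whichever of the two is smaller.\<close>
            moreover have "q y \<le> r y \<or> r x \<le> q x" using chain[OF q r] by blast
            ultimately show "u (x + y) - q x \<le> r y" by linarith
          qed
          then show ?thesis by simp
        qed
        then have "u (x + y) - u y \<le> u x" by (rule greatest)
        then show "u (x + y) \<le> u x + u y" by simp
      next
        obtain q where "q \<in> C" using False by blast
        then have "u 0 \<le> 0" using le[of q 0] sublinear_zero[OF CA(1)[of q]] by simp
        moreover have "0 \<le> u 0"
          by (intro greatest eq_refl[OF sublinear_zero[OF CA(1), symmetric]])
        ultimately show "u 0 = 0" by simp
      next
        fix c :: real and x :: 'a assume c: "0 < c"
        have "u (c *\<^sub>R x) / c \<le> u x"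
        proof (rule greatest)
          fix q assume q: "q \<in> C"
          show "u (c *\<^sub>R x) / c \<le> q x"
            using le[OF q, of "c *\<^sub>R x"] sublinear_scaleR[OF CA(1)[OF q], of c x] c by (simp add: field_simps)
        qed
        then show "u (c *\<^sub>R x) \<le> c * u x" using c by (simp add: field_simps)
      qed
      moreover have "u x \<le> p x" for x
      proof -
        obtain q where "q \<in> C" using False by blast
        then show ?thesis using le[of q x] CA(2)[of q x] by linarith
      qed
      ultimately show ?thesis using le by (auto simp: A_def P_def)
    qed
  qed
  then obtain m where m: "sublinear m" "\<And>x. m x \<le> p x"
    and min: "\<And>q. q \<in> A \<Longrightarrow> (\<And>x. q x \<le> m x) \<Longrightarrow> q = m"
    unfolding A_def P_def by blast
  have "lower_along m y = m" for y
    using sublinear_lower_along[OF m(1)] lower_along_le[OF m(1)] order_trans[OF lower_along_le[OF m(1)] m(2)]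
    by (intro min) (auto simp: A_def)
  then have "m (- y) \<le> - m y" for y using lower_along_minus[OF m(1), of y] by simp
  then have neg: "m (- y) = - m y" for y using sublinear_minus[OF m(1), of "- y"] by (simp add: antisym)
  have "linear m"
  proof (rule linearI)
    fix x y :: 'a and c :: real
    show "m (x + y) = m x + m y"
      using sublinear_add[OF m(1), of x y] sublinear_add[OF m(1), of "- x" "- y"] neg[of "x + y"] neg[of x] neg[of y]
      by simp
    show "m (c *\<^sub>R x) = c *\<^sub>R m x"
    proof (cases "0 \<le> c")
      case False
      then show ?thesis using sublinear_scaleR[OF m(1), of "- c" x] neg[of "c *\<^sub>R x"] by simp
    qed (simp add: sublinear_scaleR[OF m(1)])
  qed
  then show thesis using that m(2) by blast
qed

text \<open>A real functional below \<open>lower_along norm z\<close> is bounded by the norm and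
  equals it at z. The usual complexification l(x) - i l(ix) turns it into a complex linear
  functional of the same bound.\<close>

lemma norming_functional:
  fixes z :: "'a::complex_banach"
  obtains L where "bounded_linear L" "\<And>c x. L (scaleC c x) = c * L x"
    "\<And>x. cmod (L x) \<le> norm x" "L z = complex_of_real (norm z)"
proof -
  have n: "sublinear (norm :: 'a \<Rightarrow> real)" by (simp add: sublinear_def norm_triangle_ineq)
  obtain l where l: "linear l" "\<And>x. l x \<le> lower_along norm z x"
    using Hahn_Banach_sublinear[OF sublinear_lower_along[OF n]] by blast
  have l_le: "l x \<le> norm x" for x using l(2) lower_along_le[OF n] order_trans by blast
  have lz: "norm z \<le> l z"
    using l(2)[of "- z"] lower_along_minus[OF n, of z] linear_neg[OF l(1), of z] by simp
  note lin = linear_add[OF l(1)] linear_scale[OF l(1)] linear_diff[OF l(1)]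
  define L where "L = (\<lambda>x. Complex (l x) (- l (scaleC \<i> x)))"
  have C: "L (scaleC c x) = c * L x" for c x
  proof -
    have 1: "scaleC c x = Re c *\<^sub>R x + Im c *\<^sub>R scaleC \<i> x"
      by (metis complex_eq scaleC_add_left scaleC_of_real scaleC_scaleC mult.commute)
    have 2: "scaleC \<i> (scaleC c x) = Re c *\<^sub>R scaleC \<i> x - Im c *\<^sub>R x"
    proof -
      have "\<i> * c = of_real (Re c) * \<i> - of_real (Im c)" by (simp add: complex_eq_iff)
      then have "scaleC \<i> (scaleC c x) = scaleC (of_real (Re c) * \<i> - of_real (Im c)) x"
        by (simp add: scaleC_scaleC)
      then show ?thesis by (simp add: scaleC.diff_left scaleC_scaleC[symmetric] scaleC_of_real)
    qed
    show ?thesis unfolding L_def 2 unfolding 1 by (simp add: lin complex_eq_iff algebra_simps)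
  qed
  have bound: "cmod (L x) \<le> norm x" for x
  proof (cases "L x = 0")
    case False
    \<comment> \<open>Rotating x by \<theta> makes the value of L real and nonnegative, hence equal
      to its real part l, for which the bound is known.\<close>
    define \<theta> where "\<theta> = cnj (L x) / of_real (cmod (L x))"
    have "cmod \<theta> = 1" using False by (simp add: \<theta>_def norm_divide)
    have "\<theta> * L x = of_real (cmod (L x))"
      using False by (simp add: \<theta>_def complex_norm_square[symmetric] power2_eq_square mult.commute)
    then have "L (scaleC \<theta> x) = of_real (cmod (L x))" by (simp add: C)
    then have "cmod (L x) = l (scaleC \<theta> x)" by (simp add: L_def complex_eq_iff)
    also have "\<dots> \<le> norm x" using l_le[of "scaleC \<theta> x"] \<open>cmod \<theta> = 1\<close> by (simp add: norm_scaleC)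
    finally show ?thesis .
  qed simp
  show thesis
  proof (rule that[of L])
    show "bounded_linear L"
    proof (rule bounded_linear_intro[where K = 1])
      show "L (x + y) = L x + L y" for x y
        by (simp add: L_def lin scaleC_add_right complex_eq_iff)
      show "L (r *\<^sub>R x) = r *\<^sub>R L x" for r x
        using C[of "of_real r" x] by (simp add: scaleC_of_real scaleR_conv_of_real)
    qed (simp add: bound)
    \<comment> \<open>A number of modulus at most |z| whose real part is at least |z| is
      real.\<close>
    have "norm z \<le> Re (L z)" using lz by (simp add: L_def)
    moreover have "Re (L z) \<le> cmod (L z)" by (rule complex_Re_le_cmod)
    ultimately have "Re (L z) = norm z" "cmod (L z) = norm z" using bound[of z] by auto
    then show "L z = of_real (norm z)"
      using cmod_eq_Re[of "L z"] cmod_power2[of "L z"] by (simp add: complex_eq_iff)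
  qed (fact C bound)+
qed

section \<open>Extremal functions\<close>

text \<open>With n at least c, u^c is at most n^n (u/n)^n, and u/n is at most exp(u/n), whose n-th
  power is exp u.\<close>

lemma powr_le_exp:
  fixes c :: real
  obtains K where "1 \<le> K" "\<And>u. 1 \<le> u \<Longrightarrow> u powr c \<le> K * exp u"
proof -
  define n where "n = Suc (nat \<lceil>c\<rceil>)"
  have n: "0 < n" "c \<le> real n" unfolding n_def by linarith+
  show thesis
  proof (rule that[of "real n ^ n"])
    fix u :: real assume u: "1 \<le> u"
    have "u powr c \<le> u powr real n" using u n by (intro powr_mono) auto
    also have "\<dots> = real n ^ n * (u / real n) ^ n" using u n by (simp add: powr_realpow power_divide)
    also have "(u / real n) ^ n \<le> exp (u / real n) ^ n"
      using u by (intro power_mono order_trans[OF _ exp_ge_add_one_self]) auto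
    also have "exp (u / real n) ^ n = exp u" using n by (simp add: exp_of_nat_mult[symmetric])
    finally show "u powr c \<le> real n ^ n * exp u" by (simp add: mult_left_mono)
  qed (use n in \<open>simp add: one_le_power\<close>)
qed

text \<open>The bound is independent of the peak n, which will move with the point. On each side of
  n the exponents are distinct, so the full geometric series dominates.\<close>

lemma sum_two_sided_geometric:
  fixes q :: real
  assumes q: "0 \<le> q" "q < 1" and A: "finite A"
  shows "(\<Sum>k\<in>A. q ^ (if k \<le> n then n - k else k - n)) \<le> 2 / (1 - q)"
proof -
  have part: "(\<Sum>k\<in>B. q ^ h k) \<le> 1 / (1 - q)" if "finite B" "inj_on h B" for B and h :: "nat \<Rightarrow> nat"
  proof -
    have "(\<Sum>k\<in>B. q ^ h k) = (\<Sum>j\<in>h ` B. q ^ j)" using that by (simp add: sum.reindex)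
    also have "\<dots> \<le> (\<Sum>j. q ^ j)"
      using q that by (intro sum_le_suminf summable_geometric) auto
    also have "\<dots> = 1 / (1 - q)" using q by (simp add: suminf_geometric)
    finally show ?thesis .
  qed
  have "(\<Sum>k\<in>A. q ^ (if k \<le> n then n - k else k - n)) =
      (\<Sum>k\<in>A \<inter> {k. k \<le> n}. q ^ (n - k)) + (\<Sum>k\<in>A \<inter> - {k. k \<le> n}. q ^ (k - n))"
    using A by (simp add: if_distrib sum.If_cases)
  also have "\<dots> \<le> 1 / (1 - q) + 1 / (1 - q)"
    using A by (intro add_mono part) (auto simp: inj_on_def)
  finally show ?thesis by simp
qed

text \<open>Let n be the dyadic level of x and u = (1 - x) 2^k. For k at most n the upper power
  bound of \<omega> makes the terms decay like 2^(-a(n - k)). For larger k the factor x^(2^k) is at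
  most exp(-u) and beats the loss u^b from the lower power bound. So the terms fall off
  geometrically on both sides of n.\<close>

lemma lacunary_sum_bound:
  assumes \<omega>: "normal_weight \<omega>"
  obtains K where "0 < K" "\<And>m x. 0 \<le> x \<Longrightarrow> x < 1 \<Longrightarrow>
    (\<Sum>k=1..m. x ^ (2 ^ k) / \<omega> (1 - (1/2) ^ k)) \<le> K / \<omega> x"
proof -
  obtain a b C where ab: "0 < a" "0 < b" and C: "1 \<le> C"
    "\<And>s t. 0 \<le> s \<Longrightarrow> s \<le> t \<Longrightarrow> t < 1 \<Longrightarrow> \<omega> t \<le> C * \<omega> s * ((1 - t) / (1 - s)) powr a"
    "\<And>s t. 0 \<le> s \<Longrightarrow> s \<le> t \<Longrightarrow> t < 1 \<Longrightarrow> \<omega> s \<le> C * \<omega> t * ((1 - s) / (1 - t)) powr b"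
    using normal_weight_comparison[OF \<omega>] by metis
  note pos = normal_weight_pos[OF \<omega>]
  \<comment> \<open>The extra 1 in the exponent leaves a factor 1/u over, and this factor supplies
    the geometric decay beyond level n.\<close>
  obtain E where E: "1 \<le> E" "\<And>u. 1 \<le> u \<Longrightarrow> u powr (b + 1) \<le> E * exp u"
    using powr_le_exp[of "b + 1"] by blast
  define q where "q = max ((1/2) powr a) (1/2)"
  have "(1/2) powr a < (1/2::real) powr 0" using ab by (intro powr_less_mono') auto
  then have q: "0 \<le> q" "q < 1" "(1/2) powr a \<le> q" "1/2 \<le> q" by (auto simp: q_def)
  \<comment> \<open>The 2 next to E comes from the shift k = n + 1 + j: the decay obtained is 2^-j,
    which is twice 2^-(k - n).\<close>
  define K where "K = C * (2 * E) * (2 / (1 - q))"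
  have K: "0 < K" using C(1) E(1) q by (simp add: K_def)
  show thesis
  proof (rule that[OF K])
    fix m and x :: real assume x: "0 \<le> x" "x < 1"
    define d where "d = 1 - x"
    have d: "0 < d" "d \<le> 1" using x by (auto simp: d_def)
    \<comment> \<open>Chosen so that 2^-(n+1) < 1 - x \<le> 2^-n.\<close>
    define n where "n = nat \<lfloor>log 2 (1/d)\<rfloor>"
    have l0: "0 \<le> log 2 (1/d)" using d by (simp add: log_divide)
    have "real n \<le> log 2 (1/d)" "log 2 (1/d) < real (Suc n)" using l0 unfolding n_def by linarith+
    then have "2 powr real n \<le> 1/d" "1/d < 2 powr real (Suc n)"
      using d by (simp_all add: le_log_iff log_less_iff del: of_nat_Suc)
    then have n: "d * 2 ^ n \<le> 1" "1 < d * 2 ^ Suc n"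
      using d by (simp_all add: powr_realpow field_simps del: of_nat_Suc power_Suc)
    have term_le: "x ^ (2 ^ k) / \<omega> (1 - (1/2) ^ k) \<le>
        C * (2 * E) / \<omega> x * q ^ (if k \<le> n then n - k else k - n)" for k
    proof -
      define s where "s = 1 - (1/2::real) ^ k"
      have s: "0 \<le> s" "s < 1" "1 - s = (1/2)^k" by (auto simp: s_def power_le_one)
      have ws: "0 < \<omega> s" and wx: "0 < \<omega> x" using pos s x by auto
      show ?thesis
      proof (cases "k \<le> n")
        case True
        have p: "(2::real) ^ n = 2 ^ (n - k) * 2 ^ k" using True by (simp add: power_add[symmetric])
        have u: "d * 2 ^ k \<le> (1/2) ^ (n - k)"
          using n(1) unfolding p by (simp add: power_one_over field_simps)
        have "(1/2) ^ (n - k) \<le> (1::real)" by (simp add: power_le_one)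
        then have "d * 2 ^ k \<le> 1" using u by linarith
        then have "s \<le> x" by (simp add: s_def d_def power_one_over field_simps)
        have "\<omega> x \<le> C * \<omega> s * ((1 - x) / (1 - s)) powr a" by (rule C(2)[OF s(1) \<open>s \<le> x\<close> x(2)])
        also have "(1 - x) / (1 - s) = d * 2 ^ k" by (simp add: s(3) d_def power_one_over)
        also have "C * \<omega> s * (d * 2 ^ k) powr a \<le> C * \<omega> s * q ^ (n - k)"
        proof (intro mult_left_mono)
          have "(d * 2 ^ k) powr a \<le> ((1/2) ^ (n - k)) powr a"
            using u d ab by (intro powr_mono2) auto
          also have "\<dots> = ((1/2) powr a) ^ (n - k)"
            by (simp add: powr_realpow[symmetric] powr_powr mult.commute)
          also have "\<dots> \<le> q ^ (n - k)" using q by (intro power_mono) auto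
          finally show "(d * 2 ^ k) powr a \<le> q ^ (n - k)" .
        qed (use C ws in auto)
        finally have "1 / \<omega> s \<le> C / \<omega> x * q ^ (n - k)" using ws wx by (simp add: field_simps)
        moreover have "x ^ (2 ^ k) / \<omega> s \<le> 1 / \<omega> s"
          using x ws by (intro divide_right_mono power_le_one) auto
        moreover have "C / \<omega> x * q ^ (n - k) \<le> C * (2 * E) / \<omega> x * q ^ (n - k)"
          using C wx E q by (intro mult_right_mono divide_right_mono) auto
        ultimately show ?thesis using True by (simp add: s_def)
      next
        case False
        define u where "u = d * 2 ^ k"
        obtain j where j: "k = Suc n + j" using False less_imp_Suc_add by fastforce
        have "2 ^ j < (d * 2 ^ Suc n) * 2 ^ j" using n(2) by simp
        also have "\<dots> = u" by (simp add: u_def j power_add)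
        finally have u: "2 ^ j < u" .
        then have u1: "1 \<le> u" using one_le_power[of "2::real" j] by linarith
        have "x \<le> s" using u1 by (simp add: u_def s_def d_def power_one_over field_simps)
        have "\<omega> x \<le> C * \<omega> s * ((1 - x) / (1 - s)) powr b" by (rule C(3)[OF x(1) \<open>x \<le> s\<close> s(2)])
        also have "(1 - x) / (1 - s) = u" by (simp add: s(3) u_def d_def power_one_over)
        finally have 1: "1 / \<omega> s \<le> C / \<omega> x * u powr b" using ws wx by (simp add: field_simps)
        have "x ^ (2 ^ k) \<le> exp (- d) ^ (2 ^ k)"
          using exp_ge_add_one_self[of "- d"] x by (intro power_mono) (auto simp: d_def)
        also have "\<dots> = exp (- u)" by (simp add: exp_of_nat_mult[symmetric] u_def)
        finally have 2: "x ^ (2 ^ k) \<le> exp (- u)" .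
        have "x ^ (2 ^ k) / \<omega> s \<le> exp (- u) * (C / \<omega> x * u powr b)"
          using mult_mono[OF 2 1] ws C by simp
        also have "\<dots> = C / \<omega> x * ((u powr (b + 1)) * exp (- u) / u)"
          using u1 by (simp add: powr_add)
        also have "\<dots> \<le> C / \<omega> x * (E / 2 ^ j)"
        proof (intro mult_left_mono)
          have "u powr (b + 1) * exp (- u) \<le> E" using E(2)[OF u1] by (simp add: exp_minus field_simps)
          then show "u powr (b + 1) * exp (- u) / u \<le> E / 2 ^ j"
            using u u1 E(1) by (intro frac_le) auto
        qed (use C wx in auto)
        also have "\<dots> = C * (2 * E) / \<omega> x * (1/2) ^ (k - n)" by (simp add: j power_one_over)
        also have "\<dots> \<le> C * (2 * E) / \<omega> x * q ^ (k - n)"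
          using C E wx q by (intro mult_left_mono power_mono) auto
        finally show ?thesis using False by (simp add: s_def)
      qed
    qed
    have "(\<Sum>k=1..m. x ^ (2 ^ k) / \<omega> (1 - (1/2) ^ k)) \<le>
      (\<Sum>k=1..m. C * (2 * E) / \<omega> x * q ^ (if k \<le> n then n - k else k - n))"
      by (intro sum_mono term_le)
    also have "\<dots> = C * (2 * E) / \<omega> x * (\<Sum>k=1..m. q ^ (if k \<le> n then n - k else k - n))"
      by (simp only: sum_distrib_left)
    also have "\<dots> \<le> C * (2 * E) / \<omega> x * (2 / (1 - q))"
      using q C E pos[of x] x by (intro mult_left_mono sum_two_sided_geometric) auto
    finally show "(\<Sum>k=1..m. x ^ (2 ^ k) / \<omega> (1 - (1/2) ^ k)) \<le> K / \<omega> x"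
      by (simp add: K_def mult_ac)
  qed
qed

text \<open>On the k-th dyadic interval 1 - t is at least half of 1 - s k, so 1/\<omega> is at most
  A/\<omega>(s k) there and the interval contributes at most A times the k-th term. The sum bounds
  \<open>growth\<close> up to the level after m because a point of level m lies below that
  endpoint.\<close>

lemma growth_dyadic_bound:
  assumes \<omega>: "normal_weight \<omega>"
  obtains B where "0 < B" "\<And>m. 1 \<le> m \<Longrightarrow>
    growth \<omega> (1 - (1/2) ^ Suc m) \<le> B * (\<Sum>k=1..m. (1/2) ^ k / \<omega> (1 - (1/2) ^ k))"
proof -
  obtain b C where b: "0 < b" and C: "1 \<le> C"
    "\<And>s t. 0 \<le> s \<Longrightarrow> s \<le> t \<Longrightarrow> t < 1 \<Longrightarrow> \<omega> s \<le> C * \<omega> t * ((1 - s) / (1 - t)) powr b"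
    using normal_weight_comparison[OF \<omega>] by metis
  note pos = normal_weight_pos[OF \<omega>]
  define s :: "nat \<Rightarrow> real" where "s = (\<lambda>k. 1 - (1/2) ^ k)"
  have s: "0 \<le> s k" "s k < 1" "s k \<le> s (Suc k)" "s (Suc k) - s k = (1/2) ^ Suc k" for k
    by (auto simp: s_def power_le_one)
  define A where "A = C * 2 powr b"
  have A: "0 < A" using C by (simp add: A_def)
  have step: "growth \<omega> (s (Suc k)) \<le> growth \<omega> (s k) + A * ((1/2) ^ k / \<omega> (s k))" for k
  proof -
    have "1 / \<omega> t \<le> A / \<omega> (s k)" if t: "t \<in> {s k..s (Suc k)}" for t
    proof -
      have t1: "t < 1" "0 \<le> t" using t s[of k] s[of "Suc k"] by auto
      have "\<omega> (s k) \<le> C * \<omega> t * ((1 - s k) / (1 - t)) powr b" using t t1 s[of k] by (intro C) auto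
      also have "\<dots> \<le> C * \<omega> t * 2 powr b"
      proof (intro mult_left_mono powr_mono2)
        show "(1 - s k) / (1 - t) \<le> 2" using t t1 by (simp add: s_def field_simps)
      qed (use t1 b C pos[of t] s[of k] in auto)
      finally have "\<omega> (s k) \<le> A * \<omega> t" by (simp add: A_def mult_ac)
      then show ?thesis using pos[of t] t1 pos[of "s k"] s[of k] by (simp add: field_simps)
    qed
    moreover have "(\<lambda>t. 1 / \<omega> t) integrable_on {s k..s (Suc k)}"
      by (rule integrable_on_subinterval[OF normal_weight_inverse_integrable[OF \<omega> s(2)[of "Suc k"]]])
        (use s(1)[of k] in auto)
    ultimately have "integral {s k..s (Suc k)} (\<lambda>t. 1 / \<omega> t) \<le> integral {s k..s (Suc k)} (\<lambda>t. A / \<omega> (s k))"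
      by (intro integral_le) auto
    also have "\<dots> = (s (Suc k) - s k) * (A / \<omega> (s k))" using s(3)[of k] by simp
    also have "\<dots> = (1/2) ^ Suc k * (A / \<omega> (s k))" by (simp only: s(4))
    also have "\<dots> \<le> (1/2) ^ k * (A / \<omega> (s k))"
      using A pos[of "s k"] s[of k] by (intro mult_right_mono) auto
    finally have "integral {s k..s (Suc k)} (\<lambda>t. 1 / \<omega> t) \<le> A * ((1/2) ^ k / \<omega> (s k))" by (simp add: mult_ac)
    moreover have "integral {0..s k} (\<lambda>t. 1 / \<omega> t) + integral {s k..s (Suc k)} (\<lambda>t. 1 / \<omega> t)
        = integral {0..s (Suc k)} (\<lambda>t. 1 / \<omega> t)"
      using s by (intro Henstock_Kurzweil_Integration.integral_combine normal_weight_inverse_integrable[OF \<omega>]) auto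
    ultimately show ?thesis by (simp add: growth_def)
  qed
  have sum: "growth \<omega> (s (Suc m)) \<le> growth \<omega> (s 1) + A * (\<Sum>k=1..m. (1/2) ^ k / \<omega> (s k))" for m
  proof (induction m)
    case (Suc m)
    then show ?case using step[of "Suc m"] by (simp add: distrib_left)
  qed simp
  \<comment> \<open>The term k = 1 of the sum. As m is at least 1, it absorbs the part of
    \<open>growth\<close> up to radius 1/2.\<close>
  define w where "w = (1/2) / \<omega> (s 1)"
  have w: "0 < w" using pos[of "s 1"] s[of 1] by (simp add: w_def)
  have g: "0 < growth \<omega> (s 1)" using growth_ge_one[OF \<omega> s(1,2)[of 1]] by simp
  show thesis
  proof (rule that[of "growth \<omega> (s 1) / w + A"])
    show "0 < growth \<omega> (s 1) / w + A" using g w A by (simp add: add_pos_pos)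
    fix m :: nat assume m: "1 \<le> m"
    have "w \<le> (\<Sum>k=1..m. (1/2) ^ k / \<omega> (s k))"
      using member_le_sum[of 1 "{1..m}" "\<lambda>k. (1/2) ^ k / \<omega> (s k)"] m pos s
      by (auto simp: w_def less_imp_le)
    then have "growth \<omega> (s 1) \<le> growth \<omega> (s 1) / w * (\<Sum>k=1..m. (1/2) ^ k / \<omega> (s k))"
      using g w by (simp add: field_simps)
    then show "growth \<omega> (1 - (1/2) ^ Suc m) \<le>
        (growth \<omega> (s 1) / w + A) * (\<Sum>k=1..m. (1/2) ^ k / \<omega> (1 - (1/2) ^ k))"
      using sum[of m] by (simp add: s_def distrib_right)
  qed
qed

text \<open>The numbers (1 - 2^-k)^(2^k) increase with k and start at 1/4: passing to the next k
  replaces the base by a square that is at least as large.\<close>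

lemma dyadic_power_lower_bound:
  assumes "1 \<le> k" "1 - (1/2) ^ k \<le> (r::real)" shows "1/4 \<le> r ^ (2 ^ k)"
proof -
  have "1/4 \<le> (1 - (1/2::real) ^ k) ^ (2 ^ k)" using assms(1)
  proof (induction k rule: nat_induct_at_least)
    case base
    then show ?case by (simp add: power2_eq_square)
  next
    case (Suc k)
    have "1 - (1/2::real) ^ k \<le> (1 - (1/2) ^ Suc k)\<^sup>2" by (simp add: power2_eq_square algebra_simps)
    then have "(1 - (1/2::real) ^ k) ^ (2 ^ k) \<le> ((1 - (1/2) ^ Suc k)\<^sup>2) ^ (2 ^ k)"
      by (intro power_mono) (auto simp: power_le_one)
    then show ?case using Suc by (simp add: power_mult[symmetric])
  qed
  also have "\<dots> \<le> r ^ (2 ^ k)" using assms(2) by (intro power_mono) (auto simp: power_le_one)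
  finally show ?thesis .
qed

text \<open>The degree of the polynomial depends on z, but neither the norm bound nor the lower
  bound does, so that one constant serves all points.\<close>

lemma little_bloch_test_function:
  assumes \<omega>: "normal_weight \<omega>"
  obtains K where "0 < K" "\<And>z::'a::complex_banach. 1/2 \<le> norm z \<Longrightarrow> norm z < 1 \<Longrightarrow>
    \<exists>f\<in>little_bloch \<omega>. bloch_norm \<omega> f \<le> K \<and> growth \<omega> (norm z) \<le> K * cmod (f z)"
proof -
  obtain K1 where K1: "0 < K1" "\<And>m x. 0 \<le> x \<Longrightarrow> x < 1 \<Longrightarrow>
    (\<Sum>k=1..m. x ^ (2 ^ k) / \<omega> (1 - (1/2) ^ k)) \<le> K1 / \<omega> x"
    using lacunary_sum_bound[OF \<omega>] by blast
  obtain B where B: "0 < B" "\<And>m. 1 \<le> m \<Longrightarrow>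
    growth \<omega> (1 - (1/2) ^ Suc m) \<le> B * (\<Sum>k=1..m. (1/2) ^ k / \<omega> (1 - (1/2) ^ k))"
    using growth_dyadic_bound[OF \<omega>] by blast
  note pos = normal_weight_pos[OF \<omega>]
  have ws: "0 < \<omega> (1 - (1/2) ^ k)" for k :: nat using pos[of "1 - (1/2) ^ k"] by (simp add: power_le_one)
  show thesis
  proof (rule that[of "max K1 (4 * B)"])
    show "0 < max K1 (4 * B)" using K1 by simp
    fix z :: 'a assume z: "1/2 \<le> norm z" "norm z < 1"
    define r where "r = norm z"
    have r: "1/2 \<le> r" "r < 1" using z by (auto simp: r_def)
    \<comment> \<open>The level of z: 1 - 2^-m \<le> r \<le> 1 - 2^-(m+1). Hence all powers r^(2^k)
      with k up to m are at least 1/4, and the terms up to m already account for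
      \<open>growth\<close> at r.\<close>
    define m where "m = nat \<lfloor>log 2 (1 / (1 - r))\<rfloor>"
    have "2 powr 1 \<le> 1 / (1 - r)" using r by (simp add: field_simps)
    then have l1: "1 \<le> log 2 (1 / (1 - r))" using r by (subst le_log_iff) auto
    have m1: "1 \<le> m" "real m \<le> log 2 (1 / (1 - r))" "log 2 (1 / (1 - r)) < real (Suc m)"
      using l1 unfolding m_def by linarith+
    then have "2 powr real m \<le> 1 / (1 - r)" "1 / (1 - r) < 2 powr real (Suc m)"
      using r by (simp_all add: le_log_iff log_less_iff del: of_nat_Suc)
    then have m: "1 - (1/2) ^ m \<le> r" "r \<le> 1 - (1/2) ^ Suc m"
      using r by (simp_all add: powr_realpow power_one_over field_simps del: of_nat_Suc)
    obtain L where L: "bounded_linear L" "\<And>c x. L (scaleC c x) = c * L x"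
      "\<And>x. cmod (L x) \<le> norm x" "L z = complex_of_real (norm z)"
      using norming_functional by blast
    define c where "c = (\<lambda>k. (1/2) ^ k / \<omega> (1 - (1/2) ^ k))"
    define P where "P = (\<lambda>\<zeta>. \<Sum>k=1..m. complex_of_real (c k) * \<zeta> ^ (2 ^ k))"
    define P' where "P' = (\<lambda>\<zeta>. \<Sum>k=1..m. complex_of_real (c k) * (of_nat (2 ^ k) * \<zeta> ^ (2 ^ k - 1)))"
    have dP: "(P has_field_derivative P' \<zeta>) (at \<zeta>)" for \<zeta>
      unfolding P_def P'_def by (auto intro!: derivative_eq_intros sum.cong)
    have cd: "has_cderiv (\<lambda>w. P (L w)) (\<lambda>h. P' (L w) * L h) w" for w
    proof -
      have "(P \<circ> L has_derivative (*) (P' (L w)) \<circ> L) (at w)"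
        using dP[of "L w"] bounded_linear_imp_has_derivative[OF L(1)]
        by (intro diff_chain_at) (auto simp: has_field_derivative_def)
      then show ?thesis by (simp add: has_cderiv_def o_def L(2))
    qed
    define f where "f = (\<lambda>w\<in>ball 0 1. P (L w))"
    have hol: "f \<in> hol_ball" unfolding f_def
      by (rule restrict_in_hol_ball) (use cd in \<open>auto simp: cdiff_on_def\<close>)
    have R: "radial_deriv f w = (\<Sum>k=1..m. L w ^ (2 ^ k) / of_real (\<omega> (1 - (1/2) ^ k)))"
      if w: "w \<in> ball 0 1" for w
    proof -
      have "radial_deriv f w = P' (L w) * L w" unfolding f_def by (rule radial_deriv_restrict[OF cd w])
      also have "\<dots> = (\<Sum>k=1..m. L w ^ (2 ^ k) / of_real (\<omega> (1 - (1/2) ^ k)))"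
        unfolding P'_def sum_distrib_right
      proof (rule sum.cong[OF refl])
        fix k assume "k \<in> {1..m}"
        have "L w ^ (2 ^ k) = L w ^ (2 ^ k - 1) * L w"
          by (metis power_minus_mult zero_less_numeral zero_less_power)
        then show "complex_of_real (c k) * (of_nat (2 ^ k) * L w ^ (2 ^ k - 1)) * L w =
          L w ^ (2 ^ k) / of_real (\<omega> (1 - (1/2) ^ k))"
          by (simp add: c_def power_one_over)
      qed
      finally show ?thesis .
    qed
    have Rle: "cmod (radial_deriv f w) \<le> (\<Sum>k=1..m. norm w ^ (2 ^ k) / \<omega> (1 - (1/2) ^ k))"
      if w: "w \<in> ball 0 1" for w
      unfolding R[OF w]
    proof (rule order_trans[OF norm_sum sum_mono])
      fix k
      show "cmod (L w ^ 2 ^ k / of_real (\<omega> (1 - (1/2) ^ k))) \<le> norm w ^ 2 ^ k / \<omega> (1 - (1/2) ^ k)"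
        using ws[of k] L(3)[of w] by (simp add: norm_divide norm_power divide_right_mono power_mono)
    qed
    have Rle2: "\<omega> (norm w) * cmod (radial_deriv f w) \<le> K1" if w: "w \<in> ball 0 1" for w
    proof -
      have "\<omega> (norm w) * cmod (radial_deriv f w) \<le> \<omega> (norm w) * (K1 / \<omega> (norm w))"
        using order_trans[OF Rle[OF w] K1(2)[of "norm w" m]] pos[of "norm w"] w
        by (intro mult_left_mono) auto
      then show ?thesis using pos[of "norm w"] w by simp
    qed
    \<comment> \<open>A crude bound that depends on m. It serves only for membership in the little
      space, where \<omega> tending to 0 suffices; the norm is controlled by
      \<open>K1\<close>.\<close>
    define Q where "Q = (\<Sum>k=1..m. 1 / \<omega> (1 - (1/2) ^ k))"
    have lb: "f \<in> little_bloch \<omega>"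
    proof (rule little_bloch_dominated[OF \<omega> hol])
      fix w :: 'a assume w: "norm w < 1"
      have "cmod (radial_deriv f w) \<le> Q"
        unfolding Q_def using ws w
        by (intro order_trans[OF Rle sum_mono] divide_right_mono power_le_one) (auto simp: less_imp_le)
      then show "\<omega> (norm w) * cmod (radial_deriv f w) \<le> Q * \<omega> (norm w)"
        using pos[of "norm w"] w by (simp add: mult.commute)
    next
      have "((\<lambda>w::'a. \<omega> (norm w)) \<longlongrightarrow> 0) to_sphere"
        unfolding to_sphere_def
        by (rule filterlim_compose[OF normal_weight_tendsto_zero[OF \<omega>] filterlim_filtercomap])
      then show "((\<lambda>w::'a. Q * \<omega> (norm w)) \<longlongrightarrow> 0) to_sphere"
        by (rule tendsto_mult_right_zero)
    qed
    have "f 0 = 0" using linear_0[OF bounded_linear.linear[OF L(1)]] by (simp add: f_def P_def power_0_left)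
    then have "bloch_norm \<omega> f \<le> K1" using bloch_norm_le[of \<omega> f K1] Rle2 by simp
    moreover have "growth \<omega> (norm z) \<le> 4 * B * cmod (f z)"
    proof -
      have "f z = of_real (\<Sum>k=1..m. c k * r ^ (2 ^ k))"
        using z by (simp add: f_def P_def L(4) r_def)
      then have "cmod (f z) = \<bar>\<Sum>k=1..m. c k * r ^ (2 ^ k)\<bar>" by (simp only: norm_of_real)
      moreover have "(\<Sum>k=1..m. c k) * (1/4) \<le> (\<Sum>k=1..m. c k * r ^ (2 ^ k))"
        unfolding sum_distrib_right
      proof (intro sum_mono mult_left_mono)
        fix k assume k: "k \<in> {1..m}"
        have "(1/2::real) ^ m \<le> (1/2) ^ k" using k by (intro power_decreasing) auto
        then have "1 - (1/2) ^ k \<le> r" using m(1) by linarith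
        then show "1/4 \<le> r ^ (2 ^ k)" using k by (intro dyadic_power_lower_bound) auto
        show "0 \<le> c k" using ws[of k] by (simp add: c_def)
      qed
      ultimately have "(\<Sum>k=1..m. c k) \<le> 4 * cmod (f z)"
        using abs_ge_self[of "\<Sum>k=1..m. c k * r ^ (2 ^ k)"] by linarith
      then have "B * (\<Sum>k=1..m. c k) \<le> B * (4 * cmod (f z))" using B(1) by (intro mult_left_mono) auto
      moreover have "growth \<omega> r \<le> growth \<omega> (1 - (1/2) ^ Suc m)"
        using m r by (intro growth_mono[OF \<omega>]) auto
      ultimately show ?thesis using B(2)[OF m1(1)] by (simp add: c_def r_def)
    qed
    moreover have "4 * B * cmod (f z) \<le> max K1 (4 * B) * cmod (f z)" by (intro mult_right_mono) auto
    ultimately show "\<exists>f\<in>little_bloch \<omega>. bloch_norm \<omega> f \<le> max K1 (4 * B) \<and>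
        growth \<omega> (norm z) \<le> max K1 (4 * B) * cmod (f z)"
      using lb by (intro bexI[of _ f]) auto
  qed
qed

section \<open>Compactness of the extended Cesaro operator\<close>

text \<open>Rounding real and imaginary parts to multiples of e leaves finitely many patterns on X.
  One representative per pattern is within e in both parts, hence within 2e in modulus.\<close>

lemma finite_net_of_bounded_functions:
  fixes S :: "('a \<Rightarrow> complex) set"
  assumes X: "finite X" and e: "0 < e" and M: "\<And>f x. f \<in> S \<Longrightarrow> x \<in> X \<Longrightarrow> cmod (f x) \<le> M"
  obtains S' where "finite S'" "S' \<subseteq> S"
    "\<And>f. f \<in> S \<Longrightarrow> \<exists>g\<in>S'. \<forall>x\<in>X. cmod (f x - g x) \<le> 2 * e"
proof -
  define n where "n = \<lceil>M / e\<rceil> + 1"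
  define G where "G = (\<lambda>f. \<lambda>x\<in>X. (\<lfloor>Re (f x) / e\<rfloor>, \<lfloor>Im (f x) / e\<rfloor>))"
  have fl: "\<lfloor>y / e\<rfloor> \<in> {- n..n}" if "\<bar>y\<bar> \<le> M" for y
  proof -
    have "- (M / e) \<le> y / e" "y / e \<le> M / e"
      using that e by (simp_all add: field_simps abs_le_iff)
    then show ?thesis unfolding n_def atLeastAtMost_iff by linarith
  qed
  have "G ` S \<subseteq> X \<rightarrow>\<^sub>E ({- n..n} \<times> {- n..n})"
  proof (rule image_subsetI)
    fix f assume "f \<in> S"
    then have "\<bar>Re (f x)\<bar> \<le> M" "\<bar>Im (f x)\<bar> \<le> M" if "x \<in> X" for x
      using M[of f x] that abs_Re_le_cmod[of "f x"] abs_Im_le_cmod[of "f x"] by auto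
    then show "G f \<in> X \<rightarrow>\<^sub>E ({- n..n} \<times> {- n..n})" unfolding G_def using fl by auto
  qed
  moreover have "finite (X \<rightarrow>\<^sub>E ({- n..n} \<times> {- n..n}))" using X by (intro finite_PiE) auto
  ultimately have "finite (G ` S)" by (rule finite_subset)
  then obtain S' where S': "S' \<subseteq> S" "finite S'" "G ` S = G ` S'"
    using finite_subset_image[of "G ` S" G S] by auto
  show thesis
  proof (rule that[OF S'(2,1)])
    fix f assume "f \<in> S"
    then obtain g where g: "g \<in> S'" "G f = G g" using S'(3) by blast
    have "cmod (f x - g x) \<le> 2 * e" if "x \<in> X" for x
    proof -
      have close: "\<bar>y - y'\<bar> \<le> e" if "\<lfloor>y / e\<rfloor> = \<lfloor>y' / e\<rfloor>" for y y'
      proof -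
        have "\<bar>y / e - y' / e\<bar> < 1" using that by linarith
        then have "\<bar>(y - y') / e\<bar> < 1" by (simp add: diff_divide_distrib)
        then show ?thesis using e by (simp add: abs_divide)
      qed
      have "G f x = G g x" using g by simp
      then have "\<bar>Re (f x) - Re (g x)\<bar> \<le> e" "\<bar>Im (f x) - Im (g x)\<bar> \<le> e"
        using that by (auto simp: G_def intro: close)
      then show ?thesis using cmod_le[of "f x - g x"] by simp
    qed
    then show "\<exists>g\<in>S'. \<forall>x\<in>X. cmod (f x - g x) \<le> 2 * e" using g by blast
  qed
qed

text \<open>An Arzela-Ascoli argument: a norm bound gives a uniform bound on radius s > r, hence a
  common Lipschitz constant on radius r, and agreement on a fine finite set of the compact closure
  spreads to all of E.\<close>

lemma little_bloch_finite_net: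
  fixes S :: "('a::complex_banach \<Rightarrow> complex) set"
  assumes \<omega>: "normal_weight \<omega>" and S: "S \<subseteq> little_bloch \<omega>" "\<And>f. f \<in> S \<Longrightarrow> bloch_norm \<omega> f \<le> N"
    and E: "E \<subseteq> cball 0 r" "relatively_compact_in (top_of_set (ball 0 1)) E"
    and r: "0 < r" "r < 1" and \<eta>: "0 < \<eta>"
  obtains S' where "finite S'" "S' \<subseteq> S"
    "\<And>f. f \<in> S \<Longrightarrow> \<exists>g\<in>S'. \<forall>z\<in>E. cmod (f z - g z) \<le> \<eta>"
proof -
  obtain C where C: "0 < C" "\<And>(f :: 'a \<Rightarrow> complex) z. f \<in> little_bloch \<omega> \<Longrightarrow>
      z \<in> ball 0 1 \<Longrightarrow> cmod (f z) \<le> C * bloch_norm \<omega> f * growth \<omega> (norm z)"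
    using little_bloch_pointwise[OF \<omega>] by blast
  define d where "d = (1 - r) / 2"
  define s where "s = r + d"
  have s: "0 < d" "r < s" "0 < s" "s < 1" using r by (auto simp: s_def d_def field_simps)
  define M where "M = C * max N 1 * growth \<omega> s"
  have M0: "0 < M" using C(1) growth_ge_one[OF \<omega>, of s] s by (simp add: M_def)
  have M: "cmod (f w) \<le> M" if f: "f \<in> S" and w: "w \<in> ball 0 s" for f w
  proof -
    have "cmod (f w) \<le> C * bloch_norm \<omega> f * growth \<omega> (norm w)" using C(2)[of f w] S f w s by auto
    also have "\<dots> \<le> M"
      unfolding M_def using C(1) S(2)[OF f] bloch_norm_nonneg[OF \<omega> subsetD[OF S(1) f]] growth_mono[OF \<omega>, of "norm w" s] growth_ge_one[OF \<omega>, of "norm w"] w s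
      by (intro mult_mono) auto
    finally show ?thesis .
  qed
  have lip: "cmod (f x - f y) \<le> M / d * norm (x - y)" if f: "f \<in> S" and xy: "x \<in> cball 0 r" "y \<in> cball 0 r" for f x y
  proof (rule bounded_imp_Lipschitz)
    have "cdiff_on f (ball 0 1)"
      using little_blochD[OF subsetD[OF S(1) f]] by (simp add: hol_ball_iff)
    then show "cdiff_on f (ball 0 s)" by (rule cdiff_on_subset) (use s in \<open>simp add: subset_ball\<close>)
    show "ball x d \<subseteq> ball 0 s" if x: "x \<in> cball 0 r" for x :: 'a
    proof
      fix w assume "w \<in> ball x d"
      then show "w \<in> ball 0 s"
        using x norm_triangle_sub[of w x] by (simp add: s_def dist_norm norm_minus_commute)
    qed
  qed (use M[OF f] s xy in auto)
  \<comment> \<open>Two Lipschitz errors of one quarter each, and twice a quarter from the net of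
    values.\<close>
  define \<eta>' where "\<eta>' = \<eta> / 4"
  define h where "h = \<eta>' / (M / d)"
  have h: "0 < h" "M / d * h = \<eta>'" using \<eta> M0 s by (simp_all add: h_def \<eta>'_def)
  define K where "K = top_of_set (ball 0 1) closure_of E"
  have K: "compact K" using E(2) unfolding K_def relatively_compact_in_def compactin_subtopology compactin_euclidean_iff by blast
  have EK: "E \<subseteq> K"
    using E(2) unfolding K_def relatively_compact_in_def by (intro closure_of_subset) blast
  have "K \<subseteq> closure E" unfolding K_def using closure_mono[of "ball 0 1 \<inter> E" E]
    by (auto simp: closure_of_subtopology)
  \<comment> \<open>The centres of the covering lie in the closure and not necessarily in E, so the
    closure must stay where the Lipschitz bound holds.\<close>
  then have Kr: "K \<subseteq> cball 0 r" using closure_minimal[OF E(1)] by auto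
  obtain X where X: "finite X" "X \<subseteq> K" "K \<subseteq> (\<Union>x\<in>X. ball x h)"
  proof (rule compactE_image[OF K, of K "\<lambda>x. ball x h"])
    show "K \<subseteq> (\<Union>x\<in>K. ball x h)" using h(1) by auto
  qed (use that in auto)
  obtain S' where S': "finite S'" "S' \<subseteq> S"
    "\<And>f. f \<in> S \<Longrightarrow> \<exists>g\<in>S'. \<forall>x\<in>X. cmod (f x - g x) \<le> 2 * \<eta>'"
  proof (rule finite_net_of_bounded_functions[OF X(1), of \<eta>' S M])
    show "0 < \<eta>'" using \<eta> by (simp add: \<eta>'_def)
    show "cmod (f x) \<le> M" if "f \<in> S" "x \<in> X" for f x
      using subsetD[OF Kr subsetD[OF X(2)], of x] that s by (intro M) auto
  qed (use that in blast)
  show thesis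
  proof (rule that[OF S'(1,2)])
    fix f assume f: "f \<in> S"
    obtain g where g: "g \<in> S'" "\<And>x. x \<in> X \<Longrightarrow> cmod (f x - g x) \<le> 2 * \<eta>'" using S'(3)[OF f] by blast
    have gS: "g \<in> S" using g S' by blast
    have "cmod (f z - g z) \<le> \<eta>" if z: "z \<in> E" for z
    proof -
      obtain x where x: "x \<in> X" "dist x z < h" using z EK X(3) by auto
      have b: "z \<in> cball 0 r" "x \<in> cball 0 r" using z x E(1) X(2) Kr by auto
      have "M / d * norm (z - x) \<le> M / d * h"
        using x(2) M0 s by (intro mult_left_mono) (auto simp: dist_norm norm_minus_commute)
      then have "cmod (f z - f x) \<le> \<eta>'" "cmod (g z - g x) \<le> \<eta>'"
        using lip[OF f b] lip[OF gS b] h(2) by linarith+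
      moreover have "cmod (f z - g z) \<le> cmod (f z - f x) + cmod (f x - g x) + cmod (g z - g x)"
        using norm_triangle_ineq4[of "(f z - f x) + (f x - g x)" "g z - g x"]
          norm_triangle_ineq[of "f z - f x" "f x - g x"] by simp
      ultimately show ?thesis using g(2)[OF x(1)] by (simp add: \<eta>'_def)
    qed
    then show "\<exists>g\<in>S'. \<forall>z\<in>E. cmod (f z - g z) \<le> \<eta>" using g by blast
  qed
qed

lemma inverse_weight_integral_pos:
  assumes \<omega>: "normal_weight \<omega>" and r: "0 < r" "r < 1"
  shows "0 < integral {0..r} (\<lambda>t. 1 / \<omega> t)"
proof -
  obtain C where C: "1 \<le> C" "\<And>s t. 0 \<le> s \<Longrightarrow> s \<le> t \<Longrightarrow> t < 1 \<Longrightarrow> \<omega> t \<le> C * \<omega> s"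
    using normal_weight_almost_decreasing[OF \<omega>] by blast
  note pos = normal_weight_pos[OF \<omega>]
  have "0 < r * (1 / (C * \<omega> 0))" using r C(1) pos[of 0] by simp
  also have "\<dots> = integral {0..r} (\<lambda>t. 1 / (C * \<omega> 0))" using r by simp
  also have "\<dots> \<le> integral {0..r} (\<lambda>t. 1 / \<omega> t)"
    using normal_weight_inverse_integrable[OF \<omega> r(2)] C(2)[of 0] pos r C(1)
    by (intro integral_le) (auto intro!: divide_left_mono mult_pos_pos)
  finally show ?thesis .
qed

lemma cesaro_limit_imp_growth_limit:
  fixes \<phi> :: "'a::complex_banach \<Rightarrow> complex"
  assumes \<omega>: "normal_weight \<omega>" and \<mu>: "normal_weight \<mu>"
    and lim: "((\<lambda>z. \<mu> (norm z) * cmod (radial_deriv \<phi> z) * integral {0..norm z} (\<lambda>t. 1 / \<omega> t))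
      \<longlongrightarrow> 0) to_sphere"
  shows "((\<lambda>z. \<mu> (norm z) * cmod (radial_deriv \<phi> z) * growth \<omega> (norm z)) \<longlongrightarrow> 0) to_sphere"
proof -
  define I where "I = (\<lambda>r. integral {0..r} (\<lambda>t. 1 / \<omega> t))"
  have I: "0 < I (1/2)" unfolding I_def using \<omega> by (intro inverse_weight_integral_pos) auto
  \<comment> \<open>Beyond radius 1/2 the integral is at least its positive value there, so the
    summand 1 of \<open>growth\<close> is at most I / I(1/2).\<close>
  define k where "k = 1 / I (1/2) + 1"
  have "\<forall>\<^sub>F z::'a in to_sphere. norm (\<mu> (norm z) * cmod (radial_deriv \<phi> z) * growth \<omega> (norm z)) \<le>
    k * (\<mu> (norm z) * cmod (radial_deriv \<phi> z) * I (norm z))"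
    unfolding eventually_to_sphere
  proof (intro exI[of _ "1/2"] conjI allI impI)
    fix z :: 'a assume z: "1/2 < norm z" "norm z < 1"
    have "I (1/2) \<le> I (norm z)" using growth_mono[OF \<omega>, of "1/2" "norm z"] z by (simp add: growth_def I_def)
    then have "1 \<le> I (norm z) / I (1/2)" using I by simp
    moreover have "growth \<omega> (norm z) = 1 + I (norm z)" by (simp add: growth_def I_def)
    ultimately have "growth \<omega> (norm z) \<le> k * I (norm z)" by (simp add: k_def distrib_right)
    then have "\<mu> (norm z) * cmod (radial_deriv \<phi> z) * growth \<omega> (norm z) \<le>
      \<mu> (norm z) * cmod (radial_deriv \<phi> z) * (k * I (norm z))"
      using normal_weight_pos[OF \<mu>, of "norm z"] z by (intro mult_left_mono) auto
    moreover have "0 \<le> \<mu> (norm z) * cmod (radial_deriv \<phi> z) * growth \<omega> (norm z)"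
      using normal_weight_pos[OF \<mu>, of "norm z"] growth_ge_one[OF \<omega>, of "norm z"] z by simp
    ultimately show "norm (\<mu> (norm z) * cmod (radial_deriv \<phi> z) * growth \<omega> (norm z)) \<le>
        k * (\<mu> (norm z) * cmod (radial_deriv \<phi> z) * I (norm z))"
      by (simp add: mult_ac)
  qed auto
  from Lim_null_comparison[OF this] lim show ?thesis
    unfolding I_def using tendsto_mult_right_zero by blast
qed

lemma
  fixes \<phi> f g :: "'a::complex_banach \<Rightarrow> complex"
  assumes \<phi>: "\<phi> \<in> hol_ball" and f: "f \<in> hol_ball" and g: "g \<in> hol_ball"
  shows cesaro_add: "cesaro \<phi> (\<lambda>z\<in>ball 0 1. f z + g z) = (\<lambda>z\<in>ball 0 1. cesaro \<phi> f z + cesaro \<phi> g z)"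
    and cesaro_cmult: "cesaro \<phi> (\<lambda>z\<in>ball 0 1. c * f z) = (\<lambda>z\<in>ball 0 1. c * cesaro \<phi> f z)"
proof -
  let ?i = "\<lambda>f z t. f (t *\<^sub>R z) * radial_deriv \<phi> (t *\<^sub>R z) * (1 / complex_of_real t)"
  show "cesaro \<phi> (\<lambda>z\<in>ball 0 1. f z + g z) = (\<lambda>z\<in>ball 0 1. cesaro \<phi> f z + cesaro \<phi> g z)"
    unfolding cesaro_def
  proof (rule restrict_ext)
    fix z :: 'a assume z: "z \<in> ball 0 1"
    have "integral {0..1} (?i (\<lambda>z\<in>ball 0 1. f z + g z) z) = integral {0..1} (\<lambda>t. ?i f z t + ?i g z t)"
      using scaleR_in_unit_ball[OF z] by (intro integral_cong) (simp add: distrib_right add_divide_distrib del: mem_ball mem_ball_0)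
    then show "integral {0..1} (?i (\<lambda>z\<in>ball 0 1. f z + g z) z) =
      (\<lambda>z\<in>ball 0 1. integral {0..1} (?i f z)) z + (\<lambda>z\<in>ball 0 1. integral {0..1} (?i g z)) z"
      using integral_add[OF cesaro_integrable[OF \<phi> f z] cesaro_integrable[OF \<phi> g z]] z by simp
  qed
  show "cesaro \<phi> (\<lambda>z\<in>ball 0 1. c * f z) = (\<lambda>z\<in>ball 0 1. c * cesaro \<phi> f z)"
    unfolding cesaro_def
  proof (rule restrict_ext)
    fix z :: 'a assume z: "z \<in> ball 0 1"
    have "integral {0..1} (?i (\<lambda>z\<in>ball 0 1. c * f z) z) = integral {0..1} (\<lambda>t. c * ?i f z t)"
      using scaleR_in_unit_ball[OF z] by (intro integral_cong) (simp add: mult.assoc del: mem_ball mem_ball_0)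
    also have "\<dots> = c * integral {0..1} (?i f z)" by (rule integral_mult_right)
    finally show "integral {0..1} (?i (\<lambda>z\<in>ball 0 1. c * f z) z) =
      c * (\<lambda>z\<in>ball 0 1. integral {0..1} (?i f z)) z"
      using z by simp
  qed
qed

lemma cesaro_in_little_bloch:
  fixes \<phi> f :: "'a::complex_banach \<Rightarrow> complex"
  assumes \<omega>: "normal_weight \<omega>" and \<mu>: "normal_weight \<mu>" and \<phi>: "\<phi> \<in> hol_ball"
    and lim: "((\<lambda>z. \<mu> (norm z) * cmod (radial_deriv \<phi> z) * growth \<omega> (norm z)) \<longlongrightarrow> 0) to_sphere"
    and f: "f \<in> little_bloch \<omega>"
  shows "cesaro \<phi> f \<in> little_bloch \<mu>"
proof -
  obtain C where C: "0 < C" "\<And>(f :: 'a \<Rightarrow> complex) z. f \<in> little_bloch \<omega> \<Longrightarrow>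
      z \<in> ball 0 1 \<Longrightarrow> cmod (f z) \<le> C * bloch_norm \<omega> f * growth \<omega> (norm z)"
    using little_bloch_pointwise[OF \<omega>] by blast
  show ?thesis
  proof (rule little_bloch_dominated[OF \<mu> cesaro_in_hol_ball[OF \<phi> little_blochD[OF f]]])
    fix z :: 'a assume z: "norm z < 1"
    have "\<mu> (norm z) * cmod (radial_deriv \<phi> z) * cmod (f z) \<le>
      \<mu> (norm z) * cmod (radial_deriv \<phi> z) * (C * bloch_norm \<omega> f * growth \<omega> (norm z))"
      using normal_weight_pos[OF \<mu>, of "norm z"] z C(2)[OF f, of z] by (intro mult_left_mono) auto
    then show "\<mu> (norm z) * cmod (radial_deriv (cesaro \<phi> f) z) \<le>
      C * bloch_norm \<omega> f * (\<mu> (norm z) * cmod (radial_deriv \<phi> z) * growth \<omega> (norm z))"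
      using radial_deriv_cesaro[OF \<phi> little_blochD[OF f], of z] z by (simp add: norm_mult mult_ac)
  qed (rule tendsto_mult_right_zero[OF lim])
qed

lemma cesaro_image_mtotally_bounded:
  fixes \<phi> :: "'a::complex_banach \<Rightarrow> complex"
  assumes \<omega>: "normal_weight \<omega>" and \<mu>: "normal_weight \<mu>" and \<phi>: "\<phi> \<in> hol_ball"
    and E: "\<And>\<epsilon> \<rho>. 0 < \<epsilon> \<Longrightarrow> 0 < \<rho> \<Longrightarrow> \<rho> < 1 \<Longrightarrow>
      relatively_compact_in (top_of_set (ball 0 1)) (E_set \<mu> \<phi> \<epsilon> \<rho>)"
    and lim: "((\<lambda>z. \<mu> (norm z) * cmod (radial_deriv \<phi> z) * growth \<omega> (norm z)) \<longlongrightarrow> 0) to_sphere"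
    and S: "S \<subseteq> little_bloch \<omega>" "\<And>f. f \<in> S \<Longrightarrow> bloch_norm \<omega> f \<le> N"
  shows "Metric_space.mtotally_bounded (little_bloch \<mu>) (fun_dist (little_bloch \<mu>) (bloch_norm \<mu>)) (cesaro \<phi> ` S)"
proof -
  let ?Y = "little_bloch \<mu> :: ('a \<Rightarrow> complex) set"
  interpret M: Metric_space ?Y "fun_dist ?Y (bloch_norm \<mu>)"
    by (rule Metric_space_little_bloch[OF \<mu>])
  let ?m = "\<lambda>z. \<mu> (norm z) * cmod (radial_deriv \<phi> z)"
  note T = cesaro_in_little_bloch[OF \<omega> \<mu> \<phi> lim]
  have posm: "0 \<le> ?m z" if "z \<in> ball 0 1" for z using normal_weight_pos[OF \<mu>, of "norm z"] that by simp
  obtain C where C: "0 < C" "\<And>(f :: 'a \<Rightarrow> complex) z. f \<in> little_bloch \<omega> \<Longrightarrow>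
      z \<in> ball 0 1 \<Longrightarrow> cmod (f z) \<le> C * bloch_norm \<omega> f * growth \<omega> (norm z)"
    using little_bloch_pointwise[OF \<omega>] by blast
  define A where "A = C * max N 1"
  have A: "0 < A" using C by (simp add: A_def)
  have fA: "cmod (f z) \<le> A * growth \<omega> (norm z)" if "f \<in> S" "z \<in> ball 0 1" for f z
  proof -
    have "cmod (f z) \<le> C * bloch_norm \<omega> f * growth \<omega> (norm z)" using C(2) S that by blast
    also have "\<dots> \<le> A * growth \<omega> (norm z)"
      unfolding A_def using C(1) S(2)[of f] growth_ge_one[OF \<omega>, of "norm z"] that
      by (intro mult_right_mono mult_left_mono) auto
    finally show ?thesis .
  qed
  have fgA: "cmod (f z - g z) \<le> 2 * A * growth \<omega> (norm z)" if "f \<in> S" "g \<in> S" "z \<in> ball 0 1" for f g z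
    using norm_triangle_ineq4[of "f z" "g z"] fA[OF that(1,3)] fA[OF that(2,3)] by simp
  \<comment> \<open>As \<open>growth\<close> is at least 1, the limit condition applies to
    \<mu>|R\<phi>| itself. The resulting global bound Q is used on \<open>E_set\<close>, where only
    the difference f - g is small.\<close>
  have \<phi>b: "\<phi> \<in> little_bloch \<mu>"
  proof (rule little_bloch_dominated[OF \<mu> \<phi> _ lim])
    fix z :: 'a assume "norm z < 1"
    then show "?m z \<le> ?m z * growth \<omega> (norm z)"
      using posm[of z] growth_ge_one[OF \<omega>, of "norm z"]
        mult_left_mono[of 1 "growth \<omega> (norm z)" "?m z"] by simp
  qed
  define Q where "Q = bloch_norm \<mu> \<phi> + 1"
  have Q: "0 < Q" "\<And>z. z \<in> ball 0 1 \<Longrightarrow> ?m z \<le> Q"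
    using bloch_norm_nonneg[OF \<mu> \<phi>b] bloch_norm_ge_deriv[OF \<mu> \<phi>b] by (fastforce simp: Q_def)+
  show ?thesis
    unfolding M.mtotally_bounded_def
  proof (intro allI impI)
    fix \<epsilon> :: real assume \<epsilon>: "0 < \<epsilon>"
    \<comment> \<open>Against the bound 2A \<open>growth\<close> for |f - g| this tolerance leaves
      \<epsilon>/2; \<open>\<delta>\<close> and the net accuracy \<epsilon>/(2Q) are chosen for the
      same target.\<close>
    have "0 < \<epsilon> / (4 * A)" using \<epsilon> A by simp
    then have "\<forall>\<^sub>F z in to_sphere. ?m z * growth \<omega> (norm z) < \<epsilon> / (4 * A)"
      using order_tendstoD(2)[OF lim] by blast
    then obtain r where r: "0 < r" "r < 1"
      "\<And>z. r < norm z \<Longrightarrow> norm z < 1 \<Longrightarrow> ?m z * growth \<omega> (norm z) < \<epsilon> / (4 * A)"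
      unfolding eventually_to_sphere by blast
    define G where "G = growth \<omega> r"
    have G: "0 < G" using growth_ge_one[OF \<omega>, of r] r by (simp add: G_def)
    define \<delta> where "\<delta> = \<epsilon> / (4 * A * G)"
    have \<delta>: "0 < \<delta>" using \<epsilon> A G by (simp add: \<delta>_def)
    have Er: "E_set \<mu> \<phi> \<delta> r \<subseteq> cball 0 r" by (auto simp: E_set_def)
    obtain S' where S': "finite S'" "S' \<subseteq> S"
      "\<And>f. f \<in> S \<Longrightarrow> \<exists>g\<in>S'. \<forall>z\<in>E_set \<mu> \<phi> \<delta> r. cmod (f z - g z) \<le> \<epsilon> / (2 * Q)"
      using little_bloch_finite_net[OF \<omega> S Er E[OF \<delta> r(1,2)] r(1,2), of "\<epsilon> / (2 * Q)"] \<epsilon> Q(1) by auto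
    have "\<exists>g\<in>S'. cesaro \<phi> f \<in> M.mball (cesaro \<phi> g) \<epsilon>" if f: "f \<in> S" for f
    proof -
      obtain g where g: "g \<in> S'" "\<And>z. z \<in> E_set \<mu> \<phi> \<delta> r \<Longrightarrow> cmod (f z - g z) \<le> \<epsilon> / (2 * Q)"
        using S'(3)[OF f] by blast
      have gS: "g \<in> S" using g S' by blast
      have hol: "f \<in> hol_ball" "g \<in> hol_ball" using f gS S(1) little_blochD by blast+
      have TY: "cesaro \<phi> f \<in> ?Y" "cesaro \<phi> g \<in> ?Y" using T f gS S(1) by blast+
      have key: "?m z * cmod (f z - g z) \<le> \<epsilon> / 2" if z: "z \<in> ball 0 1" for z
      proof (cases "norm z \<le> r")
        case False
        have "?m z * cmod (f z - g z) \<le> ?m z * (2 * A * growth \<omega> (norm z))"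
          by (intro mult_left_mono fgA f gS z posm)
        also have "\<dots> = 2 * A * (?m z * growth \<omega> (norm z))" by (simp add: mult_ac)
        also have "\<dots> \<le> 2 * A * (\<epsilon> / (4 * A))"
          using r(3)[of z] False z A by (intro mult_left_mono) auto
        also have "\<dots> = \<epsilon> / 2" using A by simp
        finally show ?thesis .
      next
        case True
        show ?thesis
        proof (cases "?m z < \<delta>")
          case small: True
          have "growth \<omega> (norm z) \<le> G" unfolding G_def using True r by (intro growth_mono[OF \<omega>]) auto
          then have "2 * A * growth \<omega> (norm z) \<le> 2 * A * G" using A by (intro mult_left_mono) auto
          with fgA[OF f gS z] have "cmod (f z - g z) \<le> 2 * A * G" by (rule order_trans)
          then have "?m z * cmod (f z - g z) \<le> \<delta> * (2 * A * G)"
            using small posm[OF z] \<delta> by (intro mult_mono) auto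
          also have "\<dots> = \<epsilon> / 2" using A G by (simp add: \<delta>_def)
          finally show ?thesis .
        next
          case False
          \<comment> \<open>The witness s = 1 turns the condition in \<open>E_set\<close> into the
            case assumption.\<close>
          have "z \<in> E_set \<mu> \<phi> \<delta> r"
            using True False z r by (auto simp: E_set_def intro!: bexI[of _ 1] simp: one_le_inverse)
          then have "?m z * cmod (f z - g z) \<le> Q * (\<epsilon> / (2 * Q))"
            using g(2) Q posm[OF z] z by (intro mult_mono) auto
          then show ?thesis using Q(1) by simp
        qed
      qed
      \<comment> \<open>The modulus at 0 contributes nothing, because every image of the operator
        vanishes there; the remaining \<epsilon>/2 gives the strict inequality.\<close>
      have "bloch_norm \<mu> (\<lambda>z\<in>ball 0 1. cesaro \<phi> g z - cesaro \<phi> f z) \<le>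
        cmod ((\<lambda>z\<in>ball 0 1. cesaro \<phi> g z - cesaro \<phi> f z) 0) + \<epsilon> / 2"
      proof (rule bloch_norm_le)
        fix z :: 'a assume z: "z \<in> ball 0 1"
        have "radial_deriv (\<lambda>z\<in>ball 0 1. cesaro \<phi> g z - cesaro \<phi> f z) z = (g z - f z) * radial_deriv \<phi> z"
          using radial_deriv_diff[OF little_blochD[OF TY(2)] little_blochD[OF TY(1)] z]
            radial_deriv_cesaro[OF \<phi> hol(1) z] radial_deriv_cesaro[OF \<phi> hol(2) z]
          by (simp add: left_diff_distrib)
        then show "\<mu> (norm z) * cmod (radial_deriv (\<lambda>z\<in>ball 0 1. cesaro \<phi> g z - cesaro \<phi> f z) z) \<le> \<epsilon> / 2"
          using key[OF z] by (simp add: norm_mult norm_minus_commute mult_ac)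
      qed
      then have "fun_dist ?Y (bloch_norm \<mu>) (cesaro \<phi> g) (cesaro \<phi> f) < \<epsilon>"
        using TY \<epsilon> cesaro_zero[OF \<phi> hol(1)] cesaro_zero[OF \<phi> hol(2)] by (simp add: fun_dist_def)
      then show ?thesis using g(1) TY by (auto intro: bexI[of _ g])
    qed
    then show "\<exists>K. finite K \<and> K \<subseteq> cesaro \<phi> ` S \<and> cesaro \<phi> ` S \<subseteq> (\<Union>x\<in>K. M.mball x \<epsilon>)"
      using S'(1,2) by (intro exI[of _ "cesaro \<phi> ` S'"]) blast
  qed
qed

lemma cesaro_compact_if:
  fixes \<phi> :: "'a::complex_banach \<Rightarrow> complex"
  assumes \<omega>: "normal_weight \<omega>" and \<mu>: "normal_weight \<mu>" and \<phi>: "\<phi> \<in> hol_ball"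
    and E: "\<And>\<epsilon> \<rho>. 0 < \<epsilon> \<Longrightarrow> 0 < \<rho> \<Longrightarrow> \<rho> < 1 \<Longrightarrow>
      relatively_compact_in (top_of_set (ball 0 1)) (E_set \<mu> \<phi> \<epsilon> \<rho>)"
    and lim: "((\<lambda>z. \<mu> (norm z) * cmod (radial_deriv \<phi> z) * growth \<omega> (norm z)) \<longlongrightarrow> 0) to_sphere"
  shows "compact_linear_operator (little_bloch \<omega>) (bloch_norm \<omega>)
    (little_bloch \<mu>) (bloch_norm \<mu>) (cesaro \<phi>)"
  unfolding compact_linear_operator_def
proof (intro conjI ballI allI impI)
  interpret M: Metric_space "little_bloch \<mu> :: ('a \<Rightarrow> complex) set" "fun_dist (little_bloch \<mu>) (bloch_norm \<mu>)"
    by (rule Metric_space_little_bloch[OF \<mu>])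
  show "cesaro \<phi> \<in> little_bloch \<omega> \<rightarrow> little_bloch \<mu>"
    using cesaro_in_little_bloch[OF \<omega> \<mu> \<phi> lim] by blast
  show "cesaro \<phi> (\<lambda>z\<in>ball 0 1. f z + g z) = (\<lambda>z\<in>ball 0 1. cesaro \<phi> f z + cesaro \<phi> g z)"
    if "f \<in> little_bloch \<omega>" "g \<in> little_bloch \<omega>" for f g :: "'a \<Rightarrow> complex"
    using cesaro_add[OF \<phi> little_blochD little_blochD] that by blast
  show "cesaro \<phi> (\<lambda>z\<in>ball 0 1. c * f z) = (\<lambda>z\<in>ball 0 1. c * cesaro \<phi> f z)"
    if "f \<in> little_bloch \<omega>" for c and f :: "'a \<Rightarrow> complex"
    using cesaro_cmult[OF \<phi> little_blochD little_blochD] that by blast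
  fix S :: "('a \<Rightarrow> complex) set"
  assume S: "S \<subseteq> little_bloch \<omega>" and "\<exists>N. \<forall>f\<in>S. bloch_norm \<omega> f \<le> N"
  then obtain N where "\<And>f. f \<in> S \<Longrightarrow> bloch_norm \<omega> f \<le> N" by blast
  from cesaro_image_mtotally_bounded[OF \<omega> \<mu> \<phi> E lim S this]
  show "relatively_compact_in M.mtopology (cesaro \<phi> ` S)"
    using M.mtotally_bounded_eq_compact_closure_of[OF mcomplete_little_bloch[OF \<mu>]]
    by (simp add: relatively_compact_in_def)
qed

lemma cesaro_compact_only_if:
  fixes \<phi> :: "'a::complex_banach \<Rightarrow> complex"
  assumes \<omega>: "normal_weight \<omega>" and \<mu>: "normal_weight \<mu>" and \<phi>: "\<phi> \<in> hol_ball"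
    and T: "compact_linear_operator (little_bloch \<omega>) (bloch_norm \<omega>)
      (little_bloch \<mu>) (bloch_norm \<mu>) (cesaro \<phi>)"
  shows "((\<lambda>z. \<mu> (norm z) * cmod (radial_deriv \<phi> z) * integral {0..norm z} (\<lambda>t. 1 / \<omega> t))
    \<longlongrightarrow> 0) to_sphere"
proof -
  let ?Y = "little_bloch \<mu> :: ('a \<Rightarrow> complex) set"
  interpret M: Metric_space ?Y "fun_dist ?Y (bloch_norm \<mu>)"
    by (rule Metric_space_little_bloch[OF \<mu>])
  let ?m = "\<lambda>z. \<mu> (norm z) * cmod (radial_deriv \<phi> z)"
  obtain K where K: "0 < K" "\<And>z::'a. 1/2 \<le> norm z \<Longrightarrow> norm z < 1 \<Longrightarrow>
    \<exists>f\<in>little_bloch \<omega>. bloch_norm \<omega> f \<le> K \<and> growth \<omega> (norm z) \<le> K * cmod (f z)"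
    using little_bloch_test_function[OF \<omega>] by blast
  \<comment> \<open>A bounded set that contains the test functions of all points at once, so one
    finite net of its image serves every z near the sphere.\<close>
  define S where "S = {f :: 'a \<Rightarrow> complex. f \<in> little_bloch \<omega> \<and> bloch_norm \<omega> f \<le> K}"
  have TY: "cesaro \<phi> f \<in> ?Y" if "f \<in> S" for f
    using T that unfolding compact_linear_operator_def S_def by blast
  have "\<forall>S\<subseteq>little_bloch \<omega>. (\<exists>C. \<forall>f\<in>S. bloch_norm \<omega> f \<le> C) \<longrightarrow>
      relatively_compact_in M.mtopology (cesaro \<phi> ` S)"
    using T unfolding compact_linear_operator_def by (elim conjE)
  then have "relatively_compact_in M.mtopology (cesaro \<phi> ` S)"
    by (elim allE[of _ S]) (auto simp: S_def)
  then have tb: "M.mtotally_bounded (cesaro \<phi> ` S)"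
    by (intro M.compact_closure_of_imp_mtotally_bounded) (auto simp: relatively_compact_in_def)
  have "\<forall>\<^sub>F z::'a in to_sphere. norm (?m z * integral {0..norm z} (\<lambda>t. 1 / \<omega> t)) < \<epsilon>"
    if \<epsilon>: "0 < \<epsilon>" for \<epsilon>
  proof -
    \<comment> \<open>One e for the distance to the net element, one for the net element near the
      sphere, and the factor K for passing from |f(z)| to \<open>growth\<close>.\<close>
    define e where "e = \<epsilon> / (2 * K)"
    have e: "0 < e" using \<epsilon> K by (simp add: e_def)
    obtain F where F: "finite F" "F \<subseteq> cesaro \<phi> ` S" "cesaro \<phi> ` S \<subseteq> (\<Union>g\<in>F. M.mball g e)"
      using tb[unfolded M.mtotally_bounded_def, rule_format, OF e] by (elim exE conjE)
    \<comment> \<open>Each net element lies in the little space, and finitely many of them share a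
      radius beyond which all are small.\<close>
    have "\<forall>\<^sub>F z in to_sphere. \<forall>g\<in>F. \<mu> (norm z) * cmod (radial_deriv g z) < e"
    proof (intro eventually_ball_finite F(1) ballI)
      fix g assume "g \<in> F"
      then have "((\<lambda>z. \<mu> (norm z) * cmod (radial_deriv g z)) \<longlongrightarrow> 0) to_sphere"
        using F(2) TY by (auto simp: little_bloch_def)
      from order_tendstoD(2)[OF this e]
      show "\<forall>\<^sub>F z in to_sphere. \<mu> (norm z) * cmod (radial_deriv g z) < e" .
    qed
    moreover have "\<forall>\<^sub>F z::'a in to_sphere. 1/2 < norm z \<and> norm z < 1"
      unfolding eventually_to_sphere by (intro exI[of _ "1/2"]) auto
    ultimately show ?thesis
    proof eventually_elim
      case (elim z)
      then have z: "z \<in> ball 0 1" "1/2 < norm z" by auto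
      obtain f where f: "f \<in> little_bloch \<omega>" "bloch_norm \<omega> f \<le> K" "growth \<omega> (norm z) \<le> K * cmod (f z)"
        using K(2)[of z] z by auto
      have fS: "f \<in> S" using f by (simp add: S_def)
      then obtain g where g: "g \<in> F" "cesaro \<phi> f \<in> M.mball g e" using F(3) by blast
      let ?d = "\<lambda>z\<in>ball 0 1. g z - cesaro \<phi> f z"
      have gY: "g \<in> ?Y" using g F(2) TY by blast
      have "bloch_norm \<mu> ?d < e" using g(2) gY TY[OF fS] by (simp add: fun_dist_def)
      then have "\<mu> (norm z) * cmod (radial_deriv ?d z) < e"
        using bloch_norm_ge_deriv[OF \<mu> little_bloch_diff[OF \<mu> gY TY[OF fS]] z(1)] by linarith
      then have 1: "\<mu> (norm z) * cmod (radial_deriv g z - f z * radial_deriv \<phi> z) < e"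
        using radial_deriv_diff[OF little_blochD[OF gY] little_blochD[OF TY[OF fS]] z(1)]
          radial_deriv_cesaro[OF \<phi> little_blochD[OF f(1)] z(1)] by simp
      have 2: "\<mu> (norm z) * cmod (radial_deriv g z) < e" using elim(1) g(1) by blast
      have m0: "0 < \<mu> (norm z)" using normal_weight_pos[OF \<mu>, of "norm z"] z by simp
      have "\<mu> (norm z) * cmod (f z * radial_deriv \<phi> z) \<le> \<mu> (norm z) *
          (cmod (radial_deriv g z) + cmod (radial_deriv g z - f z * radial_deriv \<phi> z))"
        using m0 norm_triangle_ineq4[of "radial_deriv g z" "radial_deriv g z - f z * radial_deriv \<phi> z"]
        by (intro mult_left_mono) auto
      then have "\<mu> (norm z) * cmod (f z * radial_deriv \<phi> z) < 2 * e" using 1 2 by (simp add: distrib_left)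
      then have "K * (?m z * cmod (f z)) < K * (2 * e)"
        using K(1) by (intro mult_strict_left_mono) (simp_all add: norm_mult mult_ac)
      moreover have "K * (2 * e) = \<epsilon>" using K(1) by (simp add: e_def)
      moreover have "?m z * growth \<omega> (norm z) \<le> ?m z * (K * cmod (f z))"
        using m0 f(3) by (intro mult_left_mono) auto
      moreover have "?m z * integral {0..norm z} (\<lambda>t. 1 / \<omega> t) \<le> ?m z * growth \<omega> (norm z)"
        using m0 by (intro mult_left_mono) (auto simp: growth_def)
      ultimately have "?m z * integral {0..norm z} (\<lambda>t. 1 / \<omega> t) < \<epsilon>" by (simp add: mult_ac)
      moreover have "0 < norm z" using z(2) by linarith
      then have "0 < integral {0..norm z} (\<lambda>t. 1 / \<omega> t)"
        by (rule inverse_weight_integral_pos[OF \<omega>]) (use z(1) in simp)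
      then have "0 \<le> ?m z * integral {0..norm z} (\<lambda>t. 1 / \<omega> t)" using m0 by simp
      ultimately show ?case by simp
    qed
  qed
  then show ?thesis unfolding tendsto_iff dist_norm by simp
qed

theorem theorem4p3:
  fixes \<omega> \<mu> :: "real \<Rightarrow> real" and \<phi> :: "'a::complex_banach \<Rightarrow> complex"
  assumes "normal_weight \<omega>" and "normal_weight \<mu>" and "\<phi> \<in> hol_ball"
    and "\<And>\<epsilon> \<rho>. 0 < \<epsilon> \<Longrightarrow> 0 < \<rho> \<Longrightarrow> \<rho> < 1 \<Longrightarrow>
           relatively_compact_in (top_of_set (ball 0 1)) (E_set \<mu> \<phi> \<epsilon> \<rho>)"
  shows "compact_linear_operator (little_bloch \<omega>) (bloch_norm \<omega>)
           (little_bloch \<mu>) (bloch_norm \<mu>) (cesaro \<phi>)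
     \<longleftrightarrow> ((\<lambda>z. \<mu> (norm z) * cmod (radial_deriv \<phi> z) * integral {0..norm z} (\<lambda>t. 1 / \<omega> t))
            \<longlongrightarrow> 0) to_sphere"
  using cesaro_compact_only_if[OF assms(1-3)]
    cesaro_compact_if[OF assms cesaro_limit_imp_growth_limit[OF assms(1,2)]] by blast

end
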